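(* Let $k$ be a fixed positive integer. For each $n$, let $P_n,K_n$ be integers with $1\le K_n\le P_n$, and consider the uniform random intersection graph $G_u(n,P_n,K_n)$. Define the sequence $\alpha_n$ by $$\frac{K_n^2}{P_n}=\frac{\ln n+(k-1)\ln\ln n+\alpha_n}{n}.$$ If $K_n=\Omega\big(\sqrt{\ln n}\big)$, then $$\lim_{n\to\infty}\mathbb{P}[G_u(n,P_n,K_n)\text{ is }k\text{-connected}]=\begin{cases}0,&\text{if }\lim_{n\to\infty}\alpha_n=-\infty,\\ 1,&\text{if }\lim_{n\to\infty}\alpha_n=\infty,\\ e^{-\frac{e^{-\alpha^*}}{(k-1)!}},&\text{if }\lim_{n\to\infty}\alpha_n=\alpha^*\in(-\infty,\infty),\end{cases}$$ and $$\lim_{n\to\infty}\mathbb{P}[G_u(n,P_n,K_n)\text{ has minimum node degree at least }k]=\begin{cases}0,&\text{if }\lim_{n\to\infty}\alpha_n=-\infty,\\ 1,&\text{if }\lim_{n\to\infty}\alpha_n=\infty,\\ e^{-\frac{e^{-\alpha^*}}{(k-1)!}},&\text{if }\lim_{n\to\infty}\alpha_n=\alpha^*\in(-\infty,\infty).\end{cases}$$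
   Context: Uniform random intersection graph $G_u(n,P_n,K_n)$: node set $\{v_1,\dots,v_n\}$; there is a pool of $P_n$ distinct objects; independently for each node $v_i$, an object set $S_i$ is chosen uniformly at random among all $K_n$-element subsets of the pool. Two distinct nodes $v_i,v_j$ are joined by an undirected edge iff $S_i\cap S_j\neq\emptyset$. A graph is $k$-connected if every pair of nodes is joined by at least $k$ internally node-disjoint paths (equivalently, it cannot be disconnected by deleting at most $k-1$ nodes or edges). All parameters are sequences indexed by $n$, limits are as $n\to\infty$, $k$ does not depend on $n$, and $o,\omega,O,\Omega$ are standard Landau notation. *)

theory Defs
  imports "HOL-Probability.Probability" "HOL-Library.Landau_Symbols"
begin

text \<open>
  A finite simple undirected graph is given by its node set \<open>V\<close> and its set \<open>E\<close> of edges,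
  each edge being a two-element set of nodes.
\<close>

definition path_between :: "'a set \<Rightarrow> 'a set set \<Rightarrow> 'a \<Rightarrow> 'a list \<Rightarrow> 'a \<Rightarrow> bool" where
  "path_between V E u p v \<longleftrightarrow>
     p \<noteq> [] \<and> hd p = u \<and> last p = v \<and> set p \<subseteq> V \<and> distinct p \<and>
     successively (\<lambda>x y. {x, y} \<in> E) p"

text \<open>
  The paths form a set of node sequences, so a direct edge between \<open>u\<close> and \<open>v\<close>, which has no
  internal nodes, is counted only once.
\<close>

definition k_connected :: "nat \<Rightarrow> 'a set \<Rightarrow> 'a set set \<Rightarrow> bool" where
  "k_connected k V E \<longleftrightarrow>
     (\<forall>u\<in>V. \<forall>v\<in>V. u \<noteq> v \<longrightarrow>
        (\<exists>Q. finite Q \<and> card Q \<ge> k \<and> (\<forall>p\<in>Q. path_between V E u p v) \<and>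
             pairwise (\<lambda>p q. (set p - {u, v}) \<inter> (set q - {u, v}) = {}) Q))"

definition node_degree :: "'a set \<Rightarrow> 'a set set \<Rightarrow> 'a \<Rightarrow> nat" where
  "node_degree V E v = card {u \<in> V. u \<noteq> v \<and> {u, v} \<in> E}"

definition min_degree :: "'a set \<Rightarrow> 'a set set \<Rightarrow> nat" where
  "min_degree V E = Min (node_degree V E ` V)"

definition intersection_edges :: "nat \<Rightarrow> (nat \<Rightarrow> nat set) \<Rightarrow> nat set set" where
  "intersection_edges n S = {{i, j} | i j. i < n \<and> j < n \<and> i \<noteq> j \<and> S i \<inter> S j \<noteq> {}}"

text \<open>
  Distribution of the edge set of \<open>G\<^sub>u(n, P, K)\<close> on the nodes \<open>{..<n}\<close> with object pool
  \<open>{..<P}\<close>; it is meaningful for \<open>K \<le> P\<close>, when there are \<open>K\<close>-element subsets of the pool.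
\<close>

definition uniform_rig :: "nat \<Rightarrow> nat \<Rightarrow> nat \<Rightarrow> nat set set pmf" where
  "uniform_rig n P K =
     map_pmf (intersection_edges n)
       (Pi_pmf {..<n} {} (\<lambda>_. pmf_of_set {A. A \<subseteq> {..<P} \<and> card A = K}))"

end

theory Submission
  imports Defs "HOL-Real_Asymp.Real_Asymp"
begin

text \<open>
  Write \<open>\<theta> = K\<^sup>2 / P\<close>. Given the object sets of a set \<open>A\<close> of \<open>r\<close> nodes, with union \<open>U\<close>, the other
  nodes hit \<open>U\<close> independently, and they miss it with probability at most \<open>exp (- |U| K / P)\<close>. The
  defect \<open>r K - |U|\<close> has moment generating function at most \<open>exp ((t - 1) \<theta> r\<^sup>2)\<close>, so \<open>U\<close> is
  nearly as large as possible.

  Minimum degree: for a fixed number \<open>j\<close> of nodes, the probability that all of them have degree \<open>d\<close>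
  is asymptotically the \<open>j\<close>-th power of the Poisson weight \<open>(n \<theta>)\<^sup>d exp (- n \<theta>) / d!\<close>. Bonferroni's
  inequalities then give the Poisson limit, and the second moment method gives the limit \<open>0\<close>.

  Connectivity: by Menger's theorem, a graph of minimum degree at least \<open>k\<close> that is not
  \<open>k\<close>-connected has a set \<open>A\<close> of at most half of the nodes that spans an edge and has fewer than \<open>k\<close>
  outer neighbours. The edge forces a positive defect, which costs a power of \<open>n\<close> in the union bound
  over small \<open>A\<close>; large \<open>A\<close> are excluded because their sets \<open>U\<close> are too large to be avoided.
\<close>

section \<open>Menger's theorem\<close>

text \<open>The object sets of the nodes in \<open>A\<close> overlap, so conditioning on them costs
  a factor \<open>t = exp (K m / P)\<close> per unit of defect, with \<open>m\<close> close to
  \<open>n\<close>. Here \<open>K m / P \<le> n \<theta> / K\<close>, and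
  \<open>n \<theta> \<le> 3 ln n\<close> together with \<open>K \<ge> c \<surd>(ln n)\<close> keeps
  \<open>t\<close> below every power of \<open>n\<close>. This leaves room for an extra factor
  \<open>s = n powr (1/20)\<close> per unit of defect: a set with a positive defect gains
  \<open>1 / s\<close>, which outweighs the powers of \<open>ln n\<close> in the union bound. The
  bound \<open>n \<theta> \<le> 3 ln n\<close> does not follow from the hypotheses when \<alpha>
  tends to infinity. It is arranged by comparison with a larger pool: reducing objects modulo
  \<open>P\<close> can only create edges, so a pool of size \<open>M * P\<close> yields a lower
  bound for the probability of \<open>k\<close>-connectivity. When \<alpha> tends to minus infinity,
  \<open>n \<theta>\<close> may even stay bounded; isolated nodes then take the place of nodes of
  degree \<open>k - 1\<close>. Since such regimes may alternate along the sequence, the estimates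
  hold for all \<open>P\<close> and \<open>K\<close> once \<open>n\<close> is large, and cases are
  distinguished for each \<open>n\<close> separately.\<close>

definition walk_between :: "('a \<times> 'a) set \<Rightarrow> 'a set \<Rightarrow> 'a set \<Rightarrow> 'a list \<Rightarrow> bool" where
  "walk_between R A B p \<longleftrightarrow>
     p \<noteq> [] \<and> hd p \<in> A \<and> last p \<in> B \<and> successively (\<lambda>x y. (x, y) \<in> R) p"

text \<open>A separator may use vertices of \<open>A\<close> and \<open>B\<close>, and a vertex of
  \<open>A \<inter> B\<close> is a walk by itself. This set version of Menger's theorem lets the
  induction replace \<open>B\<close> or \<open>A\<close> by a separator without special cases for
  adjacent terminals.\<close>

definition separates :: "('a \<times> 'a) set \<Rightarrow> 'a set \<Rightarrow> 'a set \<Rightarrow> 'a set \<Rightarrow> bool" where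
  "separates R A B T \<longleftrightarrow> (\<forall>p. walk_between R A B p \<longrightarrow> set p \<inter> T \<noteq> {})"

text \<open>Every vertex of a walk except the last is the source of a step, so a walk that avoids
  \<open>x\<close> before its last position never uses the edge \<open>(x, y)\<close>.\<close>

lemma successively_remove_edge_source:
  assumes "successively (\<lambda>u v. (u, v) \<in> R) (p @ [z])" "x \<notin> set p"
  shows "successively (\<lambda>u v. (u, v) \<in> R - {(x, y)}) (p @ [z])"
  using assms
  by (auto simp: successively_conv_nth nth_append in_set_conv_nth split: if_splits)

lemma successively_remove_edge_target:
  assumes "successively (\<lambda>u v. (u, v) \<in> R) (z # p)" "y \<notin> set p"
  shows "successively (\<lambda>u v. (u, v) \<in> R - {(x, y)}) (z # p)"
  using assms
  by (auto simp: successively_conv_nth in_set_conv_nth split: if_splits)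

text \<open>Cutting the walk at its first vertex in \<open>Z\<close> keeps \<open>x\<close> out of
  all earlier positions, so the prefix survives the deletion of \<open>(x, y)\<close>. With
  \<open>Z\<close> a separator containing \<open>x\<close>, this turns a separator of
  \<open>A\<close> and \<open>Z\<close> after the deletion into one of \<open>A\<close> and
  \<open>B\<close> before it.\<close>

lemma walk_prefix_removing_edge:
  assumes "walk_between R A B p" "x \<in> Z" "set p \<inter> Z \<noteq> {}"
  shows "\<exists>p'. walk_between (R - {(x, y)}) A Z p' \<and> set p' \<subseteq> set p"
proof -
  obtain p1 z p2 where p: "p = p1 @ z # p2" "z \<in> Z" "\<forall>u\<in>set p1. u \<notin> Z"
    using split_list_first_prop[of p "\<lambda>u. u \<in> Z"] assms(3) by blast
  have "successively (\<lambda>u v. (u, v) \<in> R) ((p1 @ [z]) @ p2)"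
    using assms(1) p(1) by (simp add: walk_between_def)
  then have "successively (\<lambda>u v. (u, v) \<in> R) (p1 @ [z])"
    unfolding successively_append_iff by blast
  then have "successively (\<lambda>u v. (u, v) \<in> R - {(x, y)}) (p1 @ [z])"
    using successively_remove_edge_source p(3) assms(2) by metis
  then have "walk_between (R - {(x, y)}) A Z (p1 @ [z])"
    using assms(1) p by (cases p1) (auto simp: walk_between_def)
  then show ?thesis using p(1) by (intro exI[of _ "p1 @ [z]"]) auto
qed

lemma walk_suffix_removing_edge:
  assumes "walk_between R A B p" "y \<in> Z" "set p \<inter> Z \<noteq> {}"
  shows "\<exists>p'. walk_between (R - {(x, y)}) Z B p' \<and> set p' \<subseteq> set p"
proof -
  obtain p1 z p2 where p: "p = p1 @ z # p2" "z \<in> Z" "\<forall>u\<in>set p2. u \<notin> Z"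
    using split_list_last_prop[of p "\<lambda>u. u \<in> Z"] assms(3) by blast
  have "successively (\<lambda>u v. (u, v) \<in> R) (p1 @ (z # p2))"
    using assms(1) p(1) by (simp add: walk_between_def)
  then have "successively (\<lambda>u v. (u, v) \<in> R) (z # p2)"
    unfolding successively_append_iff by blast
  then have "successively (\<lambda>u v. (u, v) \<in> R - {(x, y)}) (z # p2)"
    using successively_remove_edge_target p(3) assms(2) by metis
  then have "walk_between (R - {(x, y)}) Z B (z # p2)"
    using assms(1) p by (auto simp: walk_between_def)
  then show ?thesis using p(1) by (intro exI[of _ "z # p2"]) auto
qed

text \<open>A walk that uses the deleted edge passes through both of its endpoints, so adding either
  endpoint repairs the separator.\<close>

lemma separates_insert_endpoint:
  assumes "separates (R - {(x, y)}) A B S"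
  shows "separates R A B (insert x S)" "separates R A B (insert y S)"
proof -
  have *: "set p \<inter> insert z S \<noteq> {}" if w: "walk_between R A B p" and z: "z = x \<or> z = y" for p z
  proof (rule ccontr)
    assume "\<not> set p \<inter> insert z S \<noteq> {}"
    then have d: "z \<notin> set p" "set p \<inter> S = {}" by auto
    have "successively (\<lambda>u v. (u, v) \<in> R - {(x, y)}) p"
      using w z d(1) unfolding walk_between_def successively_conv_nth
      by (auto dest: Suc_lessD)
    then have "walk_between (R - {(x, y)}) A B p" using w by (simp add: walk_between_def)
    then show False using assms d(2) by (auto simp: separates_def)
  qed
  show "separates R A B (insert x S)" "separates R A B (insert y S)"
    using * unfolding separates_def by blast+
qed

text \<open>
  Goering's proof, by induction on the number of edges: if deleting an edge \<open>(x, y)\<close> creates a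
  separator \<open>S\<close> with fewer than \<open>k\<close> nodes, then \<open>S \<union> {x}\<close> and \<open>S \<union> {y}\<close> are separators with
  exactly \<open>k\<close> nodes, and the paths that the induction provides from \<open>A\<close> to \<open>S \<union> {x}\<close> and
  from \<open>S \<union> {y}\<close> to \<open>B\<close> can only meet in \<open>S\<close>, so that they can be glued together.
\<close>

theorem menger:
  fixes R :: "('a \<times> 'a) set"
  assumes "finite R" "\<And>x. (x, x) \<notin> R" "finite A"
    and "\<And>T. finite T \<Longrightarrow> separates R A B T \<Longrightarrow> k \<le> card T"
  shows "\<exists>Q. finite Q \<and> card Q = k \<and> (\<forall>p\<in>Q. walk_between R A B p \<and> distinct p) \<and>
             pairwise (\<lambda>p q. set p \<inter> set q = {}) Q"
  using assms
proof (induction "card R" arbitrary: R A B rule: less_induct)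
  case less
  show ?case
  proof (cases "R = {}")
    case True
    \<comment> \<open>Without edges, every walk is a single vertex of
      \<open>A \<inter> B\<close>.\<close>
    have "separates R A B (A \<inter> B)"
      unfolding separates_def
    proof (intro allI impI)
      fix p assume w: "walk_between R A B p"
      then obtain a p' where p: "p = a # p'" by (cases p) (auto simp: walk_between_def)
      have "p' = []"
        using w p True by (cases p') (auto simp: walk_between_def)
      then show "set p \<inter> (A \<inter> B) \<noteq> {}" using w p by (auto simp: walk_between_def)
    qed
    then have "k \<le> card (A \<inter> B)" using less.prems(3,4) by blast
    then obtain Z where Z: "Z \<subseteq> A \<inter> B" "card Z = k" "finite Z"
      using obtain_subset_with_card_n by metis
    show ?thesis
      by (rule exI[of _ "(\<lambda>z. [z]) ` Z"])
        (use Z in \<open>auto simp: card_image inj_on_def walk_between_def pairwise_def\<close>)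
  next
    case False
    then obtain x y where xy: "(x, y) \<in> R" by auto
    define R' where "R' = R - {(x, y)}"
    have R': "card R' < card R" "finite R'" "\<And>x. (x, x) \<notin> R'"
      using less.prems(1,2) xy card_Diff1_less[of R "(x, y)"] unfolding R'_def by auto
    have xny: "x \<noteq> y" using less.prems(2) xy by auto
    have up: "walk_between R A B p" if "walk_between R' A B p" for A B p
      using that successively_mono[of "\<lambda>u v. (u, v) \<in> R'" p "\<lambda>u v. (u, v) \<in> R"]
      by (auto simp: walk_between_def R'_def)
    show ?thesis
    proof (cases "\<forall>T. finite T \<longrightarrow> separates R' A B T \<longrightarrow> k \<le> card T")
      case True
      from less.hyps[OF R' less.prems(3), of B] True show ?thesis using up by meson
    next
      case False
      then obtain S where S: "finite S" "separates R' A B S" "card S < k" by auto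
      note sep = separates_insert_endpoint[OF S(2)[unfolded R'_def]]
      have "k \<le> card (insert x S)" "k \<le> card (insert y S)"
        using less.prems(4)[OF _ sep(1)] less.prems(4)[OF _ sep(2)] S(1) by auto
      then have cS: "x \<notin> S" "y \<notin> S" "card (insert x S) = k" "card (insert y S) = k"
        using S(1,3) by (auto simp: card_insert_if split: if_splits)
      have 1: "k \<le> card T" if "finite T" "separates R' A (insert x S) T" for T
      proof (rule less.prems(4)[OF that(1)])
        show "separates R A B T"
          unfolding separates_def
        proof (intro allI impI)
          fix p assume w: "walk_between R A B p"
          obtain p' where "walk_between R' A (insert x S) p'" "set p' \<subseteq> set p"
            using walk_prefix_removing_edge[OF w, of x "insert x S" y] sep(1) w
            unfolding R'_def separates_def by blast
          then show "set p \<inter> T \<noteq> {}" using that(2) unfolding separates_def by blast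
        qed
      qed
      have 2: "k \<le> card T" if "finite T" "separates R' (insert y S) B T" for T
      proof (rule less.prems(4)[OF that(1)])
        show "separates R A B T"
          unfolding separates_def
        proof (intro allI impI)
          fix p assume w: "walk_between R A B p"
          obtain p' where "walk_between R' (insert y S) B p'" "set p' \<subseteq> set p"
            using walk_suffix_removing_edge[OF w, of y "insert y S" x] sep(2) w
            unfolding R'_def separates_def by blast
          then show "set p \<inter> T \<noteq> {}" using that(2) unfolding separates_def by blast
        qed
      qed
      obtain Q1 where Q1: "finite Q1" "card Q1 = k"
        "\<And>p. p \<in> Q1 \<Longrightarrow> walk_between R' A (insert x S) p \<and> distinct p"
        "pairwise (\<lambda>p q. set p \<inter> set q = {}) Q1"
        using less.hyps[OF R' less.prems(3), of "insert x S"] 1 by metis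
      have fyS: "finite (insert y S)" using S(1) by simp
      obtain Q2 where Q2: "finite Q2" "card Q2 = k"
        "\<And>p. p \<in> Q2 \<Longrightarrow> walk_between R' (insert y S) B p \<and> distinct p"
        "pairwise (\<lambda>p q. set p \<inter> set q = {}) Q2"
        using less.hyps[OF R' fyS, of B] 2 by metis
      have ne1: "p \<noteq> []" "last p \<in> insert x S" if "p \<in> Q1" for p
        using Q1(3)[OF that] by (auto simp: walk_between_def)
      have ne2: "p \<noteq> []" "hd p \<in> insert y S" if "p \<in> Q2" for p
        using Q2(3)[OF that] by (auto simp: walk_between_def)
      have inj1: "inj_on last Q1"
        using Q1(4) ne1(1) unfolding inj_on_def pairwise_def
        by (metis Int_iff empty_iff last_in_set)
      have inj2: "inj_on hd Q2"
        using Q2(4) ne2(1) unfolding inj_on_def pairwise_def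
        by (metis Int_iff empty_iff hd_in_set)
      \<comment> \<open>The \<open>k\<close> disjoint paths have \<open>k\<close> different last
        vertices, all in a set with \<open>k\<close> elements, so every vertex of
        \<open>insert x S\<close> ends exactly one path of \<open>Q1\<close>. The same holds for the
        first vertices of \<open>Q2\<close> and \<open>insert y S\<close>.\<close>
      have im1: "last ` Q1 = insert x S"
        by (rule card_subset_eq) (use ne1 S(1) card_image[OF inj1] Q1(2) cS in auto)
      have im2: "hd ` Q2 = insert y S"
        by (rule card_subset_eq) (use ne2 S(1) card_image[OF inj2] Q2(2) cS in auto)
      have "\<forall>s\<in>insert x S. \<exists>p. p \<in> Q1 \<and> last p = s" using im1 by (metis imageE)
      then obtain P1 where P1: "\<And>s. s \<in> insert x S \<Longrightarrow> P1 s \<in> Q1 \<and> last (P1 s) = s"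
        by metis
      have "\<forall>s\<in>insert y S. \<exists>p. p \<in> Q2 \<and> hd p = s" using im2 by (metis imageE)
      then obtain P2 where P2: "\<And>s. s \<in> insert y S \<Longrightarrow> P2 s \<in> Q2 \<and> hd (P2 s) = s"
        by metis
      \<comment> \<open>Each separator vertex ends a path of its own, so by disjointness a path of
        \<open>Q1\<close> meets \<open>insert x S\<close> in its last vertex alone.\<close>
      have only1: "z = s" if "s \<in> insert x S" "z \<in> insert x S" "z \<in> set (P1 s)" for s z
      proof -
        have "z \<in> set (P1 z)" using P1[OF that(2)] ne1(1) last_in_set by metis
        then have "P1 z = P1 s" using Q1(4) P1[OF that(1)] P1[OF that(2)] that(3)
          unfolding pairwise_def by blast
        then show ?thesis using P1[OF that(1)] P1[OF that(2)] by metis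
      qed
      have only2: "z = s" if "s \<in> insert y S" "z \<in> insert y S" "z \<in> set (P2 s)" for s z
      proof -
        have "z \<in> set (P2 z)" using P2[OF that(2)] ne2(1) hd_in_set by metis
        then have "P2 z = P2 s" using Q2(4) P2[OF that(1)] P2[OF that(2)] that(3)
          unfolding pairwise_def by blast
        then show ?thesis using P2[OF that(1)] P2[OF that(2)] by metis
      qed
      \<comment> \<open>Following \<open>P1 s\<close> up to \<open>z\<close> and
        \<open>P2 s'\<close> from there on gives a walk from \<open>A\<close> to \<open>B\<close>
        without the deleted edge, which must meet \<open>S\<close>. It can do so only at the end of
        \<open>P1 s\<close> or at the start of \<open>P2 s'\<close>; since both paths are distinct
        lists, the first case forces \<open>z\<close> to be that vertex and the second is
        impossible.\<close>
      have meet: "z \<in> S" if s: "s \<in> insert x S" "s' \<in> insert y S"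
        and z: "z \<in> set (P1 s)" "z \<in> set (P2 s')" for s s' z
      proof -
        obtain a b where ab: "P1 s = a @ z # b" using z(1) split_list by metis
        obtain c d where cd: "P2 s' = c @ z # d" using z(2) split_list by metis
        have w1: "walk_between R' A (insert x S) (P1 s)" using Q1(3) P1 s(1) by blast
        have w2: "walk_between R' (insert y S) B (P2 s')" using Q2(3) P2 s(2) by blast
        have "successively (\<lambda>u v. (u, v) \<in> R') ((a @ [z]) @ b)"
          using w1 ab by (simp add: walk_between_def)
        then have a: "successively (\<lambda>u v. (u, v) \<in> R') (a @ [z])"
          unfolding successively_append_iff by blast
        have "successively (\<lambda>u v. (u, v) \<in> R') (c @ z # d)"
          using w2 cd by (simp add: walk_between_def)
        then have d: "successively (\<lambda>u v. (u, v) \<in> R') (z # d)"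
          unfolding successively_append_iff by blast
        have "successively (\<lambda>u v. (u, v) \<in> R') (a @ z # d)"
          using a d by (auto simp: successively_append_iff)
        then have "walk_between R' A B (a @ z # d)"
          using w1 w2 ab cd by (cases a) (auto simp: walk_between_def)
        then obtain q where q: "q \<in> S" "q \<in> set (a @ z # d)"
          using S(2) unfolding separates_def by blast
        show ?thesis
        proof (cases "q \<in> set (a @ [z])")
          case True
          then have "q = s" using only1[OF s(1), of q] q ab by auto
          then have "q = last (P1 s)" using P1 s by auto
          moreover have "distinct (P1 s)" using Q1(3) P1 s by blast
          ultimately have "b = []" using True ab last_in_set[of b] by (cases "b = []") auto
          then show ?thesis using \<open>q = last (P1 s)\<close> q(1) ab by simp
        next
          case False
          then have qd: "q \<in> set d" using q by auto
          then have "q = s'" using only2[OF s(2), of q] q cd by auto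
          then have "q = hd (P2 s')" using P2 s by auto
          moreover have "distinct (P2 s')" using Q2(3) P2 s by blast
          ultimately have False using qd cd by (cases c) auto
          then show ?thesis ..
        qed
      qed
      \<comment> \<open>The path ending in \<open>x\<close> continues along the edge
        \<open>(x, y)\<close> into the path starting in \<open>y\<close>. Any other \<open>s\<close>
        ends one path and starts the other, and \<open>tl\<close> drops its second
        occurrence.\<close>
      define f where "f = (\<lambda>s. if s = x then y else s)"
      define c where "c = (\<lambda>s. if s = x then P1 x @ P2 y else P1 s @ tl (P2 s))"
      have f: "f s \<in> insert y S" if "s \<in> insert x S" for s using that by (auto simp: f_def)
      have setc: "set (c s) = set (P1 s) \<union> set (P2 (f s))" if "s \<in> insert x S" for s
      proof (cases "s = x")
        case False
        then have sS: "s \<in> S" using that by auto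
        have "s \<in> set (P1 s)" using P1[OF that] ne1(1) last_in_set by metis
        moreover have "P2 s \<noteq> []" "hd (P2 s) = s" using P2[of s] sS ne2(1) by auto
        then have "set (P2 s) = insert s (set (tl (P2 s)))" by (cases "P2 s") auto
        ultimately show ?thesis using False by (auto simp: c_def f_def)
      qed (auto simp: c_def f_def)
      have cw: "walk_between R A B (c s) \<and> distinct (c s)" if s: "s \<in> insert x S" for s
      proof -
        have w1: "walk_between R A (insert x S) (P1 s)" "distinct (P1 s)"
          using Q1(3) P1 s up by blast+
        have w2: "walk_between R (insert y S) B (P2 (f s))" "distinct (P2 (f s))"
          using Q2(3) P2 f[OF s] up by blast+
        have l: "last (P1 s) = s" "hd (P2 (f s)) = f s" using P1 P2 f s by auto
        show ?thesis
        proof (cases "s = x")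
          case True
          have "set (P1 s) \<inter> set (P2 (f s)) = {}"
          proof (rule ccontr)
            assume "\<not> ?thesis"
            then obtain z where z: "z \<in> set (P1 s)" "z \<in> set (P2 (f s))" by auto
            then have "z \<in> S" using meet s f by blast
            then have "z = s" using only1 s z by blast
            then show False using \<open>z \<in> S\<close> True cS by auto
          qed
          then show ?thesis using w1 w2 l True xy
            by (auto simp: c_def f_def walk_between_def successively_append_iff)
        next
          case False
          then have fs: "f s = s" "s \<in> S" using s by (auto simp: f_def)
          obtain d where d: "P2 s = s # d" using w2 l fs by (cases "P2 s") (auto simp: walk_between_def)
          have "set (P1 s) \<inter> set d = {}"
          proof (rule ccontr)
            assume "\<not> ?thesis"
            then obtain z where z: "z \<in> set (P1 s)" "z \<in> set d" by auto
            then have "z \<in> S" using meet[of s s z] s fs d by auto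
            then have "z = s" using only1 s z by blast
            then show False using z w2(2) fs d by auto
          qed
          moreover have "successively (\<lambda>u v. (u, v) \<in> R) (P1 s @ d)"
            using w1 w2 l fs d by (cases d) (auto simp: walk_between_def successively_append_iff)
          ultimately show ?thesis using w1 w2 l False fs d
            by (cases d) (auto simp: c_def walk_between_def)
        qed
      qed
      have disj: "set (c s) \<inter> set (c s') = {}"
        if s: "s \<in> insert x S" "s' \<in> insert x S" "s \<noteq> s'" for s s'
      proof -
        have "P1 s \<noteq> P1 s'" using P1 s by metis
        then have d1: "set (P1 s) \<inter> set (P1 s') = {}" using Q1(4) P1 s unfolding pairwise_def by blast
        have ff: "f s \<noteq> f s'" using s cS by (auto simp: f_def split: if_splits)
        then have "P2 (f s) \<noteq> P2 (f s')" using P2 f s by metis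
        then have d2: "set (P2 (f s)) \<inter> set (P2 (f s')) = {}"
          using Q2(4) P2 f s unfolding pairwise_def by blast
        have d3: "set (P1 s) \<inter> set (P2 (f s')) = {}"
          if s: "s \<in> insert x S" "s' \<in> insert x S" "s \<noteq> s'" for s s'
        proof (rule ccontr)
          assume "\<not> ?thesis"
          then obtain z where z: "z \<in> set (P1 s)" "z \<in> set (P2 (f s'))" by auto
          have "z \<in> S" using meet[OF s(1) f[OF s(2)] z] .
          then have "z = s" "z = f s'" using only1[OF s(1) _ z(1)] only2[OF f[OF s(2)] _ z(2)] by auto
          then show False using s cS \<open>z \<in> S\<close> by (auto simp: f_def split: if_splits)
        qed
        show ?thesis unfolding setc[OF s(1)] setc[OF s(2)]
          using d1 d2 d3[OF s] d3[OF s(2,1) s(3)[symmetric]] by auto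
      qed
      have cne: "c s \<noteq> []" if "s \<in> insert x S" for s
        using cw[OF that] by (simp add: walk_between_def)
      have injc: "inj_on c (insert x S)"
      proof (rule inj_onI, rule ccontr)
        fix s s' assume a: "s \<in> insert x S" "s' \<in> insert x S" "c s = c s'" "s \<noteq> s'"
        then show False using disj[OF a(1,2,4)] cne[OF a(1)] by auto
      qed
      have "pairwise (\<lambda>p q. set p \<inter> set q = {}) (c ` insert x S)"
        unfolding pairwise_def using disj by (metis imageE)
      then show ?thesis
        by (intro exI[of _ "c ` insert x S"])
          (use cw S(1) cS(3) card_image[OF injc] in auto)
    qed
  qed
qed

section \<open>Connectivity and small vertex cuts\<close>

text \<open>Monotonicity under additional edges is what the comparison of two object pools requires
  of a graph property.\<close>

lemma k_connected_mono:
  assumes "k_connected k V E" "E \<subseteq> E'"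
  shows "k_connected k V E'"
proof -
  have "path_between V E' u p v" if "path_between V E u p v" for u p v
    using that assms(2) unfolding path_between_def
    by (auto elim!: successively_mono)
  with assms(1) show ?thesis unfolding k_connected_def by meson
qed

text \<open>The second nodes of internally disjoint paths from \<open>v\<close> to some other node
  \<open>w\<close> are distinct neighbours of \<open>v\<close>: two paths can share a second node
  only if it is \<open>w\<close>, and then both are the direct edge. A second node must exist, since
  on a single node \<open>k\<close>-connectivity holds vacuously.\<close>

lemma k_connected_imp_node_degree:
  assumes fin: "finite V" and two: "card V \<ge> 2" and conn: "k_connected k V E" and v: "v \<in> V"
  shows "node_degree V E v \<ge> k"
proof -
  have "V - {v} \<noteq> {}"
  proof
    assume "V - {v} = {}"
    then have "card V \<le> card {v}" by (intro card_mono) auto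
    with two show False by simp
  qed
  then obtain w where w: "w \<in> V" "w \<noteq> v" by auto
  obtain Q where Q: "finite Q" "card Q \<ge> k" "\<And>p. p \<in> Q \<Longrightarrow> path_between V E v p w"
    "pairwise (\<lambda>p q. (set p - {v, w}) \<inter> (set q - {v, w}) = {}) Q"
    using conn v w unfolding k_connected_def by (metis (no_types, lifting))
  have shape: "\<exists>x r. p = v # x # r \<and> x \<in> V \<and> x \<noteq> v \<and> {v, x} \<in> E \<and> (x = w \<longrightarrow> r = [])"
    if "p \<in> Q" for p
  proof -
    have pb: "path_between V E v p w" using Q(3) that by auto
    obtain p' where p': "p = v # p'" using pb by (cases p) (auto simp: path_between_def)
    obtain x r where r: "p' = x # r" using pb w p' by (cases p') (auto simp: path_between_def)
    have "x = w \<longrightarrow> r = []" using pb p' r last_in_set[of r]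
      by (auto simp: path_between_def split: if_splits)
    then show ?thesis using pb p' r by (auto simp: path_between_def)
  qed
  have "inj_on (\<lambda>p. p ! 1) Q"
  proof (rule inj_onI)
    fix p q assume pq: "p \<in> Q" "q \<in> Q" "p ! 1 = q ! 1"
    obtain x r where p: "p = v # x # r" "x \<noteq> v" "x = w \<longrightarrow> r = []" using shape pq(1) by blast
    obtain y s where q: "q = v # y # s" "y \<noteq> v" "y = w \<longrightarrow> s = []" using shape pq(2) by blast
    have xy: "x = y" using pq(3) p q by simp
    show "p = q"
    proof (cases "x = w")
      case True then show ?thesis using p q xy by simp
    next
      case False
      then have "x \<in> (set p - {v, w}) \<inter> (set q - {v, w})" using p q xy by auto
      then show ?thesis using Q(4) pq unfolding pairwise_def by blast
    qed
  qed
  moreover have "(\<lambda>p. p ! 1) ` Q \<subseteq> {u \<in> V. u \<noteq> v \<and> {u, v} \<in> E}"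
  proof
    fix x assume "x \<in> (\<lambda>p. p ! 1) ` Q"
    then obtain p where p: "p \<in> Q" "x = p ! 1" by auto
    then show "x \<in> {u \<in> V. u \<noteq> v \<and> {u, v} \<in> E}"
      using shape[OF p(1)] by (auto simp: insert_commute)
  qed
  ultimately have "card Q \<le> card {u \<in> V. u \<noteq> v \<and> {u, v} \<in> E}"
    using fin by (intro card_inj_on_le) auto
  then show ?thesis using Q(2) unfolding node_degree_def by simp
qed

definition boundary :: "'a set \<Rightarrow> 'a set set \<Rightarrow> 'a set \<Rightarrow> 'a set" where
  "boundary V E A = {w \<in> V - A. \<exists>a\<in>A. {a, w} \<in> E}"

text \<open>If \<open>A\<close> spans no edge, all neighbours of a node of \<open>A\<close> lie in
  the boundary, which is too small for them.\<close>

lemma small_boundary_contains_edge: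
  assumes fin: "finite V" and deg: "\<forall>v\<in>V. node_degree V E v \<ge> k"
    and A: "A \<subseteq> V" "A \<noteq> {}" "card (boundary V E A) < k"
  shows "\<exists>a\<in>A. \<exists>b\<in>A. a \<noteq> b \<and> {a, b} \<in> E"
proof (rule ccontr)
  assume no: "\<not> ?thesis"
  obtain a where a: "a \<in> A" using A by auto
  have "{u \<in> V. u \<noteq> a \<and> {u, a} \<in> E} \<subseteq> boundary V E A"
    using no a by (auto simp: boundary_def insert_commute)
  then have "node_degree V E a \<le> card (boundary V E A)"
    unfolding node_degree_def using fin by (intro card_mono) (auto simp: boundary_def)
  then show False using deg a A by fastforce
qed

lemma successively_set_subset:
  assumes "successively (\<lambda>x y. (x, y) \<in> R) p" "p \<noteq> []" "hd p \<in> W" "R \<subseteq> W \<times> W"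
  shows "set p \<subseteq> W"
  using assms
proof (induction p)
  case (Cons a p)
  then have "p \<noteq> [] \<longrightarrow> (a, hd p) \<in> R \<and> successively (\<lambda>x y. (x, y) \<in> R) p"
    by (auto simp: successively_Cons)
  then have "p \<noteq> [] \<longrightarrow> set p \<subseteq> W" using Cons.IH Cons.prems(4) by blast
  then show ?case using Cons.prems(3) by (cases p) auto
qed simp

text \<open>Menger's theorem is applied in the graph without \<open>u\<close> and \<open>v\<close>,
  between the neighbours of \<open>u\<close> and those of \<open>v\<close>. A small separator
  \<open>T\<close> then exists, and the nodes reachable from the neighbours of \<open>u\<close>
  without touching \<open>T\<close> form one side of the cut.\<close>

lemma not_k_connected_imp_cut:
  assumes fin: "finite V" and deg: "\<forall>v\<in>V. node_degree V E v \<ge> k"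
    and nconn: "\<not> k_connected k V E"
  shows "\<exists>X v. X \<subseteq> V \<and> X \<noteq> {} \<and> v \<in> V - X - boundary V E X \<and> card (boundary V E X) < k"
proof -
  obtain u v where uv: "u \<in> V" "v \<in> V" "u \<noteq> v"
    and noQ: "\<And>Q. finite Q \<Longrightarrow> card Q \<ge> k \<Longrightarrow> \<forall>p\<in>Q. path_between V E u p v \<Longrightarrow>
             pairwise (\<lambda>p q. (set p - {u, v}) \<inter> (set q - {u, v}) = {}) Q \<Longrightarrow> False"
    using nconn unfolding k_connected_def by metis
  define W where "W = V - {u, v}"
  define R where "R = {(x, y). x \<in> W \<and> y \<in> W \<and> x \<noteq> y \<and> {x, y} \<in> E}"
  define A0 where "A0 = {x \<in> W. {u, x} \<in> E}"
  define B0 where "B0 = {x \<in> W. {x, v} \<in> E}"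
  define adj where "adj \<longleftrightarrow> {u, v} \<in> E"
  \<comment> \<open>A direct edge already is one of the \<open>k\<close> paths, so for adjacent
    \<open>u\<close> and \<open>v\<close> only \<open>k - 1\<close> further ones would be
    needed.\<close>
  define k' where "k' = (if adj then k - 1 else k)"
  have RW: "R \<subseteq> W \<times> W" by (auto simp: R_def)
  have finW: "finite W" using fin by (simp add: W_def)
  have finR: "finite R" using finite_subset[OF RW] finW by simp
  have walkW: "set p \<subseteq> W" if "walk_between R A0 B p" for p B
    using that successively_set_subset[OF _ _ _ RW] by (auto simp: walk_between_def A0_def)
  have "\<exists>T. finite T \<and> separates R A0 B0 T \<and> card T < k'"
  proof (rule ccontr)
    assume "\<not> ?thesis"
    then have "\<And>T. finite T \<Longrightarrow> separates R A0 B0 T \<Longrightarrow> k' \<le> card T" by force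
    then obtain Q where Q: "finite Q" "card Q = k'"
      "\<And>p. p \<in> Q \<Longrightarrow> walk_between R A0 B0 p \<and> distinct p" "pairwise (\<lambda>p q. set p \<inter> set q = {}) Q"
      using menger[OF finR, of A0 B0 k'] finW by (auto simp: R_def A0_def)
    define Q' where "Q' = (\<lambda>p. u # p @ [v]) ` Q"
    define Q'' where "Q'' = Q' \<union> (if adj then {[u, v]} else {})"
    have cQ': "card Q' = k'" "finite Q'" unfolding Q'_def
      using Q by (auto simp: card_image inj_on_def)
    have "[u, v] \<notin> Q'" using Q(3) by (auto simp: Q'_def walk_between_def)
    then have "card Q'' \<ge> k" "finite Q''" using cQ' by (auto simp: Q''_def k'_def)
    moreover have "\<forall>p\<in>Q''. path_between V E u p v"
    proof
      fix p assume "p \<in> Q''"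
      then consider (a) "p = [u, v]" "adj" | (b) q where "q \<in> Q" "p = u # q @ [v]"
        by (auto simp: Q''_def Q'_def split: if_splits)
      then show "path_between V E u p v"
      proof cases
        case a then show ?thesis using uv by (auto simp: path_between_def adj_def)
      next
        case b
        have w: "walk_between R A0 B0 q" "distinct q" using Q(3) b by auto
        have sq: "set q \<subseteq> W" using walkW w by blast
        have "successively (\<lambda>x y. {x, y} \<in> E) q"
          using w(1) unfolding walk_between_def
          by (elim conjE, elim successively_mono) (auto simp: R_def)
        then have "successively (\<lambda>x y. {x, y} \<in> E) (u # q @ [v])"
          using w(1) by (auto simp: successively_Cons successively_append_iff walk_between_def A0_def B0_def)
        then show ?thesis using sq w b uv by (auto simp: path_between_def W_def)
      qed
    qed
    moreover have "pairwise (\<lambda>p q. (set p - {u, v}) \<inter> (set q - {u, v}) = {}) Q''"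
      using Q(4) by (fastforce simp: pairwise_def Q''_def Q'_def)
    ultimately show False using noQ by blast
  qed
  then obtain T where T: "finite T" "separates R A0 B0 T" "card T < k'" by blast
  define C where "C = {z. \<exists>p. walk_between R A0 {z} p \<and> set p \<inter> T = {}}"
  have CW: "C \<subseteq> W"
  proof
    fix z assume "z \<in> C"
    then obtain p where p: "walk_between R A0 {z} p" by (auto simp: C_def)
    then have "z \<in> set p" by (auto simp: walk_between_def)
    then show "z \<in> W" using walkW[OF p] by auto
  qed
  have CB: "z \<notin> B0" if "z \<in> C" for z
  proof
    assume "z \<in> B0"
    obtain p where p: "walk_between R A0 {z} p" "set p \<inter> T = {}" using \<open>z \<in> C\<close> by (auto simp: C_def)
    then have "walk_between R A0 B0 p" using \<open>z \<in> B0\<close> by (auto simp: walk_between_def)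
    then show False using T(2) p by (auto simp: separates_def)
  qed
  have Ccl: "w \<in> C" if zw: "z \<in> C" "(z, w) \<in> R" "w \<notin> T" for z w
  proof -
    obtain p where p: "walk_between R A0 {z} p" "set p \<inter> T = {}" using \<open>z \<in> C\<close> by (auto simp: C_def)
    then have "walk_between R A0 {w} (p @ [w])"
      using zw by (auto simp: walk_between_def successively_append_iff)
    then show ?thesis using p zw unfolding C_def by (auto intro!: exI[of _ "p @ [w]"])
  qed
  have CA: "w \<in> C" if "w \<in> A0" "w \<notin> T" for w
    using that unfolding C_def by (auto intro!: exI[of _ "[w]"] simp: walk_between_def)
  \<comment> \<open>For adjacent \<open>u\<close> and \<open>v\<close>, putting \<open>u\<close>
    into \<open>X\<close> would put \<open>v\<close> into the boundary. So \<open>u\<close> stays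
    outside and is counted in the boundary together with \<open>T\<close>; the smaller size
    \<open>k' = k - 1\<close> makes up for it.\<close>
  define X where "X = (if adj then C else insert u C)"
  have XV: "X \<subseteq> V" using CW uv by (auto simp: X_def W_def)
  have vX: "v \<notin> X" using CW uv by (auto simp: X_def W_def)
  have vb: "v \<notin> boundary V E X"
  proof
    assume "v \<in> boundary V E X"
    then obtain a where a: "a \<in> X" "{a, v} \<in> E" by (auto simp: boundary_def)
    show False
    proof (cases "a \<in> C")
      case True then show False using CB CW a by (auto simp: B0_def)
    next
      case False
      then have "a = u" "\<not> adj" using a by (auto simp: X_def split: if_splits)
      then show False using a by (auto simp: adj_def)
    qed
  qed
  have bX: "boundary V E X \<subseteq> (if adj then insert u T else T)"
  proof
    fix w assume w: "w \<in> boundary V E X"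
    then have wv: "w \<noteq> v" using vb by auto
    obtain a where a: "a \<in> X" "{a, w} \<in> E" and wX: "w \<in> V" "w \<notin> X" using w by (auto simp: boundary_def)
    show "w \<in> (if adj then insert u T else T)"
    proof (cases "w = u")
      case True then show ?thesis using wX by (auto simp: X_def split: if_splits)
    next
      case False
      then have wW: "w \<in> W" using wX wv by (simp add: W_def)
      have "w \<notin> C" using wX by (auto simp: X_def split: if_splits)
      have "w \<in> T"
      proof (cases "a \<in> C")
        case True
        then have "(a, w) \<in> R" using CW wW a \<open>w \<notin> C\<close> by (auto simp: R_def)
        then show ?thesis using Ccl True \<open>w \<notin> C\<close> by blast
      next
        case False
        then have "a = u" using a by (auto simp: X_def split: if_splits)
        then have "w \<in> A0" using a wW by (auto simp: A0_def)
        then show ?thesis using CA \<open>w \<notin> C\<close> by blast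
      qed
      then show ?thesis by simp
    qed
  qed
  have "card (boundary V E X) < k"
  proof (cases adj)
    case True
    then have "card (boundary V E X) \<le> card (insert u T)" using bX T(1) by (intro card_mono) auto
    also have "\<dots> \<le> Suc (card T)" by (rule card_insert_le_m1) auto
    finally show ?thesis using T(3) True by (simp add: k'_def)
  next
    case False
    then have "card (boundary V E X) \<le> card T" using bX T(1) by (intro card_mono) auto
    then show ?thesis using T(3) False by (simp add: k'_def)
  qed
  \<comment> \<open>When \<open>u\<close> is left out of \<open>X\<close>, the degree condition is
    what saves non-emptiness: \<open>u\<close> has at least \<open>k - 1\<close> neighbours other
    than \<open>v\<close>, too many to lie all in \<open>T\<close>.\<close>
  moreover have "X \<noteq> {}"
  proof (cases adj)
    case True
    have "k \<le> node_degree V E u" using deg uv by auto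
    also have "\<dots> \<le> card (insert v A0)" unfolding node_degree_def
      using finW by (intro card_mono) (auto simp: A0_def W_def insert_commute)
    also have "\<dots> \<le> Suc (card A0)" by (rule card_insert_le_m1) auto
    finally have "card T < card A0" using T(3) True by (simp add: k'_def)
    then have "\<not> A0 \<subseteq> T" using card_mono[OF T(1)] by (metis leD)
    then show ?thesis using CA True by (auto simp: X_def)
  qed (auto simp: X_def)
  ultimately show ?thesis using XV vX vb uv by (intro exI[of _ X] exI[of _ v]) auto
qed

text \<open>The far side \<open>Y\<close> of the cut has its boundary inside the boundary of
  \<open>X\<close>, so both sides qualify, and one of two disjoint sets has at most half of the
  nodes. The edge inside it comes from the degree condition.\<close>

lemma not_k_connected_imp_small_boundary:
  assumes fin: "finite V" and deg: "\<forall>v\<in>V. node_degree V E v \<ge> k"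
    and nconn: "\<not> k_connected k V E"
  shows "\<exists>A\<subseteq>V. 2 * card A \<le> card V \<and> card (boundary V E A) < k \<and>
           (\<exists>a\<in>A. \<exists>b\<in>A. a \<noteq> b \<and> {a, b} \<in> E)"
proof -
  obtain X v where X: "X \<subseteq> V" "X \<noteq> {}" "v \<in> V - X - boundary V E X" "card (boundary V E X) < k"
    using not_k_connected_imp_cut[OF assms] by blast
  define Y where "Y = V - X - boundary V E X"
  have Y: "Y \<subseteq> V" "Y \<noteq> {}" using X by (auto simp: Y_def)
  have "boundary V E Y \<subseteq> boundary V E X"
  proof
    fix w assume "w \<in> boundary V E Y"
    then obtain y where y: "y \<in> Y" "{y, w} \<in> E" "w \<in> V" "w \<notin> Y" by (auto simp: boundary_def)
    have "w \<notin> X"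
    proof
      assume "w \<in> X"
      then have "y \<in> boundary V E X"
        using y by (auto simp: boundary_def Y_def insert_commute intro!: bexI[of _ w])
      then show False using y by (auto simp: Y_def)
    qed
    then show "w \<in> boundary V E X" using y by (auto simp: Y_def)
  qed
  then have "card (boundary V E Y) \<le> card (boundary V E X)"
    using fin by (intro card_mono) (auto simp: boundary_def)
  then have cY: "card (boundary V E Y) < k" using X(4) by simp
  have "card X + card Y = card (X \<union> Y)"
    using fin X(1) Y(1) by (intro card_Un_disjoint[symmetric]) (auto simp: Y_def intro: finite_subset)
  also have "\<dots> \<le> card V" using fin X Y by (intro card_mono) auto
  finally have "2 * card X \<le> card V \<or> 2 * card Y \<le> card V" by linarith
  then show ?thesis
    using small_boundary_contains_edge[OF fin deg] X Y cY by metis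
qed

lemma intersection_edges_iff:
  "{a, b} \<in> intersection_edges n S \<longleftrightarrow> a < n \<and> b < n \<and> a \<noteq> b \<and> S a \<inter> S b \<noteq> {}"
  unfolding intersection_edges_def by (auto simp: doubleton_eq_iff)

lemma min_degree_ge_iff:
  fixes n :: nat
  assumes "n \<ge> 1"
  shows "min_degree {..<n} E \<ge> k \<longleftrightarrow> (\<forall>v\<in>{..<n}. node_degree {..<n} E v \<ge> k)"
proof -
  have "0 \<in> {..<n}" using assms by simp
  then have "{..<n} \<noteq> {}" by blast
  then show ?thesis unfolding min_degree_def by (subst Min_ge_iff) auto
qed

section \<open>Finitely supported distributions and products\<close>

abbreviation expect :: "'a pmf \<Rightarrow> ('a \<Rightarrow> real) \<Rightarrow> real" where
  "expect p f \<equiv> measure_pmf.expectation p f"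

lemma expect_mono:
  assumes "finite (set_pmf p)" "\<And>x. x \<in> set_pmf p \<Longrightarrow> f x \<le> g x"
  shows "expect p f \<le> expect p g"
  using assms by (intro integral_mono_AE) (auto simp: AE_measure_pmf_iff integrable_measure_pmf_finite)

lemma prob_eq_expect: "measure_pmf.prob p A = expect p (\<lambda>x. of_bool (x \<in> A))"
proof -
  have "(\<lambda>x. of_bool (x \<in> A) :: real) = indicator A" by (auto simp: indicator_def)
  then show ?thesis by simp
qed

lemma prob_mono:
  assumes "\<And>x. x \<in> set_pmf p \<Longrightarrow> x \<in> A \<Longrightarrow> x \<in> B"
  shows "measure_pmf.prob p A \<le> measure_pmf.prob p B"
  using assms by (intro measure_pmf.finite_measure_mono_AE) (auto simp: AE_measure_pmf_iff)

lemma prob_le_sum: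
  assumes "finite I" "\<And>x. x \<in> set_pmf p \<Longrightarrow> x \<in> A \<Longrightarrow> \<exists>i\<in>I. x \<in> B i"
  shows "measure_pmf.prob p A \<le> (\<Sum>i\<in>I. measure_pmf.prob p (B i))"
proof -
  have "measure_pmf.prob p A \<le> measure_pmf.prob p (\<Union>i\<in>I. B i)"
    using assms(2) by (intro prob_mono) auto
  also have "\<dots> \<le> (\<Sum>i\<in>I. measure_pmf.prob p (B i))"
    by (rule measure_pmf.finite_measure_subadditive_finite) (use assms(1) in auto)
  finally show ?thesis .
qed

text \<open>Fubini in both orders: the first serves to reveal the coordinates of a node set before
  the others, the second to add one node to an already revealed family.\<close>

lemma expect_pair_pmf:
  assumes "finite (set_pmf p)" "finite (set_pmf q)"
  shows "expect (pair_pmf p q) f = expect p (\<lambda>x. expect q (\<lambda>y. f (x, y)))"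
    and "expect (pair_pmf p q) f = expect q (\<lambda>y. expect p (\<lambda>x. f (x, y)))"
proof -
  have "expect (pair_pmf p q) f = (\<Sum>z\<in>set_pmf p \<times> set_pmf q. f z * pmf (pair_pmf p q) z)"
    by (rule integral_measure_pmf_real) (use assms in auto)
  also have "\<dots> = (\<Sum>x\<in>set_pmf p. \<Sum>y\<in>set_pmf q. f (x, y) * (pmf p x * pmf q y))"
    unfolding sum.cartesian_product by (rule sum.cong) (auto simp: pmf_pair)
  finally have 1: "expect (pair_pmf p q) f =
      (\<Sum>x\<in>set_pmf p. \<Sum>y\<in>set_pmf q. f (x, y) * (pmf p x * pmf q y))" .
  have 2: "expect p g = (\<Sum>x\<in>set_pmf p. g x * pmf p x)" for g
    by (rule integral_measure_pmf_real) (use assms in auto)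
  have 3: "expect q g = (\<Sum>x\<in>set_pmf q. g x * pmf q x)" for g
    by (rule integral_measure_pmf_real) (use assms in auto)
  show "expect (pair_pmf p q) f = expect p (\<lambda>x. expect q (\<lambda>y. f (x, y)))"
    unfolding 1 2 3 by (simp add: sum_distrib_left sum_distrib_right mult_ac)
  show "expect (pair_pmf p q) f = expect q (\<lambda>y. expect p (\<lambda>x. f (x, y)))"
    unfolding 1 2 3 by (subst sum.swap) (simp add: sum_distrib_left sum_distrib_right mult_ac)
qed

section \<open>Independent families and the number of hits among them\<close>

lemma finite_set_Pi_pmf:
  assumes "finite A" "\<And>x. x \<in> A \<Longrightarrow> finite (set_pmf (p x))"
  shows "finite (set_pmf (Pi_pmf A d p))"
proof -
  have "set_pmf (Pi_pmf A d p) \<subseteq> PiE_dflt A d (\<lambda>x. set_pmf (p x))"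
    using set_Pi_pmf_subset'[OF assms(1)] by (simp add: o_def)
  then show ?thesis using finite_PiE_dflt[of A "\<lambda>x. set_pmf (p x)" d] assms finite_subset by blast
qed

text \<open>The coordinates in \<open>A\<close> are revealed before the others: the inner
  probability is taken over the coordinates in \<open>B\<close> with the values \<open>f\<close> on
  \<open>A\<close> frozen.\<close>

lemma prob_Pi_pmf_union:
  assumes "finite A" "finite B" "A \<inter> B = {}" "\<And>x. finite (set_pmf (p x))"
  shows "measure_pmf.prob (Pi_pmf (A \<union> B) d p) X =
           expect (Pi_pmf A d p)
             (\<lambda>f. measure_pmf.prob (Pi_pmf B d p) {g. (\<lambda>x. if x \<in> A then f x else g x) \<in> X})"
proof -
  have "measure_pmf.prob (Pi_pmf (A \<union> B) d p) X =
      expect (pair_pmf (Pi_pmf A d p) (Pi_pmf B d p))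
        (\<lambda>(f, g). of_bool ((\<lambda>x. if x \<in> A then f x else g x) \<in> X))"
    unfolding prob_eq_expect by (subst Pi_pmf_union[OF assms(1-3)]) (simp add: case_prod_unfold)
  also have "\<dots> = expect (Pi_pmf A d p) (\<lambda>f. expect (Pi_pmf B d p)
      (\<lambda>g. of_bool ((\<lambda>x. if x \<in> A then f x else g x) \<in> X)))"
    by (subst expect_pair_pmf(1)) (auto intro!: finite_set_Pi_pmf assms)
  finally show ?thesis by (simp add: prob_eq_expect)
qed

lemma set_Pi_pmf_component:
  assumes "finite A" "f \<in> set_pmf (Pi_pmf A d p)" "x \<in> A"
  shows "f x \<in> set_pmf (p x)"
  using set_Pi_pmf_subset'[OF assms(1), of d p] assms(2,3) by (auto simp: PiE_dflt_def)

lemma prob_Pi_pmf_component: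
  assumes "finite A" "x \<in> A"
  shows "measure_pmf.prob (Pi_pmf A d p) {g. g x \<in> H} = measure_pmf.prob (p x) H"
proof -
  have "measure_pmf.prob (p x) H = measure_pmf.prob (map_pmf (\<lambda>f. f x) (Pi_pmf A d p)) H"
    using assms by (simp add: Pi_pmf_component)
  then show ?thesis by (simp add: vimage_def)
qed

text \<open>A union bound over the exact set \<open>W\<close> of hits: it contributes at most
  \<open>x ^ card W * y ^ (card B - card W)\<close>, and \<open>y \<le> 1\<close> allows the
  exponent of \<open>y\<close> to be lowered to \<open>card B - q\<close>. Hits and misses have
  separate bounds \<open>x\<close> and \<open>y\<close>, so that both can be replaced by convenient
  upper estimates.\<close>

lemma prob_iid_card_le:
  fixes p :: "'b pmf" and B :: "'a set"
  assumes fin: "finite B" and x: "measure_pmf.prob p H \<le> x"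
    and y: "measure_pmf.prob p (- H) \<le> y" "y \<le> 1"
  shows "measure_pmf.prob (Pi_pmf B d (\<lambda>_. p)) {g. card {w \<in> B. g w \<in> H} \<le> q}
     \<le> (\<Sum>i\<le>q. real (card B choose i) * x ^ i) * y ^ (card B - q)"
proof -
  have x0: "0 \<le> x" using x measure_nonneg order_trans by blast
  have y0: "0 \<le> y" using y measure_nonneg order_trans by blast
  define I where "I = {W. W \<subseteq> B \<and> card W \<le> q}"
  have finI: "finite I" using fin by (simp add: I_def)
  have "measure_pmf.prob (Pi_pmf B d (\<lambda>_. p)) {g. card {w \<in> B. g w \<in> H} \<le> q}
      \<le> (\<Sum>W\<in>I. measure_pmf.prob (Pi_pmf B d (\<lambda>_. p)) (Pi B (\<lambda>w. if w \<in> W then H else - H)))"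
  proof (rule prob_le_sum[OF finI])
    fix g assume "g \<in> {g. card {w \<in> B. g w \<in> H} \<le> q}"
    then show "\<exists>W\<in>I. g \<in> Pi B (\<lambda>w. if w \<in> W then H else - H)"
      by (intro bexI[of _ "{w \<in> B. g w \<in> H}"]) (auto simp: I_def)
  qed
  also have "\<dots> \<le> (\<Sum>W\<in>I. x ^ card W * y ^ (card B - q))"
  proof (rule sum_mono)
    fix W assume W: "W \<in> I"
    have fW: "finite W" using W fin by (auto simp: I_def intro: finite_subset)
    have "measure_pmf.prob (Pi_pmf B d (\<lambda>_. p)) (Pi B (\<lambda>w. if w \<in> W then H else - H))
        = (\<Prod>w\<in>B. measure_pmf.prob p (if w \<in> W then H else - H))"
      using fin by (rule measure_Pi_pmf_Pi)
    also have "\<dots> \<le> (\<Prod>w\<in>B. if w \<in> W then x else y)"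
      using x y by (intro prod_mono) auto
    also have "\<dots> = x ^ card (B \<inter> W) * y ^ card (B \<inter> - W)"
      using fin by (simp add: prod.If_cases)
    also have "B \<inter> W = W" using W by (auto simp: I_def)
    also have "card (B \<inter> - W) = card B - card W"
      using W fin fW by (simp add: I_def Diff_eq[symmetric] card_Diff_subset)
    also have "x ^ card W * y ^ (card B - card W) \<le> x ^ card W * y ^ (card B - q)"
      using W x0 y0 y(2) by (intro mult_left_mono power_decreasing) (auto simp: I_def)
    finally show "measure_pmf.prob (Pi_pmf B d (\<lambda>_. p)) (Pi B (\<lambda>w. if w \<in> W then H else - H))
        \<le> x ^ card W * y ^ (card B - q)" .
  qed
  also have "\<dots> = (\<Sum>W\<in>I. x ^ card W) * y ^ (card B - q)" by (simp add: sum_distrib_right)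
  also have "(\<Sum>W\<in>I. x ^ card W) = (\<Sum>i\<le>q. real (card B choose i) * x ^ i)"
  proof -
    have "(\<Sum>W\<in>I. x ^ card W) = (\<Sum>i\<le>q. \<Sum>W\<in>{W \<in> I. card W = i}. x ^ card W)"
      using finI by (intro sum.group[symmetric]) (auto simp: I_def)
    also have "\<dots> = (\<Sum>i\<le>q. real (card B choose i) * x ^ i)"
    proof (rule sum.cong[OF refl])
      fix i assume i: "i \<in> {..q}"
      have "{W \<in> I. card W = i} = {W. W \<subseteq> B \<and> card W = i}" using i by (auto simp: I_def)
      then have "card {W \<in> I. card W = i} = card B choose i" using n_subsets[OF fin, of i] by simp
      moreover have "(\<Sum>W\<in>{W \<in> I. card W = i}. x ^ card W) = (\<Sum>W\<in>{W \<in> I. card W = i}. x ^ i)"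
        by (rule sum.cong) auto
      ultimately show "(\<Sum>W\<in>{W \<in> I. card W = i}. x ^ card W) = real (card B choose i) * x ^ i"
        by simp
    qed
    finally show ?thesis .
  qed
  finally show ?thesis .
qed

text \<open>Termwise comparison with the expansion of \<open>(1 + N x) ^ q\<close>, using
  \<open>N choose i \<le> N ^ i\<close> and \<open>1 \<le> q choose i\<close> for
  \<open>i \<le> q\<close>. The exponent is the cutoff \<open>q\<close>, so for fixed
  \<open>q\<close> the result is a power of \<open>1 + N x\<close> with fixed exponent.\<close>

lemma binomial_partial_sum_le:
  fixes x :: real
  assumes "x \<ge> 0"
  shows "(\<Sum>i\<le>q. real (N choose i) * x ^ i) \<le> (1 + real N * x) ^ q"
proof -
  have "(\<Sum>i\<le>q. real (N choose i) * x ^ i) \<le> (\<Sum>i\<le>q. real (q choose i) * (real N * x) ^ i)"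
  proof (rule sum_mono)
    fix i assume i: "i \<in> {..q}"
    have "N choose i \<le> N ^ i"
      by (cases "i \<le> N") (auto intro: binomial_le_pow simp: binomial_eq_0)
    then have "real (N choose i) \<le> real N ^ i" by (metis of_nat_le_iff of_nat_power)
    moreover have "1 \<le> real (q choose i)" using i
      by (metis atMost_iff of_nat_1 of_nat_le_iff One_nat_def Suc_leI zero_less_binomial)
    ultimately have "real (N choose i) \<le> real (q choose i) * real N ^ i"
      by (smt (verit) mult_le_cancel_right1 zero_le_power of_nat_0_le_iff)
    then show "real (N choose i) * x ^ i \<le> real (q choose i) * (real N * x) ^ i"
      using assms by (simp add: power_mult_distrib mult_right_mono mult.assoc[symmetric])
  qed
  also have "\<dots> = (real N * x + 1) ^ q" by (subst binomial_ring) simp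
  finally show ?thesis by (simp add: add.commute)
qed

lemma prob_iid_card_le':
  fixes p :: "'b pmf" and B :: "'a set"
  assumes "finite B" "measure_pmf.prob p H \<le> x"
    and "measure_pmf.prob p (- H) \<le> y" "y \<le> 1"
  shows "measure_pmf.prob (Pi_pmf B d (\<lambda>_. p)) {g. card {w \<in> B. g w \<in> H} \<le> q}
     \<le> (1 + real (card B) * x) ^ q * y ^ (card B - q)"
proof -
  have "0 \<le> x" "0 \<le> y" using assms measure_nonneg order_trans by blast+
  then show ?thesis
    using order_trans[OF prob_iid_card_le[OF assms]] binomial_partial_sum_le[of x "card B" q]
    by (simp add: mult_right_mono)
qed

text \<open>For cutoffs \<open>q\<close> proportional to the number of nodes, a factor like
  \<open>(1 + N x) ^ q\<close> would be too large. With \<open>x = 1\<close> the sum merely counts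
  subsets, which costs an exponential in \<open>card B\<close> only.\<close>

lemma prob_iid_card_le_pow2:
  fixes p :: "'b pmf" and B :: "'a set"
  assumes "finite B" "measure_pmf.prob p (- H) \<le> y" "y \<le> 1"
  shows "measure_pmf.prob (Pi_pmf B d (\<lambda>_. p)) {g. card {w \<in> B. g w \<in> H} \<le> q}
     \<le> 2 ^ card B * y ^ (card B - q)"
proof -
  have y0: "0 \<le> y" using assms measure_nonneg order_trans by blast
  have "(\<Sum>i\<le>q. real (card B choose i) * 1 ^ i) \<le> 2 ^ card B"
  proof -
    have "(\<Sum>i\<le>q. card B choose i) = (\<Sum>i\<in>{..q} \<inter> {..card B}. card B choose i)"
      by (rule sum.mono_neutral_right) auto
    also have "\<dots> \<le> (\<Sum>i\<le>card B. card B choose i)" by (rule sum_mono2) auto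
    also have "\<dots> = 2 ^ card B" by (rule choose_row_sum)
    finally have "real (\<Sum>i\<le>q. card B choose i) \<le> real (2 ^ card B)" by (rule of_nat_mono)
    then show ?thesis by simp
  qed
  then show ?thesis
    using order_trans[OF prob_iid_card_le[OF assms(1) _ assms(2,3), of 1]] y0
    by (simp add: mult_right_mono)
qed

text \<open>A union bound over the index that falls into \<open>H2\<close>. The remaining indices
  are independent of it and still have at most \<open>q\<close> hits, hence the factor
  \<open>z\<close> and the exponent lowered by one.\<close>

lemma prob_iid_card_le_and_ex:
  fixes p :: "'b pmf" and B :: "'a set"
  assumes fin: "finite B" and x: "measure_pmf.prob p H \<le> x"
    and y: "measure_pmf.prob p (- H) \<le> y" "y \<le> 1" and z: "measure_pmf.prob p H2 \<le> z"
    and finp: "finite (set_pmf p)"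
  shows "measure_pmf.prob (Pi_pmf B d (\<lambda>_. p)) {g. card {w \<in> B. g w \<in> H} \<le> q \<and> (\<exists>w\<in>B. g w \<in> H2)}
     \<le> real (card B) * (z * ((1 + real (card B) * x) ^ q * y ^ (card B - 1 - q)))"
proof -
  have x0: "0 \<le> x" using x measure_nonneg order_trans by blast
  have y0: "0 \<le> y" using y measure_nonneg order_trans by blast
  have z0: "0 \<le> z" using z measure_nonneg order_trans by blast
  let ?M = "Pi_pmf B d (\<lambda>_. p)"
  let ?R = "(1 + real (card B) * x) ^ q * y ^ (card B - 1 - q)"
  have "measure_pmf.prob ?M {g. card {w \<in> B. g w \<in> H} \<le> q \<and> (\<exists>w\<in>B. g w \<in> H2)}
     \<le> (\<Sum>w\<in>B. measure_pmf.prob ?M {g. g w \<in> H2 \<and> card {v \<in> B - {w}. g v \<in> H} \<le> q})"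
  proof (rule prob_le_sum[OF fin])
    fix g assume g: "g \<in> {g. card {w \<in> B. g w \<in> H} \<le> q \<and> (\<exists>w\<in>B. g w \<in> H2)}"
    then obtain w where w: "w \<in> B" "g w \<in> H2" by auto
    have "card {v \<in> B - {w}. g v \<in> H} \<le> card {v \<in> B. g v \<in> H}" using fin by (intro card_mono) auto
    then show "\<exists>w\<in>B. g \<in> {g. g w \<in> H2 \<and> card {v \<in> B - {w}. g v \<in> H} \<le> q}" using g w by fastforce
  qed
  also have "\<dots> \<le> (\<Sum>w\<in>B. z * ?R)"
  proof (rule sum_mono)
    fix w assume w: "w \<in> B"
    let ?N = "Pi_pmf (B - {w}) d (\<lambda>_. p)"
    let ?pr = "measure_pmf.prob ?N {g. card {v \<in> B - {w}. g v \<in> H} \<le> q}"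
    have B: "B = {w} \<union> (B - {w})" using w by auto
    have "measure_pmf.prob ?M {g. g w \<in> H2 \<and> card {v \<in> B - {w}. g v \<in> H} \<le> q}
      = expect (Pi_pmf {w} d (\<lambda>_. p)) (\<lambda>f. measure_pmf.prob ?N
          {g. (\<lambda>x. if x \<in> {w} then f x else g x) \<in> {g. g w \<in> H2 \<and> card {v \<in> B - {w}. g v \<in> H} \<le> q}})"
      by (subst B, subst prob_Pi_pmf_union) (use fin finp in auto)
    also have "\<dots> = expect (Pi_pmf {w} d (\<lambda>_. p)) (\<lambda>f. of_bool (f \<in> {f. f w \<in> H2}) * ?pr)"
    proof (rule arg_cong[where f = "expect _"], rule ext)
      fix f :: "'a \<Rightarrow> 'b"
      have "{v \<in> B - {w}. (if v = w then f v else g v) \<in> H} = {v \<in> B - {w}. g v \<in> H}" for g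
        by auto
      then show "measure_pmf.prob ?N
          {g. (\<lambda>x. if x \<in> {w} then f x else g x) \<in> {g. g w \<in> H2 \<and> card {v \<in> B - {w}. g v \<in> H} \<le> q}}
          = of_bool (f \<in> {f. f w \<in> H2}) * ?pr" by simp
    qed
    also have "\<dots> = measure_pmf.prob (Pi_pmf {w} d (\<lambda>_. p)) {f. f w \<in> H2} * ?pr"
      unfolding prob_eq_expect[of "Pi_pmf {w} d (\<lambda>_. p)"] by simp
    also have "\<dots> = measure_pmf.prob p H2 * ?pr" by (simp add: prob_Pi_pmf_component)
    also have "\<dots> \<le> z * ?R"
    proof (rule mult_mono[OF z _ z0 measure_nonneg])
      have "?pr \<le> (1 + real (card (B - {w})) * x) ^ q * y ^ (card (B - {w}) - q)"
        using prob_iid_card_le'[OF _ x y] fin by blast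
      also have "\<dots> \<le> (1 + real (card B) * x) ^ q * y ^ (card (B - {w}) - q)"
        using x0 y0 fin by (intro mult_right_mono power_mono add_left_mono) (auto intro: card_mono)
      finally show "?pr \<le> ?R" using w fin by simp
    qed
    finally show "measure_pmf.prob ?M {g. g w \<in> H2 \<and> card {v \<in> B - {w}. g v \<in> H} \<le> q} \<le> z * ?R" .
  qed
  finally show ?thesis by simp
qed

section \<open>Uniform object sets\<close>

definition object_sets :: "nat \<Rightarrow> nat \<Rightarrow> nat set set" where
  "object_sets P K = {A. A \<subseteq> {..<P} \<and> card A = K}"

abbreviation object_pmf :: "nat \<Rightarrow> nat \<Rightarrow> nat set pmf" where
  "object_pmf P K \<equiv> pmf_of_set (object_sets P K)"

lemma finite_object_sets [simp]: "finite (object_sets P K)"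
  by (simp add: object_sets_def)

lemma card_object_sets: "card (object_sets P K) = P choose K"
  unfolding object_sets_def using n_subsets[of "{..<P}" K] by simp

lemma object_sets_nonempty: "K \<le> P \<Longrightarrow> object_sets P K \<noteq> {}"
  using card_object_sets[of P K] by (metis card.empty zero_less_binomial less_numeral_extra(3))

lemma set_object_pmf: "K \<le> P \<Longrightarrow> set_pmf (object_pmf P K) = object_sets P K"
  by (simp add: object_sets_nonempty)

lemma finite_set_object_pmf: "K \<le> P \<Longrightarrow> finite (set_pmf (object_pmf P K))"
  by (simp add: set_object_pmf)

lemma prob_object_pmf:
  "K \<le> P \<Longrightarrow> measure_pmf.prob (object_pmf P K) X = real (card (object_sets P K \<inter> X)) / real (P choose K)"
  by (simp add: measure_pmf_of_set object_sets_nonempty card_object_sets)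

text \<open>Up to normalisation this is the probability that \<open>j\<close> given objects all
  belong to a random \<open>K\<close>-set. It is a product of factors
  \<open>(K - i) / (P - i)\<close>, none of which exceeds \<open>K / P\<close> because
  \<open>K \<le> P\<close>.\<close>

lemma choose_ratio_diag_le:
  assumes "j \<le> K" "K \<le> P" "P \<ge> 1"
  shows "real ((P - j) choose (K - j)) \<le> (real K / real P) ^ j * real (P choose K)"
  using assms
proof (induction j)
  case (Suc j)
  have "(K - j) * ((P - j) choose (K - j)) = (P - j) * ((P - Suc j) choose (K - Suc j))"
    using times_binomial_minus1_eq[of "K - j" "P - j"] Suc.prems by simp
  then have "real (K - j) * real ((P - j) choose (K - j)) = real (P - j) * real ((P - Suc j) choose (K - Suc j))"
    by (metis of_nat_mult)
  then have eq: "real ((P - Suc j) choose (K - Suc j)) = real (K - j) / real (P - j) * real ((P - j) choose (K - j))"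
    using Suc.prems by (simp add: field_simps)
  have "real (K - j) / real (P - j) \<le> real K / real P"
  proof -
    have "(real K - real j) * real P \<le> real K * (real P - real j)"
      using Suc.prems by (simp add: algebra_simps mult_right_mono)
    then show ?thesis using Suc.prems by (simp add: divide_simps of_nat_diff)
  qed
  then have "real ((P - Suc j) choose (K - Suc j)) \<le> real K / real P * real ((P - j) choose (K - j))"
    unfolding eq by (intro mult_right_mono) auto
  also have "\<dots> \<le> real K / real P * ((real K / real P) ^ j * real (P choose K))"
    using Suc by (intro mult_left_mono) auto
  finally show ?case by simp
qed simp

lemma prob_superset_le:
  assumes "1 \<le> K" "K \<le> P" "finite J"
  shows "measure_pmf.prob (object_pmf P K) {S. J \<subseteq> S} \<le> (real K / real P) ^ card J"
proof (cases "J \<subseteq> {..<P} \<and> card J \<le> K")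
  case False
  have "object_sets P K \<inter> {S. J \<subseteq> S} = {}"
  proof (rule ccontr)
    assume "\<not> ?thesis"
    then obtain S where S: "S \<subseteq> {..<P}" "card S = K" "J \<subseteq> S" by (auto simp: object_sets_def)
    then have "card J \<le> K" using card_mono[of S J] finite_subset[OF S(1)] by auto
    then show False using False S by auto
  qed
  then show ?thesis using assms by (simp add: prob_object_pmf)
next
  case True
  have "card (object_sets P K \<inter> {S. J \<subseteq> S}) = card {T. T \<subseteq> {..<P} - J \<and> card T = K - card J}"
  proof (rule bij_betw_same_card[of "\<lambda>S. S - J"], rule bij_betwI[where g = "\<lambda>T. T \<union> J"])
    show "(\<lambda>S. S - J) \<in> object_sets P K \<inter> {S. J \<subseteq> S} \<rightarrow> {T. T \<subseteq> {..<P} - J \<and> card T = K - card J}"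
      using assms(3) by (auto simp: object_sets_def card_Diff_subset)
    show "(\<lambda>T. T \<union> J) \<in> {T. T \<subseteq> {..<P} - J \<and> card T = K - card J} \<rightarrow> object_sets P K \<inter> {S. J \<subseteq> S}"
    proof
      fix T assume T: "T \<in> {T. T \<subseteq> {..<P} - J \<and> card T = K - card J}"
      then have "finite T" by (auto intro: finite_subset)
      then have "card (T \<union> J) = card T + card J" using T assms(3) by (intro card_Un_disjoint) auto
      then show "T \<union> J \<in> object_sets P K \<inter> {S. J \<subseteq> S}" using T True by (auto simp: object_sets_def)
    qed
  qed auto
  also have "\<dots> = (P - card J) choose (K - card J)"
    using n_subsets[of "{..<P} - J" "K - card J"] True assms(3) by (simp add: card_Diff_subset)
  finally have "card (object_sets P K \<inter> {S. J \<subseteq> S}) = (P - card J) choose (K - card J)" .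
  moreover have "0 < P choose K" using assms by simp
  ultimately show ?thesis
    using choose_ratio_diag_le[of "card J" K P] True assms by (simp add: prob_object_pmf field_simps)
qed

lemma prob_mem_le:
  assumes "1 \<le> K" "K \<le> P"
  shows "measure_pmf.prob (object_pmf P K) {S. a \<in> S} \<le> real K / real P"
  using prob_superset_le[OF assms, of "{a}"] by simp

lemma prob_hit_le:
  assumes "1 \<le> K" "K \<le> P" "finite U"
  shows "measure_pmf.prob (object_pmf P K) {S. S \<inter> U \<noteq> {}} \<le> real (card U) * (real K / real P)"
proof -
  have "measure_pmf.prob (object_pmf P K) {S. S \<inter> U \<noteq> {}}
      \<le> (\<Sum>a\<in>U. measure_pmf.prob (object_pmf P K) {S. a \<in> S})"
    by (rule prob_le_sum) (use assms in auto)
  also have "\<dots> \<le> (\<Sum>a\<in>U. real K / real P)" using assms by (intro sum_mono prob_mem_le) auto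
  finally show ?thesis by simp
qed

lemma prob_hit_both_le:
  assumes "1 \<le> K" "K \<le> P" "finite U" "finite V" "U \<inter> V = {}"
  shows "measure_pmf.prob (object_pmf P K) {S. S \<inter> U \<noteq> {} \<and> S \<inter> V \<noteq> {}}
    \<le> real (card U) * real (card V) * (real K / real P)\<^sup>2"
proof -
  have "measure_pmf.prob (object_pmf P K) {S. S \<inter> U \<noteq> {} \<and> S \<inter> V \<noteq> {}}
      \<le> (\<Sum>z\<in>U \<times> V. measure_pmf.prob (object_pmf P K) {S. {fst z, snd z} \<subseteq> S})"
    by (rule prob_le_sum) (use assms in fastforce)+
  also have "\<dots> \<le> (\<Sum>z\<in>U \<times> V. (real K / real P)\<^sup>2)"
  proof (rule sum_mono)
    fix z assume "z \<in> U \<times> V"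
    then have "card {fst z, snd z} = 2" using assms(5) by (auto simp: card_insert_if)
    then show "measure_pmf.prob (object_pmf P K) {S. {fst z, snd z} \<subseteq> S} \<le> (real K / real P)\<^sup>2"
      using prob_superset_le[OF assms(1,2), of "{fst z, snd z}"] by simp
  qed
  finally show ?thesis by (simp add: card_cartesian_product)
qed

section \<open>Probability that a random object set misses a given set\<close>

lemma choose_ratio_row:
  assumes "K \<le> P" "u < P"
  shows "real ((P - Suc u) choose K) = real (P - u - K) / real (P - u) * real ((P - u) choose K)"
proof -
  have "(P - u - K) * ((P - u) choose K) = (P - u) * ((P - Suc u) choose K)"
    using binomial_absorb_comp[of "P - u" K] by simp
  then have "real (P - u - K) * real ((P - u) choose K) = real (P - u) * real ((P - Suc u) choose K)"
    by (metis of_nat_mult)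
  then show ?thesis using assms by (simp add: field_simps)
qed

lemma choose_ratio_row_le:
  assumes "K \<le> P" "u \<le> P" "P \<ge> 1"
  shows "real ((P - u) choose K) \<le> (1 - real K / real P) ^ u * real (P choose K)"
  using assms
proof (induction u)
  case (Suc u)
  have pos: "0 \<le> 1 - real K / real P" using Suc.prems by simp
  have "real (P - u - K) / real (P - u) \<le> 1 - real K / real P"
  proof (cases "K + u \<le> P")
    case True
    have "real K * (real P - real u) \<le> real K * real P" by (intro mult_left_mono) auto
    then show ?thesis using Suc.prems True by (simp add: divide_simps of_nat_diff algebra_simps)
  qed (use pos in simp)
  then have "real ((P - Suc u) choose K) \<le> (1 - real K / real P) * real ((P - u) choose K)"
    unfolding choose_ratio_row[OF Suc.prems(1) Suc_le_lessD[OF Suc.prems(2)]]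
    by (intro mult_right_mono) auto
  also have "\<dots> \<le> (1 - real K / real P) * ((1 - real K / real P) ^ u * real (P choose K))"
    using Suc pos by (intro mult_left_mono) auto
  finally show ?case by simp
qed simp

text \<open>The ratio is a product of \<open>u\<close> factors \<open>1 - K / (P - i)\<close> with
  \<open>i < v\<close>, each at least \<open>1 - K / (P - v)\<close>. Keeping \<open>v\<close> apart
  from \<open>u\<close> holds the base fixed during the induction.\<close>

lemma choose_ratio_row_ge:
  assumes "K + v \<le> P" "u \<le> v" "K \<ge> 1"
  shows "(1 - real K / real (P - v)) ^ u * real (P choose K) \<le> real ((P - u) choose K)"
  using assms
proof (induction u)
  case (Suc u)
  have pos: "0 \<le> 1 - real K / real (P - v)" using Suc.prems by simp
  have "1 - real K / real (P - v) \<le> real (P - u - K) / real (P - u)"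
  proof -
    have "real K / real (P - u) \<le> real K / real (P - v)"
      using Suc.prems by (intro divide_left_mono) auto
    moreover have "real (P - u - K) / real (P - u) = 1 - real K / real (P - u)"
    proof -
      have "real (P - u - K) = real (P - u) - real K" using Suc.prems by (simp add: of_nat_diff)
      then show ?thesis using Suc.prems by (simp only: diff_divide_distrib) auto
    qed
    ultimately show ?thesis by linarith
  qed
  then have "(1 - real K / real (P - v)) * real ((P - u) choose K) \<le> real ((P - Suc u) choose K)"
    using choose_ratio_row[of K P u] Suc.prems mult_right_mono[of _ _ "real ((P - u) choose K)"]
    by (metis (no_types, lifting) add_leE le_trans of_nat_0_le_iff Suc_le_lessD)
  moreover have "(1 - real K / real (P - v)) * ((1 - real K / real (P - v)) ^ u * real (P choose K))
      \<le> (1 - real K / real (P - v)) * real ((P - u) choose K)"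
    using Suc pos by (intro mult_left_mono) auto
  ultimately show ?case by simp
qed simp

lemma prob_miss_eq:
  assumes "K \<le> P" "U \<subseteq> {..<P}"
  shows "measure_pmf.prob (object_pmf P K) {S. S \<inter> U = {}} = real ((P - card U) choose K) / real (P choose K)"
proof -
  have "object_sets P K \<inter> {S. S \<inter> U = {}} = {T. T \<subseteq> {..<P} - U \<and> card T = K}"
    by (auto simp: object_sets_def)
  moreover have "card ({..<P} - U) = P - card U"
    using assms by (simp add: card_Diff_subset finite_subset)
  ultimately have "card (object_sets P K \<inter> {S. S \<inter> U = {}}) = (P - card U) choose K"
    using n_subsets[of "{..<P} - U" K] by simp
  then show ?thesis using assms by (simp add: prob_object_pmf)
qed

lemma prob_miss_le:
  assumes "1 \<le> K" "K \<le> P" "U \<subseteq> {..<P}"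
  shows "measure_pmf.prob (object_pmf P K) {S. S \<inter> U = {}} \<le> exp (- (real (card U) * real K / real P))"
proof -
  have "card U \<le> P" using card_mono[OF _ assms(3)] by simp
  then have "measure_pmf.prob (object_pmf P K) {S. S \<inter> U = {}} \<le> (1 - real K / real P) ^ card U"
    using choose_ratio_row_le[of K P "card U"] assms by (simp add: prob_miss_eq divide_simps)
  also have "\<dots> \<le> exp (- (real K / real P)) ^ card U"
    using assms exp_ge_add_one_self[of "- (real K / real P)"] by (intro power_mono) auto
  also have "\<dots> = exp (- (real (card U) * real K / real P))"
    by (simp add: exp_of_nat_mult[symmetric])
  finally show ?thesis .
qed

lemma prob_miss_ge:
  assumes "1 \<le> K" "K + card U \<le> P" "U \<subseteq> {..<P}"
  shows "(1 - real K / real (P - card U)) ^ card U \<le> measure_pmf.prob (object_pmf P K) {S. S \<inter> U = {}}"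
proof -
  have "0 < P choose K" using assms by simp
  then show ?thesis
    using choose_ratio_row_ge[of K "card U" P "card U"] assms by (simp add: prob_miss_eq divide_simps)
qed

section \<open>Moment generating function of the defect\<close>

lemma sum_Pow_power_card:
  fixes c :: real
  assumes "finite W"
  shows "(\<Sum>J\<in>Pow W. c ^ card J) = (1 + c) ^ card W"
proof -
  have "(1 + c) ^ card W = (\<Prod>x\<in>W. c + 1)" by (simp add: add.commute)
  also have "\<dots> = (\<Sum>J\<in>Pow W. c ^ card J)" using prod_add[OF assms, of "\<lambda>_. c" "\<lambda>_. 1"] by simp
  finally show ?thesis ..
qed

text \<open>
  Expanding \<open>t ^ m = (1 + (t - 1)) ^ m\<close> over the subsets of \<open>S \<inter> U\<close> reduces the moment generating
  function to the inclusion probabilities.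
\<close>

lemma expect_power_card_inter_le:
  fixes t :: real
  assumes "1 \<le> K" "K \<le> P" "finite U" "t \<ge> 1"
  shows "expect (object_pmf P K) (\<lambda>S. t ^ card (S \<inter> U)) \<le> exp ((t - 1) * (real K * real (card U) / real P))"
proof -
  have fin: "finite (set_pmf (object_pmf P K))" using assms finite_set_object_pmf by blast
  have "t ^ card (S \<inter> U) = (\<Sum>J\<in>Pow U. (t - 1) ^ card J * of_bool (S \<in> {S. J \<subseteq> S}))" for S
  proof -
    have "t ^ card (S \<inter> U) = (\<Sum>J\<in>Pow (S \<inter> U). (t - 1) ^ card J)"
      using sum_Pow_power_card[of "S \<inter> U" "t - 1"] assms(3) by simp
    also have "\<dots> = (\<Sum>J\<in>Pow U. (t - 1) ^ card J * of_bool (S \<in> {S. J \<subseteq> S}))"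
      using assms(3) by (intro sum.mono_neutral_cong_left) auto
    finally show ?thesis .
  qed
  then have "expect (object_pmf P K) (\<lambda>S. t ^ card (S \<inter> U))
      = (\<Sum>J\<in>Pow U. (t - 1) ^ card J * measure_pmf.prob (object_pmf P K) {S. J \<subseteq> S})"
    unfolding prob_eq_expect
    by (subst Bochner_Integration.integral_sum[symmetric] integral_mult_right_zero[symmetric])+
       (auto intro!: integrable_measure_pmf_finite fin)
  also have "\<dots> \<le> (\<Sum>J\<in>Pow U. (t - 1) ^ card J * (real K / real P) ^ card J)"
    using assms by (intro sum_mono mult_left_mono prob_superset_le) (auto intro: finite_subset)
  also have "\<dots> = (\<Sum>J\<in>Pow U. ((t - 1) * (real K / real P)) ^ card J)"
    by (simp only: power_mult_distrib)
  also have "\<dots> = (1 + (t - 1) * (real K / real P)) ^ card U" using assms by (simp add: sum_Pow_power_card)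
  also have "\<dots> \<le> exp ((t - 1) * (real K / real P)) ^ card U"
    using assms by (intro power_mono) (auto simp: exp_ge_add_one_self)
  also have "\<dots> = exp ((t - 1) * (real K * real (card U) / real P))"
    by (simp add: exp_of_nat_mult[symmetric] mult_ac)
  finally show ?thesis .
qed

abbreviation objects_pmf :: "nat set \<Rightarrow> nat \<Rightarrow> nat \<Rightarrow> (nat \<Rightarrow> nat set) pmf" where
  "objects_pmf A P K \<equiv> Pi_pmf A {} (\<lambda>_. object_pmf P K)"

definition objects_of :: "(nat \<Rightarrow> nat set) \<Rightarrow> nat set \<Rightarrow> nat set" where
  "objects_of S A = (\<Union>i\<in>A. S i)"

lemma objects_pmf_component:
  assumes "K \<le> P" "finite A" "S \<in> set_pmf (objects_pmf A P K)" "i \<in> A"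
  shows "S i \<subseteq> {..<P}" "card (S i) = K" "finite (S i)"
proof -
  have "S i \<in> object_sets P K"
    using set_Pi_pmf_component[OF assms(2-4)] set_object_pmf[OF assms(1)] by simp
  then show "S i \<subseteq> {..<P}" "card (S i) = K" by (auto simp: object_sets_def)
  then show "finite (S i)" using finite_subset by blast
qed

lemma finite_set_objects_pmf:
  "K \<le> P \<Longrightarrow> finite A \<Longrightarrow> finite (set_pmf (objects_pmf A P K))"
  by (intro finite_set_Pi_pmf finite_set_object_pmf)

lemma objects_of_bounds:
  assumes "K \<le> P" "finite A" "S \<in> set_pmf (objects_pmf A P K)"
  shows "objects_of S A \<subseteq> {..<P}" "card (objects_of S A) \<le> card A * K" "finite (objects_of S A)"
proof -
  note c = objects_pmf_component[OF assms]
  show "objects_of S A \<subseteq> {..<P}" using c by (auto simp: objects_of_def)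
  then show "finite (objects_of S A)" using finite_subset by blast
  have "card (objects_of S A) \<le> (\<Sum>i\<in>A. card (S i))"
    unfolding objects_of_def by (rule card_UN_le) (rule assms)
  also have "\<dots> = card A * K" using c by simp
  finally show "card (objects_of S A) \<le> card A * K" .
qed

text \<open>The exponent counts the coincidences among the objects held by \<open>A\<close>.\<close>

lemma expect_power_overlap_le:
  fixes t :: real
  assumes KP: "1 \<le> K" "K \<le> P" and fin: "finite A" and t: "t \<ge> 1"
  shows "expect (objects_pmf A P K) (\<lambda>S. t ^ (card A * K - card (objects_of S A)))
    \<le> exp ((t - 1) * ((real K)\<^sup>2 / real P) * (real (card A))\<^sup>2)"
  using fin
proof (induction A rule: finite_induct)
  case empty
  then show ?case by simp
next
  case (insert a A)
  let ?th = "(real K)\<^sup>2 / real P" and ?r = "real (card A)"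
  let ?M = "objects_pmf A P K" and ?Q = "object_pmf P K"
  have fM: "finite (set_pmf ?M)" and fQ: "finite (set_pmf ?Q)"
    using KP insert.hyps by (auto intro!: finite_set_objects_pmf finite_set_object_pmf simp del: set_pmf_of_set)
  \<comment> \<open>A new node raises the defect by the number of its objects that are already held
    by \<open>A\<close>, so the earlier estimate for a random set against a fixed one applies
    conditionally.\<close>
  have step: "t ^ (card (insert a A) * K - card (objects_of (f(a := y)) (insert a A)))
      = t ^ (card A * K - card (objects_of f A)) * t ^ card (y \<inter> objects_of f A)"
    if y: "y \<in> set_pmf ?Q" and f: "f \<in> set_pmf ?M" for y f
  proof -
    note b = objects_of_bounds[OF KP(2) insert.hyps(1) f]
    have y': "card y = K" "finite y" using y set_object_pmf[OF KP(2)]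
      by (auto simp: object_sets_def intro: finite_subset)
    have "objects_of (f(a := y)) (insert a A) = y \<union> objects_of f A"
      using insert.hyps by (auto simp: objects_of_def)
    moreover have "card (y \<union> objects_of f A) + card (y \<inter> objects_of f A) = K + card (objects_of f A)"
      using card_Un_Int[OF y'(2) b(3)] y' by simp
    ultimately have "card (insert a A) * K - card (objects_of (f(a := y)) (insert a A))
        = (card A * K - card (objects_of f A)) + card (y \<inter> objects_of f A)"
      using b(2) insert.hyps by simp
    then show ?thesis by (simp add: power_add)
  qed
  have "expect (objects_pmf (insert a A) P K)
      (\<lambda>S. t ^ (card (insert a A) * K - card (objects_of S (insert a A))))
    = expect (pair_pmf ?Q ?M) (\<lambda>(y, f). t ^ (card (insert a A) * K - card (objects_of (f(a := y)) (insert a A))))"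
    using insert.hyps by (subst Pi_pmf_insert) (auto simp: case_prod_unfold)
  also have "\<dots> \<le> expect (pair_pmf ?Q ?M)
      (\<lambda>(y, f). t ^ (card A * K - card (objects_of f A)) * t ^ card (y \<inter> objects_of f A))"
    by (rule expect_mono) (use fM fQ step in auto)
  also have "\<dots> = expect ?M (\<lambda>f. t ^ (card A * K - card (objects_of f A))
      * expect ?Q (\<lambda>y. t ^ card (y \<inter> objects_of f A)))"
    by (subst expect_pair_pmf(2)[OF fQ fM]) simp
  also have "\<dots> \<le> expect ?M (\<lambda>f. t ^ (card A * K - card (objects_of f A)) * exp ((t - 1) * (?th * ?r)))"
  proof (rule expect_mono[OF fM], rule mult_left_mono)
    fix f assume f: "f \<in> set_pmf ?M"
    note b = objects_of_bounds[OF KP(2) insert.hyps(1) f]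
    have "real (card (objects_of f A)) \<le> real (card A * K)" using b(2) by (rule of_nat_mono)
    then have "real K * real (card (objects_of f A)) / real P \<le> ?th * ?r"
      by (simp add: power2_eq_square divide_right_mono mult_left_mono mult_ac)
    then have "(t - 1) * (real K * real (card (objects_of f A)) / real P) \<le> (t - 1) * (?th * ?r)"
      using t by (intro mult_left_mono) auto
    then show "expect ?Q (\<lambda>y. t ^ card (y \<inter> objects_of f A)) \<le> exp ((t - 1) * (?th * ?r))"
      using expect_power_card_inter_le[OF KP b(3) t] by (meson exp_le_cancel_iff order_trans)
  qed (use t in auto)
  also have "\<dots> = expect ?M (\<lambda>f. t ^ (card A * K - card (objects_of f A))) * exp ((t - 1) * (?th * ?r))"
    by simp
  also have "\<dots> \<le> exp ((t - 1) * ?th * ?r\<^sup>2) * exp ((t - 1) * (?th * ?r))"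
    using insert.IH by (intro mult_right_mono) auto
  also have "\<dots> = exp ((t - 1) * ?th * (?r\<^sup>2 + ?r))"
    by (simp only: exp_add[symmetric] distrib_left mult.assoc)
  also have "\<dots> \<le> exp ((t - 1) * ?th * (real (card (insert a A)))\<^sup>2)"
  proof -
    \<comment> \<open>Every new node adds its predecessors' number \<open>?r\<close> to the
      coefficient of \<open>\<theta>\<close>; the square is a convenient bound for the
      total.\<close>
    have "?r\<^sup>2 + ?r \<le> (real (card (insert a A)))\<^sup>2"
      using insert.hyps by (simp add: power2_eq_square algebra_simps)
    then show ?thesis unfolding exp_le_cancel_iff using t by (intro mult_left_mono) auto
  qed
  finally show ?case .
qed

section \<open>Neighbourhoods of node sets\<close>

definition nbh :: "nat \<Rightarrow> (nat \<Rightarrow> nat set) \<Rightarrow> nat set \<Rightarrow> nat set" where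
  "nbh n S A = {w \<in> {..<n} - A. S w \<inter> objects_of S A \<noteq> {}}"

lemma boundary_intersection_edges:
  assumes "A \<subseteq> {..<n}"
  shows "boundary {..<n} (intersection_edges n S) A = nbh n S A"
  using assms unfolding boundary_def nbh_def objects_of_def
  by (auto simp: intersection_edges_iff subset_eq disjoint_iff) metis

lemma node_degree_intersection_edges:
  assumes "v < n"
  shows "node_degree {..<n} (intersection_edges n S) v = card (nbh n S {v})"
proof -
  have "{u \<in> {..<n}. u \<noteq> v \<and> {u, v} \<in> intersection_edges n S} = nbh n S {v}"
    using assms by (auto simp: nbh_def objects_of_def intersection_edges_iff)
  then show ?thesis by (simp add: node_degree_def)
qed

text \<open>An edge inside \<open>A\<close> makes a shared object count twice in
  \<open>card A * K\<close>, so the defect is positive. The distribution lives on a larger index set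
  \<open>A'\<close> because the lemma is used both for all nodes and for \<open>A\<close>
  alone.\<close>

lemma objects_of_overlap:
  assumes "K \<le> P" "finite A" "S \<in> set_pmf (objects_pmf A' P K)" "A \<subseteq> A'" "finite A'"
    and ab: "a \<in> A" "b \<in> A" "a \<noteq> b" "S a \<inter> S b \<noteq> {}"
  shows "card (objects_of S A) < card A * K"
proof -
  have c: "finite (S i)" "card (S i) = K" if "i \<in> A" for i
    using objects_pmf_component[OF assms(1,5,3)] that assms(4) by auto
  have "card (S a \<union> S b) + card (S a \<inter> S b) = K + K"
    using card_Un_Int[of "S a" "S b"] c ab by simp
  moreover have "card (S a \<inter> S b) > 0" using ab c by (simp add: card_gt_0_iff)
  ultimately have 1: "card (S a \<union> S b) < 2 * K" by simp
  have "objects_of S A = (S a \<union> S b) \<union> (\<Union>i\<in>A - {a, b}. S i)"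
    using ab by (auto simp: objects_of_def)
  then have "card (objects_of S A) \<le> card (S a \<union> S b) + card (\<Union>i\<in>A - {a, b}. S i)"
    by (metis card_Un_le)
  also have "card (\<Union>i\<in>A - {a, b}. S i) \<le> (\<Sum>i\<in>A - {a, b}. card (S i))"
    using assms(2) by (intro card_UN_le) auto
  also have "\<dots> = (card A - 2) * K" using c assms(2) ab by (simp add: card_Diff_subset numeral_2_eq_2)
  finally have "card (objects_of S A) < 2 * K + (card A - 2) * K" using 1 by simp
  moreover have "card A \<ge> 2" using card_mono[OF assms(2), of "{a, b}"] ab by auto
  then have "2 * K + (card A - 2) * K = card A * K" by (metis add_mult_distrib le_add_diff_inverse)
  ultimately show ?thesis by simp
qed

section \<open>Conditioning on the object sets of a node set\<close>

lemma prob_objects_pmf_split: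
  assumes "K \<le> P" "A \<subseteq> {..<n}"
  shows "measure_pmf.prob (objects_pmf {..<n} P K) X =
    expect (objects_pmf A P K) (\<lambda>f. measure_pmf.prob (objects_pmf ({..<n} - A) P K)
      {g. (\<lambda>x. if x \<in> A then f x else g x) \<in> X})"
proof -
  have "{..<n} = A \<union> ({..<n} - A)" "finite A" using assms finite_subset by auto
  then show ?thesis
    using prob_Pi_pmf_union[of A "{..<n} - A" "\<lambda>_. object_pmf P K" "{}" X]
      finite_set_object_pmf[OF assms(1)] by auto
qed

lemma objects_of_merge: "objects_of (\<lambda>x. if x \<in> A then f x else g x) A = objects_of f A"
  by (auto simp: objects_of_def)

lemma nbh_merge:
  "nbh n (\<lambda>x. if x \<in> A then f x else g x) A = {w \<in> {..<n} - A. g w \<in> {T. T \<inter> objects_of f A \<noteq> {}}}"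
  unfolding nbh_def objects_of_merge by auto

lemma prob_objects_of:
  assumes "K \<le> P" "A \<subseteq> {..<n}"
  shows "measure_pmf.prob (objects_pmf {..<n} P K) {S. \<phi> (card (objects_of S A))} =
    expect (objects_pmf A P K) (\<lambda>f. of_bool (\<phi> (card (objects_of f A))))"
  by (subst prob_objects_pmf_split[OF assms]) (simp add: objects_of_merge of_bool_def if_distrib cong: if_cong)

text \<open>Given the object sets \<open>f\<close> on \<open>A\<close>, the neighbourhood size
  counts independent hits of one fixed set. The predicate \<phi> restricts the number of objects
  held by \<open>A\<close>, and the conditional bound \<open>h\<close> may depend on that number
  through \<open>f\<close>.\<close>

lemma prob_nbh_le_expect:
  assumes "K \<le> P" "A \<subseteq> {..<n}"
    and h: "\<And>f. f \<in> set_pmf (objects_pmf A P K) \<Longrightarrow> \<phi> (card (objects_of f A)) \<Longrightarrow>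
      measure_pmf.prob (objects_pmf ({..<n} - A) P K)
        {g. card {w \<in> {..<n} - A. g w \<in> {T. T \<inter> objects_of f A \<noteq> {}}} \<le> q} \<le> h f"
  shows "measure_pmf.prob (objects_pmf {..<n} P K)
           {S. \<phi> (card (objects_of S A)) \<and> card (nbh n S A) \<le> q}
     \<le> expect (objects_pmf A P K) (\<lambda>f. of_bool (\<phi> (card (objects_of f A))) * h f)"
proof -
  have fin: "finite A" using assms finite_subset by auto
  show ?thesis
    unfolding prob_objects_pmf_split[OF assms(1,2)]
  proof (rule expect_mono)
    show "finite (set_pmf (objects_pmf A P K))" using finite_set_objects_pmf assms fin by blast
    fix f assume f: "f \<in> set_pmf (objects_pmf A P K)"
    show "measure_pmf.prob (objects_pmf ({..<n} - A) P K)
        {g. (\<lambda>x. if x \<in> A then f x else g x) \<in> {S. \<phi> (card (objects_of S A)) \<and> card (nbh n S A) \<le> q}}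
      \<le> of_bool (\<phi> (card (objects_of f A))) * h f"
      using h[OF f] unfolding mem_Collect_eq objects_of_merge nbh_merge by auto
  qed
qed

text \<open>The miss factor is the same in all three bounds; they differ in the price of the up to
  \<open>q\<close> exceptional nodes. The first uses the actual hit probability, the second replaces
  it by \<open>1\<close>, and the third counts all subsets, which is the right choice when
  \<open>q\<close> is of order \<open>n\<close>.\<close>

lemma prob_few_hits_le:
  assumes KP: "1 \<le> K" "K \<le> P" and B: "finite B" and U: "U \<subseteq> {..<P}"
  shows "measure_pmf.prob (objects_pmf B P K) {g. card {w \<in> B. g w \<in> {T. T \<inter> U \<noteq> {}}} \<le> q}
     \<le> (1 + real (card B) * (real (card U) * (real K / real P))) ^ q
         * exp (- (real (card U) * real K / real P)) ^ (card B - q)"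
    and "measure_pmf.prob (objects_pmf B P K) {g. card {w \<in> B. g w \<in> {T. T \<inter> U \<noteq> {}}} \<le> q}
     \<le> (1 + real (card B)) ^ q * exp (- (real (card U) * real K / real P)) ^ (card B - q)"
    and "measure_pmf.prob (objects_pmf B P K) {g. card {w \<in> B. g w \<in> {T. T \<inter> U \<noteq> {}}} \<le> q}
     \<le> 2 ^ card B * exp (- (real (card U) * real K / real P)) ^ (card B - q)"
proof -
  have fU: "finite U" using U finite_subset by auto
  have c: "- {T. T \<inter> U \<noteq> {}} = {T. T \<inter> U = {}}" by auto
  have miss: "measure_pmf.prob (object_pmf P K) (- {T. T \<inter> U \<noteq> {}}) \<le> exp (- (real (card U) * real K / real P))"
    unfolding c by (rule prob_miss_le[OF KP U])
  show "measure_pmf.prob (objects_pmf B P K) {g. card {w \<in> B. g w \<in> {T. T \<inter> U \<noteq> {}}} \<le> q}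
     \<le> (1 + real (card B) * (real (card U) * (real K / real P))) ^ q
         * exp (- (real (card U) * real K / real P)) ^ (card B - q)"
    by (rule prob_iid_card_le'[OF B prob_hit_le[OF KP fU] miss]) simp
  show "measure_pmf.prob (objects_pmf B P K) {g. card {w \<in> B. g w \<in> {T. T \<inter> U \<noteq> {}}} \<le> q}
     \<le> (1 + real (card B)) ^ q * exp (- (real (card U) * real K / real P)) ^ (card B - q)"
    using prob_iid_card_le'[OF B _ miss, of 1 "{}" q] by simp
  show "measure_pmf.prob (objects_pmf B P K) {g. card {w \<in> B. g w \<in> {T. T \<inter> U \<noteq> {}}} \<le> q}
     \<le> 2 ^ card B * exp (- (real (card U) * real K / real P)) ^ (card B - q)"
    by (rule prob_iid_card_le_pow2[OF B miss]) simp
qed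

text \<open>With defect \<open>D\<close>, the conditional miss bound is
  \<open>exp (- r \<theta> m)\<close> times \<open>t ^ D\<close>: every lost object makes missing
  cheaper by \<open>t\<close>. As \<open>D > 0\<close> on the event,
  \<open>t ^ D \<le> (s * t) ^ D / s\<close>, and the moment generating function at
  \<open>s * t\<close> bounds the expectation. The free parameter \<open>s\<close> becomes a small
  power of \<open>n\<close>, and \<open>1 / s\<close> is the gain from the overlap.\<close>

lemma prob_overlap_small_nbh_le:
  fixes s t \<theta> :: real
  assumes KP: "1 \<le> K" "K \<le> P" and A: "A \<subseteq> {..<n}" and s: "s \<ge> 1"
    and t: "t = exp (real K * real (n - card A - q) / real P)" and th: "\<theta> = (real K)\<^sup>2 / real P"
  shows "measure_pmf.prob (objects_pmf {..<n} P K)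
           {S. card (objects_of S A) < card A * K \<and> card (nbh n S A) \<le> q}
     \<le> (1 + real n * real (card A) * \<theta>) ^ q * exp (- (real (card A) * \<theta> * real (n - card A - q)))
         * (exp (s * t * \<theta> * (real (card A))\<^sup>2) / s)"
proof -
  have fin: "finite A" using A finite_subset by auto
  define m where "m = n - card A - q"
  define r where "r = card A"
  define C where "C = (1 + real n * real r * \<theta>) ^ q * exp (- (real r * \<theta> * real m))"
  have th0: "\<theta> \<ge> 0" by (simp add: th)
  have t1: "t \<ge> 1" by (simp add: t)
  have C0: "C \<ge> 0" using th0 by (simp add: C_def)
  have cB: "card ({..<n} - A) = n - r" using A fin by (simp add: card_Diff_subset r_def)
  have fM: "finite (set_pmf (objects_pmf A P K))" using finite_set_objects_pmf KP fin by blast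
  have "measure_pmf.prob (objects_pmf {..<n} P K)
           {S. card (objects_of S A) < card A * K \<and> card (nbh n S A) \<le> q}
    \<le> expect (objects_pmf A P K) (\<lambda>f. of_bool (card (objects_of f A) < card A * K)
         * (C * t ^ (card A * K - card (objects_of f A))))"
  proof (rule prob_nbh_le_expect[OF KP(2) A])
    fix f assume f: "f \<in> set_pmf (objects_pmf A P K)"
    note b = objects_of_bounds[OF KP(2) fin f]
    let ?u = "real (card (objects_of f A))"
    let ?D = "card A * K - card (objects_of f A)"
    have u: "?u = real r * real K - real ?D" using b(2) by (simp add: of_nat_diff r_def)
    have ule: "?u \<le> real r * real K" using u by linarith
    have "measure_pmf.prob (objects_pmf ({..<n} - A) P K)
        {g. card {w \<in> {..<n} - A. g w \<in> {T. T \<inter> objects_of f A \<noteq> {}}} \<le> q}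
      \<le> (1 + real (card ({..<n} - A)) * (?u * (real K / real P))) ^ q
         * exp (- (?u * real K / real P)) ^ (card ({..<n} - A) - q)"
      by (rule prob_few_hits_le(1)[OF KP _ b(1)]) simp
    also have "\<dots> = (1 + real (n - r) * (?u * (real K / real P))) ^ q * exp (- (?u * real K / real P)) ^ m"
      unfolding cB m_def r_def by simp
    also have "\<dots> \<le> (1 + real n * real r * \<theta>) ^ q * exp (- (?u * real K / real P)) ^ m"
    proof (intro mult_right_mono power_mono add_left_mono)
      have "?u * (real K / real P) \<le> real r * real K * (real K / real P)"
        using ule by (intro mult_right_mono) auto
      also have "\<dots> = real r * \<theta>" by (simp add: th power2_eq_square)
      finally have *: "?u * (real K / real P) \<le> real r * \<theta>" .
      have "real (n - r) * (?u * (real K / real P)) \<le> real n * (real r * \<theta>)"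
        by (rule mult_mono[OF _ *]) auto
      then show "real (n - r) * (?u * (real K / real P)) \<le> real n * real r * \<theta>" by simp
    qed auto
    also have "exp (- (?u * real K / real P)) ^ m = exp (- (real r * \<theta> * real m)) * t ^ ?D"
    proof -
      have "exp (- (?u * real K / real P)) ^ m = exp (real m * - (?u * real K / real P))"
        by (simp only: exp_of_nat_mult)
      also have "real m * - (?u * real K / real P)
          = - (real r * \<theta> * real m) + real ?D * (real K * real m / real P)"
        unfolding u th by (simp add: power2_eq_square left_diff_distrib right_diff_distrib diff_divide_distrib mult_ac)
      finally show ?thesis unfolding exp_add t m_def[symmetric] exp_of_nat_mult .
    qed
    finally show "measure_pmf.prob (objects_pmf ({..<n} - A) P K)
        {g. card {w \<in> {..<n} - A. g w \<in> {T. T \<inter> objects_of f A \<noteq> {}}} \<le> q} \<le> C * t ^ ?D"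
      by (simp add: C_def mult_ac)
  qed
  also have "\<dots> \<le> expect (objects_pmf A P K) (\<lambda>f. C / s * (s * t) ^ (card A * K - card (objects_of f A)))"
  proof (rule expect_mono[OF fM])
    fix f
    let ?D = "card A * K - card (objects_of f A)"
    show "of_bool (card (objects_of f A) < card A * K) * (C * t ^ ?D) \<le> C / s * (s * t) ^ ?D"
    proof (cases "card (objects_of f A) < card A * K")
      case True
      then obtain d where d: "?D = Suc d" by (metis Suc_diff_Suc)
      have "1 \<le> s ^ d" using s by simp
      then have "C * t ^ ?D \<le> (C * t ^ ?D) * s ^ d"
        using C0 t1 mult_left_mono[of 1 "s ^ d" "C * t ^ ?D"] by simp
      then show ?thesis using True s unfolding d by (simp add: power_mult_distrib mult_ac)
    qed (use C0 s t1 in simp)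
  qed
  also have "\<dots> = C / s * expect (objects_pmf A P K) (\<lambda>f. (s * t) ^ (card A * K - card (objects_of f A)))"
    by simp
  also have "\<dots> \<le> C / s * exp ((s * t - 1) * \<theta> * (real r)\<^sup>2)"
  proof (rule mult_left_mono)
    have "1 \<le> s * t" using s t1 by (metis mult_mono' mult_1 zero_le_one)
    then show "expect (objects_pmf A P K) (\<lambda>f. (s * t) ^ (card A * K - card (objects_of f A)))
        \<le> exp ((s * t - 1) * \<theta> * (real r)\<^sup>2)"
      using expect_power_overlap_le[OF KP fin, of "s * t"] unfolding th r_def by blast
  qed (use C0 s in simp)
  also have "\<dots> \<le> C / s * exp (s * t * \<theta> * (real r)\<^sup>2)"
    using C0 s th0 by (intro mult_left_mono) (auto intro!: mult_right_mono)
  finally show ?thesis by (simp add: C_def r_def m_def)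
qed

lemma prob_single_small_nbh_le:
  fixes \<theta> :: real
  assumes KP: "1 \<le> K" "K \<le> P" and v: "v < n" and th: "\<theta> = (real K)\<^sup>2 / real P"
  shows "measure_pmf.prob (objects_pmf {..<n} P K) {S. card (nbh n S {v}) \<le> q}
     \<le> (1 + real n * \<theta>) ^ q * exp (- (\<theta> * real (n - 1 - q)))"
proof -
  let ?A = "{v}"
  have fM: "finite (set_pmf (objects_pmf ?A P K))" using finite_set_objects_pmf KP by blast
  have th0: "\<theta> \<ge> 0" by (simp add: th)
  have "measure_pmf.prob (objects_pmf {..<n} P K) {S. True \<and> card (nbh n S ?A) \<le> q}
    \<le> expect (objects_pmf ?A P K) (\<lambda>f. of_bool True * ((1 + real n * \<theta>) ^ q * exp (- (\<theta> * real (n - 1 - q)))))"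
  proof (rule prob_nbh_le_expect[OF KP(2)])
    show "?A \<subseteq> {..<n}" using v by simp
    fix f assume f: "f \<in> set_pmf (objects_pmf ?A P K)"
    note b = objects_of_bounds[OF KP(2) _ f]
    have "objects_of f ?A = f v" by (simp add: objects_of_def)
    then have u: "card (objects_of f ?A) = K"
      using objects_pmf_component[OF KP(2) _ f] by simp
    have cB: "card ({..<n} - ?A) = n - 1" using v by simp
    have "measure_pmf.prob (objects_pmf ({..<n} - ?A) P K)
        {g. card {w \<in> {..<n} - ?A. g w \<in> {T. T \<inter> objects_of f ?A \<noteq> {}}} \<le> q}
      \<le> (1 + real (n - 1) * (real K * (real K / real P))) ^ q * exp (- (real K * real K / real P)) ^ (n - 1 - q)"
      using prob_few_hits_le(1)[OF KP, of "{..<n} - ?A" "objects_of f ?A" q] b(1) unfolding u cB by simp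
    also have "\<dots> \<le> (1 + real n * \<theta>) ^ q * exp (- \<theta>) ^ (n - 1 - q)"
      by (intro mult_mono power_mono add_left_mono) (auto simp: th power2_eq_square)
    also have "exp (- \<theta>) ^ (n - 1 - q) = exp (- (\<theta> * real (n - 1 - q)))"
      by (simp add: exp_of_nat_mult[symmetric] mult_ac)
    finally show "measure_pmf.prob (objects_pmf ({..<n} - ?A) P K)
        {g. card {w \<in> {..<n} - ?A. g w \<in> {T. T \<inter> objects_of f ?A \<noteq> {}}} \<le> q}
      \<le> (1 + real n * \<theta>) ^ q * exp (- (\<theta> * real (n - 1 - q)))" .
  qed
  then show ?thesis by simp
qed

text \<open>A Chernoff bound for the event that the defect exceeds half of
  \<open>card A * K\<close>. The parameter \<open>y\<close> will be chosen according to the ratio of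
  \<open>n\<close> to \<open>card A\<close>.\<close>

lemma prob_few_objects_le:
  fixes y \<theta> :: real
  assumes KP: "1 \<le> K" "K \<le> P" and A: "A \<subseteq> {..<n}" and y: "y \<ge> 0" and th: "\<theta> = (real K)\<^sup>2 / real P"
  shows "measure_pmf.prob (objects_pmf {..<n} P K) {S. 2 * card (objects_of S A) < card A * K}
     \<le> exp (- (y * real (card A) * real K / 2) + (exp y - 1) * \<theta> * (real (card A))\<^sup>2)"
proof -
  have fin: "finite A" using A finite_subset by auto
  have fM: "finite (set_pmf (objects_pmf A P K))" using finite_set_objects_pmf KP fin by blast
  have "measure_pmf.prob (objects_pmf {..<n} P K) {S. 2 * card (objects_of S A) < card A * K}
     = expect (objects_pmf A P K) (\<lambda>f. of_bool (2 * card (objects_of f A) < card A * K))"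
    by (rule prob_objects_of[OF KP(2) A])
  also have "\<dots> \<le> expect (objects_pmf A P K) (\<lambda>f. exp (- (y * real (card A) * real K / 2))
      * exp y ^ (card A * K - card (objects_of f A)))"
  proof (rule expect_mono[OF fM])
    fix f assume f: "f \<in> set_pmf (objects_pmf A P K)"
    note b = objects_of_bounds[OF KP(2) fin f]
    let ?D = "card A * K - card (objects_of f A)"
    show "of_bool (2 * card (objects_of f A) < card A * K)
        \<le> exp (- (y * real (card A) * real K / 2)) * exp y ^ ?D"
    proof (cases "2 * card (objects_of f A) < card A * K")
      case True
      then have "real (card A * K) \<le> real (2 * ?D)" by (intro of_nat_mono) linarith
      then have "real (card A) * real K \<le> 2 * real ?D" by simp
      then have "y * (real (card A) * real K) \<le> y * (2 * real ?D)" using y by (intro mult_left_mono) auto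
      then have "0 \<le> - (y * real (card A) * real K / 2) + real ?D * y" by (simp add: mult_ac)
      then have "1 \<le> exp (- (y * real (card A) * real K / 2) + real ?D * y)" by simp
      then show ?thesis using True unfolding exp_add exp_of_nat_mult by simp
    qed simp
  qed
  also have "\<dots> = exp (- (y * real (card A) * real K / 2))
      * expect (objects_pmf A P K) (\<lambda>f. exp y ^ (card A * K - card (objects_of f A)))" by simp
  also have "\<dots> \<le> exp (- (y * real (card A) * real K / 2)) * exp ((exp y - 1) * \<theta> * (real (card A))\<^sup>2)"
    using expect_power_overlap_le[OF KP fin, of "exp y"] y unfolding th by (intro mult_left_mono) auto
  finally show ?thesis unfolding exp_add .
qed

text \<open>If at least half of the possible objects are present, an outer node misses them all with
  probability at most \<open>exp (- card A * \<theta> / 2)\<close>. The two conclusions differ in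
  the price of the \<open>q\<close> exceptions; the second is meant for \<open>q\<close> of order
  \<open>n\<close>.\<close>

lemma prob_many_objects_small_nbh_le:
  fixes \<theta> :: real
  assumes KP: "1 \<le> K" "K \<le> P" and A: "A \<subseteq> {..<n}" and th: "\<theta> = (real K)\<^sup>2 / real P"
  shows "measure_pmf.prob (objects_pmf {..<n} P K)
           {S. card A * K \<le> 2 * card (objects_of S A) \<and> card (nbh n S A) \<le> q}
     \<le> (1 + real n) ^ q * exp (- (real (card A) * \<theta> * real (n - card A - q) / 2))"
    and "measure_pmf.prob (objects_pmf {..<n} P K)
           {S. card A * K \<le> 2 * card (objects_of S A) \<and> card (nbh n S A) \<le> q}
     \<le> 2 ^ n * exp (- (real (card A) * \<theta> * real (n - card A - q) / 2))"
proof -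
  have fin: "finite A" using A finite_subset by auto
  have fM: "finite (set_pmf (objects_pmf A P K))" using finite_set_objects_pmf KP fin by blast
  define m where "m = n - card A - q"
  define E where "E = exp (- (real (card A) * \<theta> * real m / 2))"
  have cB: "card ({..<n} - A) = n - card A" using A fin by (simp add: card_Diff_subset)
  have main: "measure_pmf.prob (objects_pmf {..<n} P K)
           {S. card A * K \<le> 2 * card (objects_of S A) \<and> card (nbh n S A) \<le> q} \<le> c * E"
    if c: "c \<ge> 0" "\<And>U. U \<subseteq> {..<P} \<Longrightarrow> measure_pmf.prob (objects_pmf ({..<n} - A) P K)
        {g. card {w \<in> {..<n} - A. g w \<in> {T. T \<inter> U \<noteq> {}}} \<le> q}
        \<le> c * exp (- (real (card U) * real K / real P)) ^ (card ({..<n} - A) - q)" for c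
  proof -
    have "measure_pmf.prob (objects_pmf {..<n} P K)
           {S. card A * K \<le> 2 * card (objects_of S A) \<and> card (nbh n S A) \<le> q}
      \<le> expect (objects_pmf A P K) (\<lambda>f. of_bool (card A * K \<le> 2 * card (objects_of f A)) * (c * E))"
    proof (rule prob_nbh_le_expect[OF KP(2) A])
      fix f assume f: "f \<in> set_pmf (objects_pmf A P K)" and big: "card A * K \<le> 2 * card (objects_of f A)"
      note b = objects_of_bounds[OF KP(2) fin f]
      let ?u = "real (card (objects_of f A))"
      have "exp (- (?u * real K / real P)) ^ m = exp (real m * - (?u * real K / real P))"
        by (simp only: exp_of_nat_mult)
      also have "\<dots> \<le> E"
      proof -
        have "real (card A * K) \<le> real (2 * card (objects_of f A))" using big by (rule of_nat_mono)
        then have "real (card A) * real K \<le> 2 * ?u" by simp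
        then have "(real (card A) * real K) * (real m * real K / real P) \<le> (2 * ?u) * (real m * real K / real P)"
          by (intro mult_right_mono) auto
        moreover have "real (card A) * \<theta> * real m = (real (card A) * real K) * (real m * real K / real P)"
          by (simp add: th power2_eq_square)
        moreover have "real m * - (?u * real K / real P) = - (?u * (real m * real K / real P))" by simp
        ultimately show ?thesis unfolding E_def exp_le_cancel_iff by linarith
      qed
      finally have "c * exp (- (?u * real K / real P)) ^ m \<le> c * E" using c(1) by (intro mult_left_mono)
      then show "measure_pmf.prob (objects_pmf ({..<n} - A) P K)
        {g. card {w \<in> {..<n} - A. g w \<in> {T. T \<inter> objects_of f A \<noteq> {}}} \<le> q} \<le> c * E"
        using c(2)[OF b(1)] unfolding cB m_def by simp
    qed
    also have "\<dots> \<le> expect (objects_pmf A P K) (\<lambda>f. c * E)"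
      by (rule expect_mono[OF fM]) (use c(1) in \<open>auto simp: E_def\<close>)
    finally show ?thesis by simp
  qed
  have "measure_pmf.prob (objects_pmf {..<n} P K)
           {S. card A * K \<le> 2 * card (objects_of S A) \<and> card (nbh n S A) \<le> q} \<le> (1 + real (card ({..<n} - A))) ^ q * E"
    by (rule main, simp, rule prob_few_hits_le(2)[OF KP], simp)
  also have "\<dots> \<le> (1 + real n) ^ q * E"
    unfolding cB by (intro mult_right_mono power_mono) (auto simp: E_def)
  finally show "measure_pmf.prob (objects_pmf {..<n} P K)
           {S. card A * K \<le> 2 * card (objects_of S A) \<and> card (nbh n S A) \<le> q}
     \<le> (1 + real n) ^ q * exp (- (real (card A) * \<theta> * real (n - card A - q) / 2))" by (simp add: E_def m_def)
  have "measure_pmf.prob (objects_pmf {..<n} P K)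
           {S. card A * K \<le> 2 * card (objects_of S A) \<and> card (nbh n S A) \<le> q} \<le> 2 ^ card ({..<n} - A) * E"
    by (rule main, simp, rule prob_few_hits_le(3)[OF KP], simp)
  also have "\<dots> \<le> 2 ^ n * E"
    unfolding cB by (intro mult_right_mono power_increasing) (auto simp: E_def)
  finally show "measure_pmf.prob (objects_pmf {..<n} P K)
           {S. card A * K \<le> 2 * card (objects_of S A) \<and> card (nbh n S A) \<le> q}
     \<le> 2 ^ n * exp (- (real (card A) * \<theta> * real (n - card A - q) / 2))" by (simp add: E_def m_def)
qed

section \<open>Connectivity given the minimum degree\<close>

lemma sum_power_fact_le_exp:
  fixes x :: real
  assumes "x \<ge> 0" "finite I"
  shows "(\<Sum>i\<in>I. x ^ i / fact i) \<le> exp x"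
proof -
  have "(\<lambda>i. x ^ i / fact i) sums exp x"
    using exp_converges[of x] by (simp add: field_simps)
  then show ?thesis using sum_le_suminf[of "\<lambda>i. x ^ i / fact i" I] assms
    by (auto simp: sums_iff)
qed

lemma power_le_fact_exp:
  fixes x :: real
  assumes "x \<ge> 0"
  shows "x ^ i \<le> fact i * exp x"
  using sum_power_fact_le_exp[OF assms, of "{i}"] by (simp add: field_simps)

lemma choose_le_power_fact: "real (n choose r) \<le> real n ^ r / fact r"
proof -
  have "fact r * (n choose r) \<le> n ^ r"
    by (cases "r \<le> n") (use binomial_fact_pow[of n r] in \<open>auto simp: mult.commute binomial_eq_0\<close>)
  then have "real (fact r * (n choose r)) \<le> real (n ^ r)" by (rule of_nat_mono)
  then show ?thesis by (simp add: field_simps)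
qed

text \<open>This is the classical \<open>(e n / r) ^ r\<close>, a consequence of
  \<open>r ^ r \<le> fact r * exp r\<close>, written as an exponential so that it can be compared
  with tail bounds.\<close>

lemma choose_le_exp:
  assumes "r \<ge> 1" "n \<ge> 1"
  shows "real (n choose r) \<le> exp (real r * (1 + ln (real n / real r)))"
proof -
  have "real n ^ r / fact r = (real n / real r) ^ r * (real r ^ r / fact r)"
    using assms by (simp add: power_divide)
  also have "\<dots> \<le> (real n / real r) ^ r * exp (real r)"
    using power_le_fact_exp[of "real r" r] by (intro mult_left_mono) (auto simp: field_simps)
  also have "real n / real r = exp (ln (real n / real r))" using assms by simp
  also have "exp (ln (real n / real r)) ^ r * exp (real r) = exp (real r * (1 + ln (real n / real r)))"
    by (simp only: exp_of_nat_mult[symmetric] exp_add[symmetric]) (simp add: algebra_simps)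
  finally show ?thesis using choose_le_power_fact[of n r] by linarith
qed

lemma union_bound_subsets:
  assumes "finite I"
    and cover: "\<And>S. S \<in> set_pmf M \<Longrightarrow> S \<in> Ev \<Longrightarrow> \<exists>A\<subseteq>{..<n::nat}. card A \<in> I \<and> S \<in> X A"
    and b: "\<And>A. A \<subseteq> {..<n} \<Longrightarrow> card A \<in> I \<Longrightarrow> measure_pmf.prob M (X A) \<le> b (card A)"
  shows "measure_pmf.prob M Ev \<le> (\<Sum>r\<in>I. real (n choose r) * b r)"
proof -
  define J where "J = {A. A \<subseteq> {..<n} \<and> card A \<in> I}"
  have fJ: "finite J" by (auto simp: J_def)
  have "measure_pmf.prob M Ev \<le> (\<Sum>A\<in>J. measure_pmf.prob M (X A))"
    by (rule prob_le_sum[OF fJ]) (use cover in \<open>auto simp: J_def\<close>)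
  also have "\<dots> \<le> (\<Sum>A\<in>J. b (card A))" by (rule sum_mono) (use b in \<open>auto simp: J_def\<close>)
  also have "\<dots> = (\<Sum>r\<in>I. \<Sum>A\<in>{A \<in> J. card A = r}. b (card A))"
    using fJ assms(1) by (intro sum.group[symmetric]) (auto simp: J_def)
  also have "\<dots> = (\<Sum>r\<in>I. real (n choose r) * b r)"
  proof (rule sum.cong[OF refl])
    fix r assume r: "r \<in> I"
    have "{A \<in> J. card A = r} = {A. A \<subseteq> {..<n} \<and> card A = r}" using r by (auto simp: J_def)
    then have "card {A \<in> J. card A = r} = n choose r" using n_subsets[of "{..<n}" r] by simp
    moreover have "(\<Sum>A\<in>{A \<in> J. card A = r}. b (card A)) = (\<Sum>A\<in>{A \<in> J. card A = r}. b r)"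
      by (rule sum.cong) auto
    ultimately show "(\<Sum>A\<in>{A \<in> J. card A = r}. b (card A)) = real (n choose r) * b r" by simp
  qed
  finally show ?thesis .
qed

text \<open>
  The admissible parameters: \<open>c\<close> is the constant in \<open>K = \<Omega>(\<surd>(ln n))\<close>, and \<open>n K\<^sup>2 / P\<close> is at
  most \<open>3 ln n\<close>. All estimates are uniform in them, which avoids sequences.
\<close>

definition admissible :: "real \<Rightarrow> nat \<Rightarrow> nat \<Rightarrow> nat \<Rightarrow> bool" where
  "admissible c n P K \<longleftrightarrow> 1 \<le> K \<and> K \<le> P \<and> c * sqrt (ln (real n)) \<le> real K \<and>
     real n * ((real K)\<^sup>2 / real P) \<le> 3 * ln (real n)"

text \<open>For \<open>r = card A\<close> there are at most \<open>n ^ r / fact r\<close> sets, and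
  the misses give back \<open>n\<close> to the power \<open>- r\<close> up to a constant to the
  power \<open>r\<close>, since \<open>n \<theta> \<ge> ln n - C0\<close>. The sum over
  \<open>r\<close> is therefore bounded by an exponential series, and a power of \<open>ln n\<close>
  divided by \<open>s = n powr (1/20)\<close> remains. Without the overlap this union bound would
  not tend to zero.\<close>

lemma overlap_small_nbh_union_bound:
  fixes c C0 \<epsilon> :: real
  assumes c: "c > 0" and eps: "\<epsilon> > 0"
  shows "\<forall>\<^sub>F n in sequentially. \<forall>P K. admissible c n P K \<and> ln (real n) - C0 \<le> real n * ((real K)\<^sup>2 / real P) \<longrightarrow>
    measure_pmf.prob (objects_pmf {..<n} P K)
      {S. \<exists>A\<subseteq>{..<n}. 1 \<le> card A \<and> real (card A) \<le> real n powr 0.9 \<and>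
          card (objects_of S A) < card A * K \<and> card (nbh n S A) \<le> q} \<le> \<epsilon>"
proof -
  define d where "d = 3 / c"
  have d: "d > 0" using c by (simp add: d_def)
  have e1: "\<forall>\<^sub>F n in sequentially. 3 * ln (real n) / real n * (real n powr 0.9 + real q) \<le> 1"
    by real_asymp
  \<comment> \<open>The exponents satisfy \<open>1/20 + 0.9 - 1 < 0\<close>, and
    \<open>exp (d * sqrt (ln n))\<close> grows more slowly than every power of \<open>n\<close>. So
    \<open>s * t * \<theta> * r\<close> stays below \<open>1\<close> up to
    \<open>r = n powr 0.9\<close>.\<close>
  have e2: "\<forall>\<^sub>F n in sequentially.
      real n powr (1/20) * exp (d * sqrt (ln (real n))) * (3 * ln (real n) / real n) * real n powr 0.9 \<le> 1"
    using d by real_asymp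
  have e3: "\<forall>\<^sub>F n in sequentially. ln (real n) \<ge> 1" by real_asymp
  have e4: "\<forall>\<^sub>F n in sequentially. real n powr 0.9 + real q \<le> real n" by real_asymp
  have "(\<lambda>n::nat. (4 * ln (real n)) ^ q * real n powr (-1/20) * (fact q * exp (exp (C0 + 3)))) \<longlonglongrightarrow> 0"
    by (rule tendsto_mult_left_zero) real_asymp
  then have e5: "\<forall>\<^sub>F n in sequentially.
      (4 * ln (real n)) ^ q * real n powr (-1/20) * (fact q * exp (exp (C0 + 3))) < \<epsilon>"
    using eps by (rule order_tendstoD)
  show ?thesis
    using e1 e2 e3 e4 e5
  proof eventually_elim
    case (elim n)
    show ?case
    proof (intro allI impI)
      fix P K assume as: "admissible c n P K \<and> ln (real n) - C0 \<le> real n * ((real K)\<^sup>2 / real P)"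
      define L where "L = ln (real n)"
      define \<theta> where "\<theta> = (real K)\<^sup>2 / real P"
      define s where "s = real n powr (1/20)"
      have KP: "1 \<le> K" "K \<le> P" and Kc: "c * sqrt L \<le> real K" and lam: "real n * \<theta> \<le> 3 * L" "L - C0 \<le> real n * \<theta>"
        using as by (auto simp: admissible_def L_def \<theta>_def)
      have L1: "L \<ge> 1" using elim by (simp add: L_def)
      have n0: "real n > 0" using L1 by (cases "n = 0") (auto simp: L_def)
      have n1: "n \<ge> 1" using n0 by simp
      have th0: "\<theta> \<ge> 0" by (simp add: \<theta>_def)
      have thle: "\<theta> \<le> 3 * L / real n" using lam n0 by (simp add: field_simps)
      have s1: "s \<ge> 1" using n1 by (simp add: s_def ge_one_powr_ge_zero)
      define I where "I = {r \<in> {1..n}. real r \<le> real n powr 0.9}"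
      define b where "b = (\<lambda>r. (4 * L * real r) ^ q * exp (- (real r * (L - C0 - 1))) * (exp (real r) / s))"
      have "measure_pmf.prob (objects_pmf {..<n} P K)
        {S. \<exists>A\<subseteq>{..<n}. 1 \<le> card A \<and> real (card A) \<le> real n powr 0.9 \<and>
          card (objects_of S A) < card A * K \<and> card (nbh n S A) \<le> q}
        \<le> (\<Sum>r\<in>I. real (n choose r) * b r)"
      proof (rule union_bound_subsets[where X = "\<lambda>A. {S. card (objects_of S A) < card A * K \<and> card (nbh n S A) \<le> q}"])
        show "finite I" by (simp add: I_def)
      next
        fix S assume "S \<in> {S. \<exists>A\<subseteq>{..<n}. 1 \<le> card A \<and> real (card A) \<le> real n powr 0.9 \<and>
          card (objects_of S A) < card A * K \<and> card (nbh n S A) \<le> q}"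
        then obtain A where A: "A \<subseteq> {..<n}" "1 \<le> card A" "real (card A) \<le> real n powr 0.9"
          "card (objects_of S A) < card A * K \<and> card (nbh n S A) \<le> q" by blast
        have "card A \<le> n" using card_mono[OF _ A(1)] by simp
        then show "\<exists>A\<subseteq>{..<n}. card A \<in> I \<and> S \<in> {S. card (objects_of S A) < card A * K \<and> card (nbh n S A) \<le> q}"
          using A by (auto simp: I_def)
      next
        fix A assume A: "A \<subseteq> {..<n}" "card A \<in> I"
        define r where "r = card A"
        have r: "1 \<le> r" "real r \<le> real n powr 0.9" using A by (auto simp: I_def r_def)
        define m where "m = n - card A - q"
        have rq: "real r + real q \<le> real n" using elim r by linarith
        then have "r + q \<le> n" by linarith
        then have m: "real m = real n - real r - real q" unfolding m_def r_def[symmetric] by simp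
        define t where "t = exp (real K * real m / real P)"
        have "measure_pmf.prob (objects_pmf {..<n} P K) {S. card (objects_of S A) < card A * K \<and> card (nbh n S A) \<le> q}
           \<le> (1 + real n * real r * \<theta>) ^ q * exp (- (real r * \<theta> * real m)) * (exp (s * t * \<theta> * (real r)\<^sup>2) / s)"
          unfolding r_def m_def
          by (rule prob_overlap_small_nbh_le[OF KP A(1) s1 _ \<theta>_def]) (simp add: t_def m_def)
        also have "\<dots> \<le> b r"
          unfolding b_def
        proof (intro mult_mono power_mono divide_right_mono)
          have "real n * real r * \<theta> \<le> 3 * L * real r"
            using lam(1) mult_right_mono[of "real n * \<theta>" "3 * L" "real r"] by (simp add: mult_ac)
          moreover have "1 \<le> L * real r" using L1 r(1) mult_mono[of 1 L 1 "real r"] by simp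
          ultimately show "1 + real n * real r * \<theta> \<le> 4 * L * real r" by linarith
          \<comment> \<open>Leaving out the \<open>r\<close> nodes of \<open>A\<close> and the
            \<open>q\<close> exceptions lowers \<open>n \<theta>\<close> by at most
            \<open>1\<close>.\<close>
          have "\<theta> * (real r + real q) \<le> 3 * L / real n * (real n powr 0.9 + real q)"
            using thle r th0 by (intro mult_mono) auto
          also have "\<dots> \<le> 1" using elim by (simp add: L_def)
          finally have "L - C0 - 1 \<le> \<theta> * real m" using lam(2) unfolding m by (simp add: algebra_simps)
          then have "real r * (L - C0 - 1) \<le> real r * (\<theta> * real m)" by (intro mult_left_mono) auto
          then show "exp (- (real r * \<theta> * real m)) \<le> exp (- (real r * (L - C0 - 1)))" by (simp add: mult_ac)
          have "real K * real m / real P \<le> real K * real n / real P"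
            by (intro divide_right_mono mult_left_mono) (auto simp: m_def)
          also have "\<dots> = real n * \<theta> / real K" using KP by (simp add: \<theta>_def power2_eq_square field_simps)
          also have "\<dots> \<le> 3 * L / real K" using lam by (intro divide_right_mono) auto
          also have "\<dots> \<le> 3 * L / (c * sqrt L)" using Kc c L1 KP by (intro divide_left_mono) auto
          also have "\<dots> = d * sqrt L" using c L1 real_div_sqrt[of L] by (simp add: d_def field_simps)
          finally have t: "t \<le> exp (d * sqrt L)" by (simp add: t_def)
          have "s * t * \<theta> * real r \<le> s * exp (d * sqrt L) * (3 * L / real n) * real n powr 0.9"
            using s1 t thle r th0 L1 by (intro mult_mono) (auto simp: t_def)
          also have "\<dots> \<le> 1" using elim by (simp add: s_def L_def)
          finally have "s * t * \<theta> * real r * real r \<le> 1 * real r" by (intro mult_right_mono) auto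
          then show "exp (s * t * \<theta> * (real r)\<^sup>2) \<le> exp (real r)" by (simp add: power2_eq_square mult_ac)
        qed (use th0 s1 L1 in auto)
        finally show "measure_pmf.prob (objects_pmf {..<n} P K)
            {S. card (objects_of S A) < card A * K \<and> card (nbh n S A) \<le> q} \<le> b (card A)" by (simp add: r_def)
      qed
      \<comment> \<open>In \<open>C0 + 3\<close>, one unit each stems from the loss in
        \<open>\<theta> * m\<close>, from the overlap factor \<open>exp r\<close>, and from
        absorbing \<open>r ^ q\<close> by \<open>r ^ q \<le> fact q * exp r\<close>.\<close>
      also have "\<dots> \<le> (\<Sum>r\<in>I. (4 * L) ^ q / s * fact q * (exp (C0 + 3) ^ r / fact r))"
      proof (rule sum_mono)
        fix r assume r: "r \<in> I"
        have "real (n choose r) * b r \<le> real n ^ r / fact r * b r"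
          using choose_le_power_fact s1 L1 by (intro mult_right_mono) (auto simp: b_def)
        also have "real n ^ r = exp (real r * L)" using n0 by (simp add: exp_of_nat_mult L_def)
        also have "exp (real r * L) / fact r * b r
           = (4 * L) ^ q / s * real r ^ q * (exp (real r * L) * exp (- (real r * (L - C0 - 1))) * exp (real r)) / fact r"
          by (simp add: b_def power_mult_distrib field_simps)
        also have "exp (real r * L) * exp (- (real r * (L - C0 - 1))) * exp (real r) = exp (real r * (C0 + 2))"
          unfolding exp_add[symmetric] by (simp add: algebra_simps)
        also have "(4 * L) ^ q / s * real r ^ q * exp (real r * (C0 + 2)) / fact r
           \<le> (4 * L) ^ q / s * (fact q * exp (real r)) * exp (real r * (C0 + 2)) / fact r"
          using power_le_fact_exp[of "real r" q] L1 s1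
          by (intro divide_right_mono mult_right_mono mult_left_mono) auto
        also have "\<dots> = (4 * L) ^ q / s * fact q * ((exp (real r) * exp (real r * (C0 + 2))) / fact r)" by simp
        also have "exp (real r) * exp (real r * (C0 + 2)) = exp (C0 + 3) ^ r"
          unfolding exp_add[symmetric] exp_of_nat_mult[symmetric] by (simp add: algebra_simps)
        finally show "real (n choose r) * b r \<le> (4 * L) ^ q / s * fact q * (exp (C0 + 3) ^ r / fact r)" .
      qed
      also have "\<dots> = (4 * L) ^ q / s * fact q * (\<Sum>r\<in>I. exp (C0 + 3) ^ r / fact r)"
        by (simp add: sum_distrib_left)
      also have "\<dots> \<le> (4 * L) ^ q / s * fact q * exp (exp (C0 + 3))"
        using L1 s1 by (intro mult_left_mono sum_power_fact_le_exp) (auto simp: I_def)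
      also have "\<dots> = (4 * ln (real n)) ^ q * real n powr (-1/20) * (fact q * exp (exp (C0 + 3)))"
        by (simp add: L_def s_def powr_minus_divide)
      also have "\<dots> \<le> \<epsilon>" using elim by simp
      finally show "measure_pmf.prob (objects_pmf {..<n} P K)
        {S. \<exists>A\<subseteq>{..<n}. 1 \<le> card A \<and> real (card A) \<le> real n powr 0.9 \<and>
          card (objects_of S A) < card A * K \<and> card (nbh n S A) \<le> q} \<le> \<epsilon>" .
    qed
  qed
qed

text \<open>Put \<open>x = n / r\<close>. The Chernoff parameter \<open>y = ln x / 4\<close> yields
  the exponent \<open>- r K ln x / 8\<close>, of which the moment generating function takes back at
  most half. Because \<open>K\<close> grows, the remainder beats the
  \<open>exp (r (1 + ln x))\<close> choices of \<open>A\<close>, leaving at most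
  \<open>(1 / x) ^ r\<close>.\<close>

lemma few_objects_union_bound:
  fixes c \<epsilon> :: real
  assumes c: "c > 0" and eps: "\<epsilon> > 0"
  shows "\<forall>\<^sub>F n in sequentially. \<forall>P K. admissible c n P K \<longrightarrow>
    measure_pmf.prob (objects_pmf {..<n} P K)
      {S. \<exists>A\<subseteq>{..<n}. 1 \<le> card A \<and> real (card A) \<le> 128 * real n / ln (real n) \<and>
          2 * card (objects_of S A) < card A * K} \<le> \<epsilon>"
proof -
  \<comment> \<open>On this range \<open>x\<close> is at least \<open>ln n / 128\<close>, so
    \<open>exp y / x = x powr (-3/4)\<close> leaves a term of order \<open>ln n\<close> to the power
    \<open>1/4\<close>, which \<open>c * sqrt (ln n)\<close> dominates.\<close>
  have e1: "\<forall>\<^sub>F n in sequentially. 3 * ln (real n) * (ln (real n) / 128) powr (-3/4) \<le> c * sqrt (ln (real n)) / 16"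
    using c by real_asymp
  have e2: "\<forall>\<^sub>F n in sequentially. ln (real n) / 128 \<ge> exp 1" by real_asymp
  \<comment> \<open>With \<open>K \<ge> 64\<close> the gain \<open>K ln x / 16\<close> is at least
    \<open>4 ln x\<close>; as \<open>ln x \<ge> 1\<close>, it pays for \<open>1 + ln x\<close> and
    leaves \<open>ln x\<close> to spare.\<close>
  have e3: "\<forall>\<^sub>F n in sequentially. c * sqrt (ln (real n)) \<ge> 64" using c by real_asymp
  have e4: "\<forall>\<^sub>F n in sequentially. 2 * (128 / ln (real n)) \<le> \<epsilon>" using eps by real_asymp
  have e5: "\<forall>\<^sub>F n in sequentially. 128 / ln (real n) \<le> 1 / 2" by real_asymp
  have e6: "\<forall>\<^sub>F n in sequentially. ln (real n) \<ge> 1" by real_asymp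
  show ?thesis
    using e1 e2 e3 e4 e5 e6
  proof eventually_elim
    case (elim n)
    show ?case
    proof (intro allI impI)
      fix P K assume as: "admissible c n P K"
      define L where "L = ln (real n)"
      define \<theta> where "\<theta> = (real K)\<^sup>2 / real P"
      have KP: "1 \<le> K" "K \<le> P" and Kc: "c * sqrt L \<le> real K" and lam: "real n * \<theta> \<le> 3 * L"
        using as by (auto simp: admissible_def L_def \<theta>_def)
      have L1: "L \<ge> 1" using elim by (simp add: L_def)
      have n0: "real n > 0" using L1 by (cases "n = 0") (auto simp: L_def)
      have n1: "n \<ge> 1" using n0 by simp
      have th0: "\<theta> \<ge> 0" by (simp add: \<theta>_def)
      define z where "z = 128 / L"
      have z: "0 \<le> z" "z \<le> 1 / 2" using elim L1 by (auto simp: z_def L_def)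
      define I where "I = {r \<in> {1..n}. real r \<le> 128 * real n / L}"
      define b where "b = (\<lambda>r. exp (- (real r * real K * ln (real n / real r) / 16)))"
      have "measure_pmf.prob (objects_pmf {..<n} P K)
        {S. \<exists>A\<subseteq>{..<n}. 1 \<le> card A \<and> real (card A) \<le> 128 * real n / ln (real n) \<and>
          2 * card (objects_of S A) < card A * K} \<le> (\<Sum>r\<in>I. real (n choose r) * b r)"
      proof (rule union_bound_subsets[where X = "\<lambda>A. {S. 2 * card (objects_of S A) < card A * K}"])
        show "finite I" by (simp add: I_def)
      next
        fix S assume "S \<in> {S. \<exists>A\<subseteq>{..<n}. 1 \<le> card A \<and> real (card A) \<le> 128 * real n / ln (real n) \<and>
          2 * card (objects_of S A) < card A * K}"
        then obtain A where A: "A \<subseteq> {..<n}" "1 \<le> card A" "real (card A) \<le> 128 * real n / ln (real n)"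
          "2 * card (objects_of S A) < card A * K" by blast
        have "card A \<le> n" using card_mono[OF _ A(1)] by simp
        then show "\<exists>A\<subseteq>{..<n}. card A \<in> I \<and> S \<in> {S. 2 * card (objects_of S A) < card A * K}"
          using A by (auto simp: I_def L_def)
      next
        fix A assume A: "A \<subseteq> {..<n}" "card A \<in> I"
        define r where "r = card A"
        define x where "x = real n / real r"
        have r: "1 \<le> r" "real r \<le> 128 * real n / L" using A by (auto simp: I_def r_def)
        have x: "L / 128 \<le> x" using r L1 by (simp add: x_def field_simps)
        have x0: "x > 0" using n0 r by (simp add: x_def)
        have "exp 1 \<le> x" using x elim by (simp add: L_def)
        then have lnx: "1 \<le> ln x" using x0 by (simp add: ln_ge_iff)
        define y where "y = ln x / 4"
        have ey: "exp y = x powr (1/4)" using x0 by (simp add: y_def powr_def)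
        have "measure_pmf.prob (objects_pmf {..<n} P K) {S. 2 * card (objects_of S A) < card A * K}
           \<le> exp (- (y * real r * real K / 2) + (exp y - 1) * \<theta> * (real r)\<^sup>2)"
          unfolding r_def by (rule prob_few_objects_le[OF KP A(1) _ \<theta>_def]) (use lnx in \<open>simp add: y_def\<close>)
        also have "\<dots> \<le> b r"
          unfolding b_def exp_le_cancel_iff
        proof -
          have "(exp y - 1) * \<theta> * (real r)\<^sup>2 \<le> exp y * \<theta> * (real r)\<^sup>2"
            using th0 by (intro mult_right_mono) auto
          also have "\<dots> = x powr (1/4) * ((real n * \<theta>) * (real r / x))"
            using n0 r by (simp add: ey x_def power2_eq_square)
          also have "\<dots> \<le> x powr (1/4) * ((3 * L) * (real r / x))"
            using lam x0 by (intro mult_left_mono mult_right_mono) auto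
          also have "\<dots> = 3 * L * (x powr (1/4) / x) * real r" by simp
          also have "x powr (1/4) / x = x powr (-3/4)"
            using x0 powr_diff[of x "1/4" 1] by simp
          also have "3 * L * x powr (-3/4) * real r \<le> 3 * L * (L / 128) powr (-3/4) * real r"
            using x L1 by (intro mult_right_mono mult_left_mono powr_mono2') auto
          also have "\<dots> \<le> (c * sqrt L / 16) * real r"
            using elim by (intro mult_right_mono) (auto simp: L_def)
          also have "\<dots> \<le> (real K / 16) * real r"
            using Kc by (intro mult_right_mono divide_right_mono) auto
          also have "\<dots> \<le> (real K / 16) * real r * ln x"
            using lnx mult_left_mono[of 1 "ln x" "real K / 16 * real r"] by simp
          finally have "(exp y - 1) * \<theta> * (real r)\<^sup>2 \<le> real r * real K * ln x / 16" by (simp add: mult_ac)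
          then show "- (y * real r * real K / 2) + (exp y - 1) * \<theta> * (real r)\<^sup>2
              \<le> - (real r * real K * ln (real n / real r) / 16)"
            unfolding x_def[symmetric] y_def by (simp add: mult_ac)
        qed
        finally show "measure_pmf.prob (objects_pmf {..<n} P K)
            {S. 2 * card (objects_of S A) < card A * K} \<le> b (card A)" by (simp add: r_def)
      qed
      also have "\<dots> \<le> (\<Sum>r\<in>I. z ^ r)"
      proof (rule sum_mono)
        fix r assume "r \<in> I"
        then have r: "1 \<le> r" "real r \<le> 128 * real n / L" by (auto simp: I_def)
        define x where "x = real n / real r"
        have x: "L / 128 \<le> x" using r L1 by (simp add: x_def field_simps)
        have x0: "x > 0" using n0 r by (simp add: x_def)
        have "exp 1 \<le> x" using x elim by (simp add: L_def)
        then have lnx: "1 \<le> ln x" using x0 by (simp add: ln_ge_iff)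
        have "real (n choose r) * b r \<le> exp (real r * (1 + ln x)) * b r"
          unfolding x_def using r n1 by (intro mult_right_mono choose_le_exp) (auto simp: b_def)
        also have "\<dots> = exp (real r * (1 + ln x - real K * ln x / 16))"
          unfolding b_def x_def exp_add[symmetric] by (simp add: algebra_simps)
        also have "\<dots> \<le> exp (real r * (- ln x))"
        proof -
          have "64 \<le> real K" using Kc elim by (simp add: L_def)
          then have "64 * ln x \<le> real K * ln x" using lnx by (intro mult_right_mono) auto
          then have "1 + ln x - real K * ln x / 16 \<le> - ln x" using lnx by linarith
          then show ?thesis unfolding exp_le_cancel_iff by (intro mult_left_mono) auto
        qed
        also have "\<dots> = (1 / x) ^ r" using x0 by (simp add: exp_of_nat_mult exp_minus field_simps)
        also have "\<dots> \<le> z ^ r"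
        proof (rule power_mono)
          show "1 / x \<le> z" using x x0 L1 by (simp add: z_def field_simps)
        qed (use x0 in simp)
        finally show "real (n choose r) * b r \<le> z ^ r" .
      qed
      also have "\<dots> \<le> (\<Sum>r\<in>{1..n}. z ^ r)" using z by (intro sum_mono2) (auto simp: I_def)
      also have "\<dots> \<le> 2 * z"
      proof -
        have a: "(\<Sum>r\<in>{1..n}. z ^ r) = z * (\<Sum>r<n. z ^ r)"
          by (simp add: sum_distrib_left sum.shift_bounds_cl_Suc_ivl[symmetric] lessThan_atLeast0
              atLeastLessThanSuc_atLeastAtMost[symmetric] sum.atLeast_Suc_lessThan_Suc_shift del: sum.op_ivl_Suc)
        have b: "(\<Sum>r<n. z ^ r) \<le> 2"
        proof -
          have "(\<Sum>r<n. z ^ r) = (1 - z ^ n) / (1 - z)" using z by (subst sum_gp_strict) auto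
          also have "\<dots> \<le> 1 / (1 - z)" using z by (intro divide_right_mono) auto
          also have "\<dots> \<le> 2" using z by (simp add: field_simps)
          finally show ?thesis .
        qed
        show ?thesis unfolding a using mult_left_mono[OF b z(1)] by simp
      qed
      also have "\<dots> \<le> \<epsilon>" using elim by (simp add: z_def L_def)
      finally show "measure_pmf.prob (objects_pmf {..<n} P K)
        {S. \<exists>A\<subseteq>{..<n}. 1 \<le> card A \<and> real (card A) \<le> 128 * real n / ln (real n) \<and>
          2 * card (objects_of S A) < card A * K} \<le> \<epsilon>" .
    qed
  qed
qed

text \<open>From \<open>n powr 0.9\<close> on, \<open>ln (n / r) \<le> ln n / 10\<close>, so
  choosing \<open>A\<close> costs little per node. The misses gain about \<open>r ln n / 4\<close>:
  one factor \<open>1/2\<close> is lost because only half of the objects are guaranteed, the other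
  because only \<open>m \<ge> n / 2\<close> is used. No overlap is exploited here.\<close>

lemma many_objects_small_nbh_union_bound:
  fixes c C0 \<epsilon> :: real
  assumes eps: "\<epsilon> > 0"
  shows "\<forall>\<^sub>F n in sequentially. \<forall>P K. admissible c n P K \<and> ln (real n) - C0 \<le> real n * ((real K)\<^sup>2 / real P) \<longrightarrow>
    measure_pmf.prob (objects_pmf {..<n} P K)
      {S. \<exists>A\<subseteq>{..<n}. real n powr 0.9 \<le> real (card A) \<and> real (card A) \<le> 128 * real n / ln (real n) \<and>
          card A * K \<le> 2 * card (objects_of S A) \<and> card (nbh n S A) \<le> q} \<le> \<epsilon>"
proof -
  \<comment> \<open>Here \<open>3/20 = 1/4 - 1/10\<close> is the gain from the misses minus the cost
    of choosing \<open>A\<close>; constants are absorbed by keeping only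
    \<open>1/10\<close>.\<close>
  have e1: "\<forall>\<^sub>F n in sequentially. 1 + C0 / 4 - 3/20 * ln (real n) \<le> -1/10 * ln (real n)" by real_asymp
  have e2: "\<forall>\<^sub>F n in sequentially. 128 * real n / ln (real n) + real q \<le> real n / 2" by real_asymp
  have e3: "\<forall>\<^sub>F n in sequentially. real n * (1 + real n) ^ q * exp (- (1/10) * real n powr 0.9 * ln (real n)) \<le> \<epsilon>"
    using eps by real_asymp
  have e4: "\<forall>\<^sub>F n in sequentially. ln (real n) \<ge> 1" by real_asymp
  have e5: "\<forall>\<^sub>F n in sequentially. ln (real n) - C0 \<ge> 0" by real_asymp
  show ?thesis
    using e1 e2 e3 e4 e5
  proof eventually_elim
    case (elim n)
    show ?case
    proof (intro allI impI)
      fix P K assume as: "admissible c n P K \<and> ln (real n) - C0 \<le> real n * ((real K)\<^sup>2 / real P)"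
      define L where "L = ln (real n)"
      define \<theta> where "\<theta> = (real K)\<^sup>2 / real P"
      have KP: "1 \<le> K" "K \<le> P" and lam: "L - C0 \<le> real n * \<theta>"
        using as by (auto simp: admissible_def L_def \<theta>_def)
      have L1: "L \<ge> 1" using elim by (simp add: L_def)
      have n0: "real n > 0" using L1 by (cases "n = 0") (auto simp: L_def)
      have n1: "n \<ge> 1" using n0 by simp
      have th0: "\<theta> \<ge> 0" by (simp add: \<theta>_def)
      define I where "I = {r \<in> {1..n}. real n powr 0.9 \<le> real r \<and> real r \<le> 128 * real n / L}"
      define b where "b = (\<lambda>r. (1 + real n) ^ q * exp (- (real r * (L - C0) / 4)))"
      have "measure_pmf.prob (objects_pmf {..<n} P K)
        {S. \<exists>A\<subseteq>{..<n}. real n powr 0.9 \<le> real (card A) \<and> real (card A) \<le> 128 * real n / ln (real n) \<and>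
          card A * K \<le> 2 * card (objects_of S A) \<and> card (nbh n S A) \<le> q} \<le> (\<Sum>r\<in>I. real (n choose r) * b r)"
      proof (rule union_bound_subsets[where X = "\<lambda>A. {S. card A * K \<le> 2 * card (objects_of S A) \<and> card (nbh n S A) \<le> q}"])
        show "finite I" by (simp add: I_def)
      next
        fix S assume "S \<in> {S. \<exists>A\<subseteq>{..<n}. real n powr 0.9 \<le> real (card A) \<and> real (card A) \<le> 128 * real n / ln (real n) \<and>
          card A * K \<le> 2 * card (objects_of S A) \<and> card (nbh n S A) \<le> q}"
        then obtain A where A: "A \<subseteq> {..<n}" "real n powr 0.9 \<le> real (card A)" "real (card A) \<le> 128 * real n / L"
          "card A * K \<le> 2 * card (objects_of S A) \<and> card (nbh n S A) \<le> q" unfolding L_def by blast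
        have "card A \<le> n" using card_mono[OF _ A(1)] by simp
        moreover have "0 < real n powr 0.9" using n0 by simp
        then have "real (card A) > 0" using A(2) by linarith
        ultimately have "card A \<in> I" using A by (auto simp: I_def)
        then show "\<exists>A\<subseteq>{..<n}. card A \<in> I \<and> S \<in> {S. card A * K \<le> 2 * card (objects_of S A) \<and> card (nbh n S A) \<le> q}"
          using A by blast
      next
        fix A assume A: "A \<subseteq> {..<n}" "card A \<in> I"
        define r where "r = card A"
        have r: "1 \<le> r" "real r \<le> 128 * real n / L" using A by (auto simp: I_def r_def)
        define m where "m = n - card A - q"
        have rq: "real r + real q \<le> real n / 2" using elim r by (simp add: L_def)
        have m: "real m \<ge> real n / 2" using rq unfolding m_def r_def[symmetric] by linarith
        have "measure_pmf.prob (objects_pmf {..<n} P K) {S. card A * K \<le> 2 * card (objects_of S A) \<and> card (nbh n S A) \<le> q}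
           \<le> (1 + real n) ^ q * exp (- (real r * \<theta> * real m / 2))"
          unfolding r_def m_def by (rule prob_many_objects_small_nbh_le(1)[OF KP A(1) \<theta>_def])
        also have "\<dots> \<le> b r"
          unfolding b_def
        proof (intro mult_left_mono)
          have "real r * (L - C0) \<le> real r * (real n * \<theta>)" using lam by (intro mult_left_mono) auto
          moreover have "real r * \<theta> * (real n / 2) \<le> real r * \<theta> * real m"
            using m th0 by (intro mult_left_mono) auto
          moreover have "real r * \<theta> * (real n / 2) = real r * (real n * \<theta>) / 2" by simp
          ultimately show "exp (- (real r * \<theta> * real m / 2)) \<le> exp (- (real r * (L - C0) / 4))"
            unfolding exp_le_cancel_iff by linarith
        qed auto
        finally show "measure_pmf.prob (objects_pmf {..<n} P K)
            {S. card A * K \<le> 2 * card (objects_of S A) \<and> card (nbh n S A) \<le> q} \<le> b (card A)" by (simp add: r_def)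
      qed
      also have "\<dots> \<le> (\<Sum>r\<in>I. (1 + real n) ^ q * exp (- (1/10) * real n powr 0.9 * L))"
      proof (rule sum_mono)
        fix r assume "r \<in> I"
        then have r: "1 \<le> r" "real n powr 0.9 \<le> real r" by (auto simp: I_def)
        have "ln (real n / real r) \<le> ln (real n powr 0.1)"
        proof -
          have "real n = real n powr 0.1 * real n powr 0.9" using n0 by (simp add: powr_add[symmetric])
          also have "\<dots> \<le> real n powr 0.1 * real r" using r by (intro mult_left_mono) auto
          finally have "real n / real r \<le> real n powr 0.1" using r by (simp add: field_simps)
          then show ?thesis using n0 r by (intro ln_mono) auto
        qed
        also have "\<dots> = L / 10" using n0 by (simp add: ln_powr L_def)
        finally have lnx: "ln (real n / real r) \<le> L / 10" .
        have "real (n choose r) * b r \<le> exp (real r * (1 + ln (real n / real r))) * b r"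
          using r n1 by (intro mult_right_mono choose_le_exp) (auto simp: b_def)
        also have "\<dots> = (1 + real n) ^ q * exp (real r * (1 + ln (real n / real r) - (L - C0) / 4))"
        proof -
          have "real r * (1 + ln (real n / real r) - (L - C0) / 4)
            = real r * (1 + ln (real n / real r)) + - (real r * (L - C0) / 4)" by (simp add: algebra_simps)
          then show ?thesis unfolding b_def by (simp only: exp_add mult_ac)
        qed
        also have "\<dots> \<le> (1 + real n) ^ q * exp (- (1/10) * real n powr 0.9 * L)"
        proof (intro mult_left_mono)
          have "1 + ln (real n / real r) - (L - C0) / 4 \<le> - (1/10) * L"
            using lnx elim(1)[folded L_def] by (simp add: field_simps)
          then have "real r * (1 + ln (real n / real r) - (L - C0) / 4) \<le> real r * (- (1/10) * L)"
            by (intro mult_left_mono) auto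
          also have "\<dots> = - ((1/10 * L) * real r)" by simp
          also have "\<dots> \<le> - ((1/10 * L) * real n powr 0.9)"
            using L1 r mult_left_mono[OF r(2), of "1/10 * L"] by linarith
          also have "\<dots> = - (1/10) * real n powr 0.9 * L" by simp
          finally show "exp (real r * (1 + ln (real n / real r) - (L - C0) / 4)) \<le> exp (- (1/10) * real n powr 0.9 * L)"
            by simp
        qed auto
        finally show "real (n choose r) * b r \<le> (1 + real n) ^ q * exp (- (1/10) * real n powr 0.9 * L)" .
      qed
      also have "\<dots> = real (card I) * ((1 + real n) ^ q * exp (- (1/10) * real n powr 0.9 * L))" by simp
      also have "\<dots> \<le> real n * ((1 + real n) ^ q * exp (- (1/10) * real n powr 0.9 * L))"
      proof (rule mult_right_mono)
        have "card I \<le> card {1..n}" by (intro card_mono) (auto simp: I_def)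
        then show "real (card I) \<le> real n" by simp
      qed simp
      also have "\<dots> \<le> \<epsilon>" using elim by (simp add: L_def mult_ac)
      finally show "measure_pmf.prob (objects_pmf {..<n} P K)
        {S. \<exists>A\<subseteq>{..<n}. real n powr 0.9 \<le> real (card A) \<and> real (card A) \<le> 128 * real n / ln (real n) \<and>
          card A * K \<le> 2 * card (objects_of S A) \<and> card (nbh n S A) \<le> q} \<le> \<epsilon>" .
    qed
  qed
qed

text \<open>Sets of this single size represent all larger ones, at the price of allowing about
  \<open>n / 2\<close> neighbours. The constant \<open>128\<close> is chosen for this:
  \<open>r \<ge> 64 n / ln n\<close>, \<open>n \<theta> \<ge> ln n / 2\<close> and
  \<open>m \<ge> n / 4\<close> give the exponent \<open>- 4 n\<close>, which beats the two factors
  \<open>2 ^ n\<close> for the choice of \<open>A\<close> and of the exceptions.\<close>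

lemma medium_set_large_nbh_union_bound:
  fixes c C0 \<epsilon> :: real
  assumes eps: "\<epsilon> > 0"
  shows "\<forall>\<^sub>F n in sequentially. \<forall>P K. admissible c n P K \<and> ln (real n) - C0 \<le> real n * ((real K)\<^sup>2 / real P) \<longrightarrow>
    measure_pmf.prob (objects_pmf {..<n} P K)
      {S. \<exists>A\<subseteq>{..<n}. card A = nat \<lfloor>128 * real n / ln (real n)\<rfloor> \<and>
          card A * K \<le> 2 * card (objects_of S A) \<and> card (nbh n S A) \<le> n div 2 + q} \<le> \<epsilon>"
proof -
  have e1: "\<forall>\<^sub>F n in sequentially. 128 * real n / ln (real n) + real n / 2 + real q \<le> 3/4 * real n" by real_asymp
  have e2: "\<forall>\<^sub>F n in sequentially. 128 * real n / ln (real n) - 1 \<ge> 64 * real n / ln (real n)" by real_asymp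
  have e3: "\<forall>\<^sub>F n in sequentially. exp (- 2 * real n) \<le> \<epsilon>" using eps by real_asymp
  have e4: "\<forall>\<^sub>F n in sequentially. ln (real n) \<ge> 1" by real_asymp
  have e5: "\<forall>\<^sub>F n in sequentially. ln (real n) - C0 \<ge> ln (real n) / 2" by real_asymp
  show ?thesis
    using e1 e2 e3 e4 e5
  proof eventually_elim
    case (elim n)
    show ?case
    proof (intro allI impI)
      fix P K assume as: "admissible c n P K \<and> ln (real n) - C0 \<le> real n * ((real K)\<^sup>2 / real P)"
      define L where "L = ln (real n)"
      define \<theta> where "\<theta> = (real K)\<^sup>2 / real P"
      have KP: "1 \<le> K" "K \<le> P" and lam0: "L - C0 \<le> real n * \<theta>"
        using as by (auto simp: admissible_def L_def \<theta>_def)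
      have lam: "L / 2 \<le> real n * \<theta>" using lam0 elim(5) unfolding L_def by linarith
      have L1: "L \<ge> 1" using elim by (simp add: L_def)
      have n0: "real n > 0" using L1 by (cases "n = 0") (auto simp: L_def)
      have th0: "\<theta> \<ge> 0" by (simp add: \<theta>_def)
      define r where "r = nat \<lfloor>128 * real n / L\<rfloor>"
      have r: "real r \<le> 128 * real n / L" "64 * real n / L \<le> real r"
        using L1 n0 elim(2) unfolding r_def L_def[symmetric] by linarith+
      have "measure_pmf.prob (objects_pmf {..<n} P K)
        {S. \<exists>A\<subseteq>{..<n}. card A = nat \<lfloor>128 * real n / ln (real n)\<rfloor> \<and>
          card A * K \<le> 2 * card (objects_of S A) \<and> card (nbh n S A) \<le> n div 2 + q}
        \<le> (\<Sum>r\<in>{r}. real (n choose r) * (2 ^ n * exp (- 4 * real n)))"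
      proof (rule union_bound_subsets[where X = "\<lambda>A. {S. card A * K \<le> 2 * card (objects_of S A) \<and> card (nbh n S A) \<le> n div 2 + q}"])
        fix A assume A: "A \<subseteq> {..<n}" "card A \<in> {r}"
        define m where "m = n - card A - (n div 2 + q)"
        have "real (n div 2) \<le> real n / 2" by linarith
        then have "real r + real (n div 2 + q) \<le> 3/4 * real n" using elim(1) r by (simp add: L_def)
        then have m: "real m \<ge> real n / 4" using A unfolding m_def by simp
        have "measure_pmf.prob (objects_pmf {..<n} P K)
            {S. card A * K \<le> 2 * card (objects_of S A) \<and> card (nbh n S A) \<le> n div 2 + q}
           \<le> 2 ^ n * exp (- (real r * \<theta> * real m / 2))"
          using prob_many_objects_small_nbh_le(2)[OF KP A(1) \<theta>_def, of "n div 2 + q"] A(2) unfolding m_def by simp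
        also have "\<dots> \<le> 2 ^ n * exp (- 4 * real n)"
        proof (intro mult_left_mono)
          have "32 * real n = (64 * real n / L) * (L / 2)" using L1 by simp
          also have "\<dots> \<le> real r * (real n * \<theta>)" using r lam L1 by (intro mult_mono) auto
          finally have "8 * real n \<le> real r * \<theta> * (real n / 4)" by (simp add: mult_ac)
          also have "\<dots> \<le> real r * \<theta> * real m" using m th0 by (intro mult_left_mono) auto
          finally show "exp (- (real r * \<theta> * real m / 2)) \<le> exp (- 4 * real n)" by simp
        qed simp
        finally show "measure_pmf.prob (objects_pmf {..<n} P K)
            {S. card A * K \<le> 2 * card (objects_of S A) \<and> card (nbh n S A) \<le> n div 2 + q}
           \<le> 2 ^ n * exp (- 4 * real n)" .
      qed (auto simp: r_def L_def)
      also have "\<dots> = real (n choose r) * 2 ^ n * exp (- 4 * real n)" by simp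
      also have "\<dots> \<le> 2 ^ n * 2 ^ n * exp (- 4 * real n)"
      proof (intro mult_right_mono)
        have "n choose r \<le> 2 ^ n" by (rule binomial_le_pow2)
        then show "real (n choose r) \<le> 2 ^ n" by (metis of_nat_le_iff of_nat_numeral of_nat_power)
      qed auto
      also have "\<dots> \<le> exp (real n) * exp (real n) * exp (- 4 * real n)"
      proof (intro mult_right_mono mult_mono)
        have "(2::real) ^ n \<le> exp 1 ^ n" using exp_ge_add_one_self[of 1] by (intro power_mono) auto
        then show "2 ^ n \<le> exp (real n)" "2 ^ n \<le> exp (real n)" by (simp_all add: exp_of_nat_mult[symmetric])
      qed auto
      also have "\<dots> = exp (- 2 * real n)" by (simp add: exp_add[symmetric])
      also have "\<dots> \<le> \<epsilon>" using elim by simp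
      finally show "measure_pmf.prob (objects_pmf {..<n} P K)
        {S. \<exists>A\<subseteq>{..<n}. card A = nat \<lfloor>128 * real n / ln (real n)\<rfloor> \<and>
          card A * K \<le> 2 * card (objects_of S A) \<and> card (nbh n S A) \<le> n div 2 + q} \<le> \<epsilon>" .
    qed
  qed
qed

text \<open>A neighbour of \<open>A'\<close> outside \<open>A'\<close> either belongs to
  \<open>A\<close> or is a neighbour of \<open>A\<close>. This carries a small neighbourhood over to
  a subset of prescribed size.\<close>

lemma card_nbh_subset_le:
  assumes "A' \<subseteq> A" "A \<subseteq> {..<n}"
  shows "card (nbh n S A') \<le> (card A - card A') + card (nbh n S A)"
proof -
  have fin: "finite A" using assms finite_subset by auto
  have "nbh n S A' \<subseteq> (A - A') \<union> nbh n S A"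
    using assms by (auto simp: nbh_def objects_of_def)
  then have "card (nbh n S A') \<le> card ((A - A') \<union> nbh n S A)"
    using fin by (intro card_mono) (auto simp: nbh_def)
  also have "\<dots> \<le> card (A - A') + card (nbh n S A)" by (rule card_Un_le)
  also have "card (A - A') = card A - card A'" using assms fin by (intro card_Diff_subset) (auto intro: finite_subset)
  finally show ?thesis .
qed

theorem min_degree_imp_k_connected_asymptotically:
  fixes c C0 \<epsilon> :: real
  assumes c: "c > 0" and eps: "\<epsilon> > 0" and k: "k \<ge> 1"
  shows "\<forall>\<^sub>F n in sequentially. \<forall>P K. admissible c n P K \<and> ln (real n) - C0 \<le> real n * ((real K)\<^sup>2 / real P) \<longrightarrow>
    measure_pmf.prob (objects_pmf {..<n} P K)
      {S. (\<forall>v<n. k \<le> card (nbh n S {v})) \<and> \<not> k_connected k {..<n} (intersection_edges n S)} \<le> \<epsilon>"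
proof -
  have eps': "\<epsilon> / 4 > 0" using eps by simp
  have e1: "\<forall>\<^sub>F n in sequentially. 128 * real n / ln (real n) \<ge> 1" by real_asymp
  show ?thesis
    using overlap_small_nbh_union_bound[OF c eps', of C0 "k - 1"]
      few_objects_union_bound[OF c eps']
      many_objects_small_nbh_union_bound[OF eps', of c C0 "k - 1"]
      medium_set_large_nbh_union_bound[OF eps', of c C0 "k - 1"] e1
  proof eventually_elim
    case (elim n)
    show ?case
    proof (intro allI impI)
      fix P K assume as: "admissible c n P K \<and> ln (real n) - C0 \<le> real n * ((real K)\<^sup>2 / real P)"
      then have KP: "1 \<le> K" "K \<le> P" by (auto simp: admissible_def)
      let ?M = "objects_pmf {..<n} P K"
      let ?E1 = "{S. \<exists>A\<subseteq>{..<n}. 1 \<le> card A \<and> real (card A) \<le> real n powr 0.9 \<and>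
          card (objects_of S A) < card A * K \<and> card (nbh n S A) \<le> k - 1}"
      let ?E2 = "{S. \<exists>A\<subseteq>{..<n}. 1 \<le> card A \<and> real (card A) \<le> 128 * real n / ln (real n) \<and>
          2 * card (objects_of S A) < card A * K}"
      let ?E3 = "{S. \<exists>A\<subseteq>{..<n}. real n powr 0.9 \<le> real (card A) \<and> real (card A) \<le> 128 * real n / ln (real n) \<and>
          card A * K \<le> 2 * card (objects_of S A) \<and> card (nbh n S A) \<le> k - 1}"
      let ?E4 = "{S. \<exists>A\<subseteq>{..<n}. card A = nat \<lfloor>128 * real n / ln (real n)\<rfloor> \<and>
          card A * K \<le> 2 * card (objects_of S A) \<and> card (nbh n S A) \<le> n div 2 + (k - 1)}"
      let ?m = "nat \<lfloor>128 * real n / ln (real n)\<rfloor>"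
      have m: "1 \<le> ?m" "real ?m \<le> 128 * real n / ln (real n)" using elim(5) by linarith+
      have "measure_pmf.prob ?M
        {S. (\<forall>v<n. k \<le> card (nbh n S {v})) \<and> \<not> k_connected k {..<n} (intersection_edges n S)}
        \<le> measure_pmf.prob ?M (?E1 \<union> ?E2 \<union> ?E3 \<union> ?E4)"
      proof (rule prob_mono)
        fix S assume S: "S \<in> set_pmf ?M"
          and "S \<in> {S. (\<forall>v<n. k \<le> card (nbh n S {v})) \<and> \<not> k_connected k {..<n} (intersection_edges n S)}"
        then have deg: "\<forall>v\<in>{..<n}. k \<le> node_degree {..<n} (intersection_edges n S) v"
          and nc: "\<not> k_connected k {..<n} (intersection_edges n S)"
          by (auto simp: node_degree_intersection_edges)
        obtain A where A: "A \<subseteq> {..<n}" "2 * card A \<le> n" "card (nbh n S A) < k"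
            "\<exists>a\<in>A. \<exists>b\<in>A. a \<noteq> b \<and> S a \<inter> S b \<noteq> {}"
        proof -
          obtain A where A: "A \<subseteq> {..<n}" "2 * card A \<le> card {..<n}"
            "card (boundary {..<n} (intersection_edges n S) A) < k"
            "\<exists>a\<in>A. \<exists>b\<in>A. a \<noteq> b \<and> {a, b} \<in> intersection_edges n S"
            using not_k_connected_imp_small_boundary[OF finite_lessThan deg nc] by blast
          have "\<exists>a\<in>A. \<exists>b\<in>A. a \<noteq> b \<and> S a \<inter> S b \<noteq> {}"
            using A(4) unfolding intersection_edges_iff by blast
          then show ?thesis using that[of A] A by (simp add: boundary_intersection_edges)
        qed
        have fA: "finite A" using A finite_subset by auto
        have overlap: "card (objects_of S A) < card A * K"
          using objects_of_overlap[OF KP(2) fA S A(1)] A(4) by auto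
        have q: "card (nbh n S A) \<le> k - 1" using A(3) by simp
        have c1: "1 \<le> card A" using A(4) fA by (auto simp: Suc_le_eq card_gt_0_iff)
        consider "real (card A) \<le> real n powr 0.9"
          | "real n powr 0.9 \<le> real (card A)" "real (card A) \<le> 128 * real n / ln (real n)"
          | "128 * real n / ln (real n) \<le> real (card A)" by linarith
        then show "S \<in> ?E1 \<union> ?E2 \<union> ?E3 \<union> ?E4"
        proof cases
          case 1
          then have "S \<in> ?E1" using A(1) c1 overlap q by blast
          then show ?thesis by blast
        next
          case 2
          show ?thesis
          proof (cases "2 * card (objects_of S A) < card A * K")
            case True
            then have "S \<in> ?E2" using A(1) c1 2 by blast
            then show ?thesis by blast
          next
            case False
            then have "S \<in> ?E3" using A(1) 2 q by (auto simp: not_less)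
            then show ?thesis by blast
          qed
        next
          case 3
          \<comment> \<open>A set beyond the medium range is represented by a subset
            \<open>A'\<close> of threshold size. As \<open>A\<close> has at most half of the nodes
            and fewer than \<open>k\<close> outer neighbours, \<open>A'\<close> has at most
            \<open>n div 2 + (k - 1)\<close>.\<close>
          then have "?m \<le> card A" using m by linarith
          then obtain A' where A': "A' \<subseteq> A" "card A' = ?m" by (meson obtain_subset_with_card_n)
          have A'n: "A' \<subseteq> {..<n}" using A' A by auto
          have "card (nbh n S A') \<le> n div 2 + (k - 1)"
            using card_nbh_subset_le[OF A'(1) A(1), of S] q A(2) by linarith
          show ?thesis
          proof (cases "2 * card (objects_of S A') < card A' * K")
            case True
            then have "S \<in> ?E2" using A'n A' m by auto
            then show ?thesis by blast
          next
            case False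
            then have "S \<in> ?E4" using A'n A' \<open>card (nbh n S A') \<le> n div 2 + (k - 1)\<close> by (auto simp: not_less)
            then show ?thesis by blast
          qed
        qed
      qed
      also have "\<dots> \<le> measure_pmf.prob ?M ?E1 + measure_pmf.prob ?M ?E2
          + measure_pmf.prob ?M ?E3 + measure_pmf.prob ?M ?E4"
        by (intro order_trans[OF measure_Un_le] add_mono order_refl) auto
      also have "\<dots> \<le> \<epsilon> / 4 + \<epsilon> / 4 + \<epsilon> / 4 + \<epsilon> / 4"
        by (intro add_mono) (use elim as in blast)+
      finally show "measure_pmf.prob ?M
        {S. (\<forall>v<n. k \<le> card (nbh n S {v})) \<and> \<not> k_connected k {..<n} (intersection_edges n S)} \<le> \<epsilon>" by simp
    qed
  qed
qed

section \<open>Joint degree distribution of finitely many nodes\<close>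

text \<open>These are the possible assignments of neighbourhoods when every outer node sees at most
  one node of \<open>A\<close>. Using \<open>PiE\<close>, with a default outside \<open>A\<close>,
  makes each assignment a unique function, so that assignments can be counted.\<close>

definition single_hits :: "nat set \<Rightarrow> nat set \<Rightarrow> nat \<Rightarrow> (nat \<Rightarrow> nat set) set" where
  "single_hits A B d = {W \<in> PiE A (\<lambda>_. {X. X \<subseteq> B \<and> card X = d}). disjoint_family_on W A}"

lemma finite_single_hits: "finite A \<Longrightarrow> finite B \<Longrightarrow> finite (single_hits A B d)"
  unfolding single_hits_def by (rule finite_subset[of _ "PiE A (\<lambda>_. {X. X \<subseteq> B \<and> card X = d})"])
    (auto intro!: finite_PiE)

lemma card_single_hits_le:
  assumes "finite A" "finite B"
  shows "card (single_hits A B d) \<le> (card B choose d) ^ card A"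
proof -
  have "card (single_hits A B d) \<le> card (PiE A (\<lambda>_. {X. X \<subseteq> B \<and> card X = d}))"
    unfolding single_hits_def using assms by (intro card_mono finite_PiE) auto
  also have "\<dots> = (card B choose d) ^ card A"
    using assms by (simp add: card_PiE n_subsets)
  finally show ?thesis .
qed

lemma card_Union_single_hits:
  assumes "W \<in> single_hits A B d" "finite A" "finite B"
  shows "card (\<Union>v\<in>A. W v) = card A * d"
proof -
  have "card (\<Union>v\<in>A. W v) = (\<Sum>v\<in>A. card (W v))"
    using assms
    by (intro card_UN_disjoint) (auto simp: single_hits_def disjoint_family_on_def PiE_iff intro: finite_subset)
  also have "\<dots> = card A * d" using assms by (simp add: single_hits_def PiE_iff)
  finally show ?thesis .
qed

text \<open>The sets are chosen for one node after another, and each has to avoid at most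
  \<open>j * d\<close> nodes already taken. The bound \<open>j\<close> is separate from
  \<open>card A\<close> so that the base stays the same throughout the induction.\<close>

lemma card_single_hits_ge:
  assumes "finite A" "finite B" "card A \<le> j"
  shows "((card B - j * d) choose d) ^ card A \<le> card (single_hits A B d)"
  using assms
proof (induction A rule: finite_induct)
  case empty
  then show ?case by (simp add: single_hits_def disjoint_family_on_def)
next
  case (insert a A)
  let ?M = "(card B - j * d) choose d"
  let ?T = "SIGMA W : single_hits A B d. {X. X \<subseteq> B - (\<Union>v\<in>A. W v) \<and> card X = d}"
  have fS: "finite (single_hits A B d)" using insert by (intro finite_single_hits) auto
  have "?M ^ card (insert a A) = ?M ^ card A * ?M" using insert.hyps by simp
  also have "\<dots> \<le> card (single_hits A B d) * ?M" using insert by (intro mult_right_mono) auto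
  also have "\<dots> = (\<Sum>W\<in>single_hits A B d. ?M)" by simp
  also have "\<dots> \<le> (\<Sum>W\<in>single_hits A B d. card {X. X \<subseteq> B - (\<Union>v\<in>A. W v) \<and> card X = d})"
  proof (rule sum_mono)
    fix W assume W: "W \<in> single_hits A B d"
    have sub: "(\<Union>v\<in>A. W v) \<subseteq> B" using W by (auto simp: single_hits_def PiE_iff)
    have "card (B - (\<Union>v\<in>A. W v)) = card B - card A * d"
      using card_Union_single_hits[OF W insert.hyps(1) insert.prems(1)] sub insert.prems(1)
      by (simp add: card_Diff_subset finite_subset)
    moreover have "card A * d \<le> j * d" using insert by (intro mult_right_mono) auto
    ultimately have "card B - j * d \<le> card (B - (\<Union>v\<in>A. W v))" by (metis diff_le_mono2)
    then show "?M \<le> card {X. X \<subseteq> B - (\<Union>v\<in>A. W v) \<and> card X = d}"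
      using n_subsets[of "B - (\<Union>v\<in>A. W v)" d] insert.prems(1) by (simp add: binomial_right_mono)
  qed
  also have "\<dots> = card ?T" using fS insert.prems(1) by (subst card_SigmaI) auto
  also have "\<dots> \<le> card (single_hits (insert a A) B d)"
  proof (rule card_inj_on_le[where f = "\<lambda>(W, X). W(a := X)"])
    show "inj_on (\<lambda>(W, X). W(a := X)) ?T"
    proof (rule inj_onI)
      fix p q assume pq: "p \<in> ?T" "q \<in> ?T" and e: "(\<lambda>(W, X). W(a := X)) p = (\<lambda>(W, X). W(a := X)) q"
      obtain W X W' X' where wx: "p = (W, X)" "q = (W', X')" by (cases p, cases q) auto
      have W: "W \<in> single_hits A B d" "W' \<in> single_hits A B d" and eq: "W(a := X) = W'(a := X')"
        using pq e wx by auto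
      have "W a = undefined" "W' a = undefined"
        using W insert.hyps(2) by (auto simp: single_hits_def PiE_iff extensional_def)
      moreover have "W x = W' x" if "x \<noteq> a" for x using fun_cong[OF eq, of x] that by simp
      ultimately have "W = W'" by (intro ext) metis
      moreover have "X = X'" using fun_cong[OF eq, of a] by simp
      ultimately show "p = q" using wx by simp
    qed
    show "(\<lambda>(W, X). W(a := X)) ` ?T \<subseteq> single_hits (insert a A) B d"
    proof
      fix V assume "V \<in> (\<lambda>(W, X). W(a := X)) ` ?T"
      then obtain W X where V: "V = W(a := X)" and W: "W \<in> single_hits A B d"
        and X: "X \<subseteq> B - (\<Union>v\<in>A. W v)" "d = card X" by auto
      have "W(a := X) \<in> PiE (insert a A) (\<lambda>_. {X'. X' \<subseteq> B \<and> card X' = card X})"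
        using W X by (auto simp: single_hits_def PiE_iff extensional_def)
      moreover have "disjoint_family_on (W(a := X)) (insert a A)"
        using W X insert.hyps(2) unfolding single_hits_def disjoint_family_on_def
        by (auto simp: disjoint_iff)
      ultimately show "V \<in> single_hits (insert a A) B d" using V X by (simp add: single_hits_def)
    qed
    show "finite (single_hits (insert a A) B d)" using insert by (intro finite_single_hits) auto
  qed
  finally show ?case .
qed

lemma objects_disjoint:
  assumes "K \<le> P" "finite A" "S \<in> set_pmf (objects_pmf A' P K)" "A \<subseteq> A'" "finite A'"
    and "card (objects_of S A) = card A * K" "a \<in> A" "b \<in> A" "a \<noteq> b"
  shows "S a \<inter> S b = {}"
  using objects_of_overlap[OF assms(1-5,7-9)] assms(6) by auto

text \<open>The cardinality condition says that \<open>A\<close> spans no edge.\<close>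

definition hit_pattern :: "nat \<Rightarrow> nat \<Rightarrow> nat set \<Rightarrow> (nat \<Rightarrow> nat set) \<Rightarrow> (nat \<Rightarrow> nat set) set" where
  "hit_pattern n K A W = {S. card (objects_of S A) = card A * K \<and>
     (\<forall>w\<in>{..<n} - A. \<forall>v\<in>A. S w \<inter> S v \<noteq> {} \<longleftrightarrow> w \<in> W v)}"

text \<open>Without an overlap no neighbour of \<open>v\<close> lies in \<open>A\<close>, so the
  pattern prescribes the whole neighbourhood. Hence patterns for different assignments exclude each
  other, and each determines the degrees on \<open>A\<close>.\<close>

lemma hit_pattern_nbh:
  assumes "K \<le> P" "A \<subseteq> {..<n}" "S \<in> set_pmf (objects_pmf {..<n} P K)" "S \<in> hit_pattern n K A W"
    "v \<in> A" "W v \<subseteq> {..<n} - A"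
  shows "nbh n S {v} = W v"
proof -
  have fin: "finite A" using assms finite_subset by auto
  have c: "card (objects_of S A) = card A * K" using assms by (simp add: hit_pattern_def)
  have "S w \<inter> S v = {}" if "w \<in> A" "w \<noteq> v" for w
    using objects_disjoint[OF assms(1) fin assms(3,2) _ c that(1) assms(5) that(2)] by simp
  moreover have "S w \<inter> S v \<noteq> {} \<longleftrightarrow> w \<in> W v" if "w \<in> {..<n} - A" for w
    using assms(4,5) that unfolding hit_pattern_def by blast
  ultimately have "w < n \<and> w \<noteq> v \<and> S w \<inter> S v \<noteq> {} \<longleftrightarrow> w \<in> W v" for w
    using assms(5,6) by (cases "w \<in> A") (blast, metis DiffI DiffD1 lessThan_iff subsetD)
  then show ?thesis by (auto simp: nbh_def objects_of_def)
qed

lemma prob_hit_pattern: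
  assumes "K \<le> P" "A \<subseteq> {..<n}"
  shows "measure_pmf.prob (objects_pmf {..<n} P K) (hit_pattern n K A W) =
    expect (objects_pmf A P K) (\<lambda>f. of_bool (card (objects_of f A) = card A * K) *
      (\<Prod>w\<in>{..<n} - A. measure_pmf.prob (object_pmf P K) {T. \<forall>v\<in>A. T \<inter> f v \<noteq> {} \<longleftrightarrow> w \<in> W v}))"
proof -
  have "measure_pmf.prob (objects_pmf ({..<n} - A) P K)
      {g. (\<lambda>x. if x \<in> A then f x else g x) \<in> hit_pattern n K A W}
    = of_bool (card (objects_of f A) = card A * K) *
      (\<Prod>w\<in>{..<n} - A. measure_pmf.prob (object_pmf P K) {T. \<forall>v\<in>A. T \<inter> f v \<noteq> {} \<longleftrightarrow> w \<in> W v})" for f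
  proof (cases "card (objects_of f A) = card A * K")
    case True
    then have "{g. (\<lambda>x. if x \<in> A then f x else g x) \<in> hit_pattern n K A W}
        = Pi ({..<n} - A) (\<lambda>w. {T. \<forall>v\<in>A. T \<inter> f v \<noteq> {} \<longleftrightarrow> w \<in> W v})"
      by (auto simp: hit_pattern_def objects_of_merge Pi_iff)
    then show ?thesis using True by (simp add: measure_Pi_pmf_Pi)
  next
    case False
    then have "{g. (\<lambda>x. if x \<in> A then f x else g x) \<in> hit_pattern n K A W} = {}"
      by (auto simp: hit_pattern_def objects_of_merge)
    then show ?thesis using False by simp
  qed
  then show ?thesis unfolding prob_objects_pmf_split[OF assms] by simp
qed

text \<open>The \<open>card A * d\<close> prescribed neighbours contribute about \<theta> each; all
  other outer nodes miss all \<open>card A * K\<close> objects. The lower bound discards the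
  probability of hitting two object sets, at most \<open>card A\<close> times the square of
  \<theta>, and loses another such square in \<open>exp (- \<theta>)\<close>, hence the factor
  \<open>1 - (card A + 1) * \<theta>\<close>.\<close>

lemma hit_pattern_product_bounds:
  fixes \<theta> :: real
  assumes KP: "1 \<le> K" "K \<le> P" and A: "A \<subseteq> {..<n}" and f: "f \<in> set_pmf (objects_pmf A P K)"
    and c: "card (objects_of f A) = card A * K" and W: "W \<in> single_hits A ({..<n} - A) d"
    and th: "\<theta> = (real K)\<^sup>2 / real P"
  shows "(\<Prod>w\<in>{..<n} - A. measure_pmf.prob (object_pmf P K) {T. \<forall>v\<in>A. T \<inter> f v \<noteq> {} \<longleftrightarrow> w \<in> W v})
      \<le> \<theta> ^ (card A * d) * exp (- (real (card A) * \<theta>)) ^ (n - card A - card A * d)" (is "?upper")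
    and "\<lbrakk>real (card A + 1) * \<theta> \<le> 1; K + card A * K \<le> P\<rbrakk> \<Longrightarrow>
      (\<theta> * (1 - real (card A + 1) * \<theta>)) ^ (card A * d)
        * ((1 - real K / real (P - card A * K)) ^ (card A * K)) ^ (n - card A - card A * d)
      \<le> (\<Prod>w\<in>{..<n} - A. measure_pmf.prob (object_pmf P K) {T. \<forall>v\<in>A. T \<inter> f v \<noteq> {} \<longleftrightarrow> w \<in> W v})" (is "_ \<Longrightarrow> _ \<Longrightarrow> ?lower")
proof -
  have fin: "finite A" using A finite_subset by auto
  let ?Q = "object_pmf P K"
  let ?B = "{..<n} - A"
  let ?cell = "\<lambda>w. {T. \<forall>v\<in>A. T \<inter> f v \<noteq> {} \<longleftrightarrow> w \<in> W v}"
  define Z where "Z = (\<Union>v\<in>A. W v)"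
  have ZB: "Z \<subseteq> ?B" using W by (auto simp: Z_def single_hits_def PiE_iff)
  have cZ: "card Z = card A * d" unfolding Z_def using card_Union_single_hits[OF W fin] by simp
  have fZ: "finite Z" using ZB finite_subset by auto
  have cBZ: "card (?B \<inter> - Z) = n - card A - card A * d"
  proof -
    have "?B \<inter> - Z = ?B - Z" by auto
    then show ?thesis using ZB fZ cZ A fin by (simp add: card_Diff_subset)
  qed
  have BZ: "?B \<inter> Z = Z" using ZB by auto
  have split: "(\<Prod>w\<in>?B. if w \<in> Z then x else y) = x ^ (card A * d) * y ^ (n - card A - card A * d)" for x y :: real
    using cZ cBZ by (simp add: prod.If_cases BZ)
  have comp: "card (f v) = K" "finite (f v)" if "v \<in> A" for v
    using objects_pmf_component[OF KP(2) fin f that] by auto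
  have disj: "f a \<inter> f b = {}" if "a \<in> A" "b \<in> A" "a \<noteq> b" for a b
    by (rule objects_disjoint[OF KP(2) fin f subset_refl fin c that])
  note U = objects_of_bounds[OF KP(2) fin f]
  have cell_out: "?cell w = {T. T \<inter> objects_of f A = {}}" if "w \<notin> Z" for w
    using that by (auto simp: Z_def objects_of_def)
  have hit: "real K * (real K / real P) = \<theta>" by (simp add: th power2_eq_square)
  show ?upper
  proof -
    have "(\<Prod>w\<in>?B. measure_pmf.prob ?Q (?cell w)) \<le> (\<Prod>w\<in>?B. if w \<in> Z then \<theta> else exp (- (real (card A) * \<theta>)))"
    proof (rule prod_mono, rule conjI)
      fix w assume w: "w \<in> ?B"
      show "measure_pmf.prob ?Q (?cell w) \<le> (if w \<in> Z then \<theta> else exp (- (real (card A) * \<theta>)))"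
      proof (cases "w \<in> Z")
        case True
        then obtain v where v: "v \<in> A" "w \<in> W v" by (auto simp: Z_def)
        have "measure_pmf.prob ?Q (?cell w) \<le> measure_pmf.prob ?Q {T. T \<inter> f v \<noteq> {}}"
          using v by (intro prob_mono) auto
        also have "\<dots> \<le> real (card (f v)) * (real K / real P)" by (rule prob_hit_le[OF KP comp(2)[OF v(1)]])
        finally show ?thesis using True comp(1)[OF v(1)] hit by simp
      next
        case False
        have "measure_pmf.prob ?Q (?cell w) \<le> exp (- (real (card A * K) * real K / real P))"
          unfolding cell_out[OF False] using prob_miss_le[OF KP U(1)] c by simp
        also have "real (card A * K) * real K / real P = real (card A) * \<theta>" by (simp add: th power2_eq_square)
        finally show ?thesis using False by simp
      qed
    qed simp
    then show ?thesis unfolding split .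
  qed
  assume s1: "real (card A + 1) * \<theta> \<le> 1" and s2: "K + card A * K \<le> P"
  show ?lower
  proof -
    have th0: "\<theta> \<ge> 0" by (simp add: th)
    have "real K \<le> real (P - card A * K)" using s2 by (intro of_nat_mono) simp
    then have "real K / real (P - card A * K) \<le> real (P - card A * K) / real (P - card A * K)"
      by (rule divide_right_mono) simp
    also have "\<dots> \<le> 1" by simp
    finally have mu0: "0 \<le> 1 - real K / real (P - card A * K)" by simp
    have "(\<Prod>w\<in>?B. if w \<in> Z then \<theta> * (1 - real (card A + 1) * \<theta>) else (1 - real K / real (P - card A * K)) ^ (card A * K))
        \<le> (\<Prod>w\<in>?B. measure_pmf.prob ?Q (?cell w))"
    proof (rule prod_mono, rule conjI)
      fix w assume w: "w \<in> ?B"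
      show "0 \<le> (if w \<in> Z then \<theta> * (1 - real (card A + 1) * \<theta>) else (1 - real K / real (P - card A * K)) ^ (card A * K))"
        using th0 s1 mu0 by simp
      show "(if w \<in> Z then \<theta> * (1 - real (card A + 1) * \<theta>) else (1 - real K / real (P - card A * K)) ^ (card A * K))
         \<le> measure_pmf.prob ?Q (?cell w)"
      proof (cases "w \<in> Z")
        case True
        then obtain v where v: "v \<in> A" "w \<in> W v" by (auto simp: Z_def)
        have only: "w \<notin> W b" if "b \<in> A" "b \<noteq> v" for b
          using W v that unfolding single_hits_def disjoint_family_on_def by blast
        have fv: "f v \<subseteq> {..<P}" using objects_pmf_component[OF KP(2) fin f v(1)] by auto
        let ?D = "\<lambda>b. {T. T \<inter> f v \<noteq> {} \<and> T \<inter> f b \<noteq> {}}"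
        \<comment> \<open>A set \<open>T\<close> misses \<open>f v\<close>, or follows the pattern,
          or hits \<open>f v\<close> and a second set; bounding the other two cases leaves a lower
          bound for the pattern.\<close>
        have "1 = measure_pmf.prob ?Q UNIV" by simp
        also have "\<dots> \<le> measure_pmf.prob ?Q ({T. T \<inter> f v = {}} \<union> (?cell w \<union> (\<Union>b\<in>A - {v}. ?D b)))"
          by (rule prob_mono) (use v only in auto)
        also have "\<dots> \<le> measure_pmf.prob ?Q {T. T \<inter> f v = {}} + (measure_pmf.prob ?Q (?cell w) + measure_pmf.prob ?Q (\<Union>b\<in>A - {v}. ?D b))"
          by (intro order_trans[OF measure_Un_le] add_mono order_refl) auto
        also have "measure_pmf.prob ?Q (\<Union>b\<in>A - {v}. ?D b) \<le> (\<Sum>b\<in>A - {v}. measure_pmf.prob ?Q (?D b))"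
          by (rule measure_pmf.finite_measure_subadditive_finite) (use fin in auto)
        also have "\<dots> \<le> (\<Sum>b\<in>A - {v}. \<theta>\<^sup>2)"
        proof (rule sum_mono)
          fix b assume b: "b \<in> A - {v}"
          then have "measure_pmf.prob ?Q (?D b) \<le> real (card (f v)) * real (card (f b)) * (real K / real P)\<^sup>2"
            using v comp disj by (intro prob_hit_both_le[OF KP]) auto
          also have "\<dots> = \<theta>\<^sup>2" using b v comp by (simp add: th power2_eq_square)
          finally show "measure_pmf.prob ?Q (?D b) \<le> \<theta>\<^sup>2" .
        qed
        also have "\<dots> \<le> real (card A) * \<theta>\<^sup>2" using fin by (simp add: mult_right_mono card_mono)
        also have "measure_pmf.prob ?Q {T. T \<inter> f v = {}} \<le> exp (- \<theta>)"
          using prob_miss_le[OF KP fv] comp[OF v(1)] by (simp add: th power2_eq_square)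
        also have "exp (- \<theta>) \<le> 1 - \<theta> + \<theta>\<^sup>2"
        proof -
          have "\<theta> \<le> 1" using s1 th0 mult_right_mono[of 1 "real (card A + 1)" \<theta>] by simp
          then have "(1 + \<theta>) * (1 - \<theta> + \<theta>\<^sup>2) = 1 + \<theta> ^ 3" by (simp add: algebra_simps power2_eq_square power3_eq_cube)
          then have "1 \<le> (1 + \<theta>) * (1 - \<theta> + \<theta>\<^sup>2)" using th0 by simp
          also have "\<dots> \<le> exp \<theta> * (1 - \<theta> + \<theta>\<^sup>2)"
            using exp_ge_add_one_self[of \<theta>] \<open>\<theta> \<le> 1\<close> by (intro mult_right_mono) auto
          finally show ?thesis by (simp add: exp_minus field_simps)
        qed
        finally have "1 \<le> 1 - \<theta> + \<theta>\<^sup>2 + (measure_pmf.prob ?Q (?cell w) + real (card A) * \<theta>\<^sup>2)" by simp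
        then show ?thesis using True by (simp add: algebra_simps power2_eq_square)
      next
        case False
        have "(1 - real K / real (P - card (objects_of f A))) ^ card (objects_of f A)
            \<le> measure_pmf.prob ?Q {T. T \<inter> objects_of f A = {}}"
          by (rule prob_miss_ge[OF KP(1) _ U(1)]) (use s2 c in simp)
        then show ?thesis using False unfolding cell_out[OF False] c by simp
      qed
    qed
    then show ?thesis unfolding split .
  qed
qed

text \<open>The moment generating function at \<open>t = 2\<close> suffices: \<open>2 ^ D\<close> is
  at least \<open>2\<close> for a positive defect \<open>D\<close> and equals \<open>1\<close> for
  \<open>D = 0\<close>.\<close>

lemma prob_no_overlap_ge:
  fixes \<theta> :: real
  assumes KP: "1 \<le> K" "K \<le> P" and fin: "finite A" and th: "\<theta> = (real K)\<^sup>2 / real P"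
  shows "2 - exp (\<theta> * (real (card A))\<^sup>2) \<le> expect (objects_pmf A P K) (\<lambda>f. of_bool (card (objects_of f A) = card A * K))"
proof -
  let ?M = "objects_pmf A P K"
  have fM: "finite (set_pmf ?M)" using finite_set_objects_pmf KP fin by blast
  have "expect ?M (\<lambda>f. 2 - of_bool (card (objects_of f A) = card A * K)) \<le> expect ?M (\<lambda>f. 2 ^ (card A * K - card (objects_of f A)))"
  proof (rule expect_mono[OF fM])
    fix f assume f: "f \<in> set_pmf ?M"
    note b = objects_of_bounds[OF KP(2) fin f]
    show "2 - of_bool (card (objects_of f A) = card A * K) \<le> (2::real) ^ (card A * K - card (objects_of f A))"
    proof (cases "card (objects_of f A) = card A * K")
      case False
      then have "1 \<le> card A * K - card (objects_of f A)" using b(2) by simp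
      then have "(2::real) ^ 1 \<le> 2 ^ (card A * K - card (objects_of f A))" by (intro power_increasing) auto
      then show ?thesis using False by simp
    qed simp
  qed
  also have "\<dots> \<le> exp ((2 - 1) * ((real K)\<^sup>2 / real P) * (real (card A))\<^sup>2)"
    by (rule expect_power_overlap_le[OF KP fin]) simp
  finally have "expect ?M (\<lambda>f. 2 - of_bool (card (objects_of f A) = card A * K)) \<le> exp (\<theta> * (real (card A))\<^sup>2)"
    by (simp add: th)
  moreover have "expect ?M (\<lambda>f. 2 - of_bool (card (objects_of f A) = card A * K))
      = 2 - expect ?M (\<lambda>f. of_bool (card (objects_of f A) = card A * K))"
    by (subst Bochner_Integration.integral_diff) (auto intro!: integrable_measure_pmf_finite fM)
  ultimately show ?thesis by simp
qed

text \<open>Two disjoint object sets are both hit with probability at most the square of \<theta>,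
  so such a node costs a factor \<open>n * (card A * \<theta>)\<^sup>2\<close>, which is small. The
  factor for having few neighbours has to be kept, since the result is compared with the probability
  of the degree event, which may itself be as small as a power of \<open>1 / n\<close>.\<close>

lemma prob_double_hit_le:
  fixes \<theta> :: real
  assumes KP: "1 \<le> K" "K \<le> P" and A: "A \<subseteq> {..<n}" and th: "\<theta> = (real K)\<^sup>2 / real P"
  shows "measure_pmf.prob (objects_pmf {..<n} P K)
      {S. card (objects_of S A) = card A * K \<and> card (nbh n S A) \<le> q \<and>
          (\<exists>w\<in>{..<n} - A. \<exists>a\<in>A. \<exists>b\<in>A. a \<noteq> b \<and> S w \<inter> S a \<noteq> {} \<and> S w \<inter> S b \<noteq> {})}
    \<le> real n * ((real (card A) * \<theta>)\<^sup>2 * ((1 + real n * real (card A) * \<theta>) ^ q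
        * exp (- (real (card A) * \<theta>)) ^ (n - card A - 1 - q)))" (is "measure_pmf.prob _ ?E \<le> ?R")
proof -
  have fin: "finite A" using A finite_subset by auto
  have fM: "finite (set_pmf (objects_pmf A P K))" using finite_set_objects_pmf KP fin by blast
  have th0: "\<theta> \<ge> 0" by (simp add: th)
  let ?Q = "object_pmf P K"
  let ?B = "{..<n} - A"
  have cB: "card ?B = n - card A" using A fin by (simp add: card_Diff_subset)
  have R0: "?R \<ge> 0" using th0 by simp
  have "measure_pmf.prob (objects_pmf {..<n} P K) ?E \<le> expect (objects_pmf A P K) (\<lambda>_. ?R)"
    unfolding prob_objects_pmf_split[OF KP(2) A]
  proof (rule expect_mono[OF fM])
    fix f assume f: "f \<in> set_pmf (objects_pmf A P K)"
    note U = objects_of_bounds[OF KP(2) fin f]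
    let ?g = "{g. (\<lambda>x. if x \<in> A then f x else g x) \<in> ?E}"
    show "measure_pmf.prob (objects_pmf ?B P K) ?g \<le> ?R"
    proof (cases "card (objects_of f A) = card A * K")
      case False
      then show ?thesis using R0 unfolding mem_Collect_eq objects_of_merge by simp
    next
      case c: True
      let ?H = "{T. T \<inter> objects_of f A \<noteq> {}}"
      let ?H2 = "{T. \<exists>a\<in>A. \<exists>b\<in>A. a \<noteq> b \<and> T \<inter> f a \<noteq> {} \<and> T \<inter> f b \<noteq> {}}"
      have comp: "card (f v) = K" "finite (f v)" if "v \<in> A" for v
        using objects_pmf_component[OF KP(2) fin f that] by auto
      have disj: "f a \<inter> f b = {}" if "a \<in> A" "b \<in> A" "a \<noteq> b" for a b
        by (rule objects_disjoint[OF KP(2) fin f subset_refl fin c that])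
      have u: "real (card (objects_of f A)) * (real K / real P) = real (card A) * \<theta>"
        using c by (simp add: th power2_eq_square)
      have x: "measure_pmf.prob ?Q ?H \<le> real (card A) * \<theta>"
        using prob_hit_le[OF KP U(3)] unfolding u .
      have y: "measure_pmf.prob ?Q (- ?H) \<le> exp (- (real (card A) * \<theta>))"
      proof -
        have "- ?H = {T. T \<inter> objects_of f A = {}}" by auto
        then show ?thesis using prob_miss_le[OF KP U(1)] u by simp
      qed
      have z: "measure_pmf.prob ?Q ?H2 \<le> (real (card A) * \<theta>)\<^sup>2"
      proof -
        have "measure_pmf.prob ?Q ?H2 \<le> (\<Sum>p\<in>{p \<in> A \<times> A. fst p \<noteq> snd p}.
            measure_pmf.prob ?Q {T. T \<inter> f (fst p) \<noteq> {} \<and> T \<inter> f (snd p) \<noteq> {}})"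
          by (rule prob_le_sum) (use fin in force)+
        also have "\<dots> \<le> (\<Sum>p\<in>{p \<in> A \<times> A. fst p \<noteq> snd p}. \<theta>\<^sup>2)"
        proof (rule sum_mono)
          fix p assume "p \<in> {p \<in> A \<times> A. fst p \<noteq> snd p}"
          then have p: "fst p \<in> A" "snd p \<in> A" "fst p \<noteq> snd p" by auto
          have "measure_pmf.prob ?Q {T. T \<inter> f (fst p) \<noteq> {} \<and> T \<inter> f (snd p) \<noteq> {}}
            \<le> real (card (f (fst p))) * real (card (f (snd p))) * (real K / real P)\<^sup>2"
            using p comp disj by (intro prob_hit_both_le[OF KP]) auto
          also have "\<dots> = \<theta>\<^sup>2" using p comp by (simp add: th power2_eq_square)
          finally show "measure_pmf.prob ?Q {T. T \<inter> f (fst p) \<noteq> {} \<and> T \<inter> f (snd p) \<noteq> {}} \<le> \<theta>\<^sup>2" .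
        qed
        also have "\<dots> = real (card {p \<in> A \<times> A. fst p \<noteq> snd p}) * \<theta>\<^sup>2" by simp
        also have "\<dots> \<le> real (card (A \<times> A)) * \<theta>\<^sup>2"
          using fin by (intro mult_right_mono of_nat_mono card_mono) auto
        also have "\<dots> = (real (card A) * \<theta>)\<^sup>2" by (simp add: card_cartesian_product power2_eq_square)
        finally show ?thesis .
      qed
      have "measure_pmf.prob (objects_pmf ?B P K) ?g
          \<le> measure_pmf.prob (objects_pmf ?B P K) {g. card {w \<in> ?B. g w \<in> ?H} \<le> q \<and> (\<exists>w\<in>?B. g w \<in> ?H2)}"
      proof (rule prob_mono)
        fix g assume "g \<in> ?g"
        then have g: "card {w \<in> ?B. g w \<in> ?H} \<le> q"
          "\<exists>w\<in>?B. \<exists>a\<in>A. \<exists>b\<in>A. a \<noteq> b \<and> g w \<inter> f a \<noteq> {} \<and> g w \<inter> f b \<noteq> {}"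
          unfolding mem_Collect_eq nbh_merge by auto
        then show "g \<in> {g. card {w \<in> ?B. g w \<in> ?H} \<le> q \<and> (\<exists>w\<in>?B. g w \<in> ?H2)}" by blast
      qed
      also have "\<dots> \<le> real (card ?B) * ((real (card A) * \<theta>)\<^sup>2 * ((1 + real (card ?B) * (real (card A) * \<theta>)) ^ q
          * exp (- (real (card A) * \<theta>)) ^ (card ?B - 1 - q)))"
        by (rule prob_iid_card_le_and_ex[OF _ x y _ z])
          (use th0 KP in \<open>auto simp: set_object_pmf simp del: set_pmf_of_set\<close>)
      also have "\<dots> \<le> real n * ((real (card A) * \<theta>)\<^sup>2 * ((1 + real n * (real (card A) * \<theta>)) ^ q
          * exp (- (real (card A) * \<theta>)) ^ (card ?B - 1 - q)))"
        using th0 unfolding cB by (intro mult_mono power_mono add_left_mono mult_nonneg_nonneg) auto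
      finally show ?thesis unfolding cB by (simp add: mult.assoc)
    qed
  qed
  then show ?thesis by simp
qed

section \<open>Probability that all nodes of a fixed set have degree \<open>d\<close>\<close>

definition degree_event :: "nat \<Rightarrow> nat set \<Rightarrow> nat \<Rightarrow> (nat \<Rightarrow> nat set) set" where
  "degree_event n A d = {S. \<forall>v\<in>A. card (nbh n S {v}) = d}"

lemma card_nbh_le_of_degrees:
  assumes "finite A" "S \<in> degree_event n A d"
  shows "card (nbh n S A) \<le> card A * d"
proof -
  have "nbh n S A \<subseteq> (\<Union>v\<in>A. nbh n S {v})" by (auto simp: nbh_def objects_of_def)
  then have "card (nbh n S A) \<le> card (\<Union>v\<in>A. nbh n S {v})"
    using assms by (intro card_mono) (auto simp: nbh_def)
  also have "\<dots> \<le> (\<Sum>v\<in>A. card (nbh n S {v}))" using assms by (intro card_UN_le) auto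
  also have "\<dots> = card A * d" using assms by (simp add: degree_event_def)
  finally show ?thesis .
qed

text \<open>Apart from two error events, an overlap inside \<open>A\<close> and an outer node joined
  to two nodes of \<open>A\<close>, the neighbourhoods are disjoint \<open>d\<close>-sets outside
  \<open>A\<close>. So the configuration follows one of the patterns, and these are counted.\<close>

lemma prob_degree_event_upper:
  fixes \<theta> :: real
  assumes KP: "1 \<le> K" "K \<le> P" and A: "A \<subseteq> {..<n}" and th: "\<theta> = (real K)\<^sup>2 / real P"
  shows "measure_pmf.prob (objects_pmf {..<n} P K) (degree_event n A d)
    \<le> real ((n choose d) ^ card A) * (\<theta> ^ (card A * d) * exp (- (real (card A) * \<theta>)) ^ (n - card A - card A * d))
      + measure_pmf.prob (objects_pmf {..<n} P K)
           {S. card (objects_of S A) < card A * K \<and> card (nbh n S A) \<le> card A * d}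
      + measure_pmf.prob (objects_pmf {..<n} P K)
           {S. card (objects_of S A) = card A * K \<and> card (nbh n S A) \<le> card A * d \<and>
             (\<exists>w\<in>{..<n} - A. \<exists>a\<in>A. \<exists>b\<in>A. a \<noteq> b \<and> S w \<inter> S a \<noteq> {} \<and> S w \<inter> S b \<noteq> {})}"
    (is "_ \<le> _ + measure_pmf.prob ?M ?B1 + measure_pmf.prob ?M ?B2")
proof -
  have fin: "finite A" using A finite_subset by auto
  have fM: "finite (set_pmf (objects_pmf A P K))" using finite_set_objects_pmf KP fin by blast
  have th0: "\<theta> \<ge> 0" by (simp add: th)
  let ?F = "single_hits A ({..<n} - A) d"
  let ?b = "\<theta> ^ (card A * d) * exp (- (real (card A) * \<theta>)) ^ (n - card A - card A * d)"
  have fF: "finite ?F" using fin by (intro finite_single_hits) auto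
  have cB: "card ({..<n} - A) = n - card A" using A fin by (simp add: card_Diff_subset)
  have "measure_pmf.prob ?M (degree_event n A d) \<le> measure_pmf.prob ?M ((\<Union>W\<in>?F. hit_pattern n K A W) \<union> ?B1 \<union> ?B2)"
  proof (rule prob_mono)
    fix S assume S: "S \<in> set_pmf ?M" and D: "S \<in> degree_event n A d"
    note nb = card_nbh_le_of_degrees[OF fin D]
    have Uc: "card (objects_of S A) \<le> card A * K"
    proof -
      have "card (objects_of S A) \<le> (\<Sum>i\<in>A. card (S i))" unfolding objects_of_def by (rule card_UN_le) (rule fin)
      also have "\<dots> = card A * K" using objects_pmf_component(2)[OF KP(2) finite_lessThan S] A by (simp add: subset_eq)
      finally show ?thesis .
    qed
    show "S \<in> (\<Union>W\<in>?F. hit_pattern n K A W) \<union> ?B1 \<union> ?B2"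
    proof (cases "card (objects_of S A) = card A * K")
      case False
      then show ?thesis using Uc nb by auto
    next
      case c: True
      show ?thesis
      proof (cases "\<exists>w\<in>{..<n} - A. \<exists>a\<in>A. \<exists>b\<in>A. a \<noteq> b \<and> S w \<inter> S a \<noteq> {} \<and> S w \<inter> S b \<noteq> {}")
        case True
        then show ?thesis using c nb by auto
      next
        case False
        define W where "W = restrict (\<lambda>v. nbh n S {v}) A"
        have disj: "S a \<inter> S b = {}" if "a \<in> A" "b \<in> A" "a \<noteq> b" for a b
          by (rule objects_disjoint[OF KP(2) fin S A _ c that]) simp
        have sub: "nbh n S {v} \<subseteq> {..<n} - A" if "v \<in> A" for v
          using disj[OF _ that] by (auto simp: nbh_def objects_of_def)
        have "disjoint_family_on W A"
          unfolding disjoint_family_on_def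
        proof (intro ballI impI)
          fix a b assume ab: "a \<in> A" "b \<in> A" "a \<noteq> b"
          show "W a \<inter> W b = {}"
          proof (rule ccontr)
            assume "W a \<inter> W b \<noteq> {}"
            then obtain w where "w \<in> nbh n S {a}" "w \<in> nbh n S {b}" using ab by (auto simp: W_def)
            then show False using False ab sub[OF ab(1)] by (auto simp: nbh_def objects_of_def)
          qed
        qed
        then have "W \<in> ?F" using sub D by (auto simp: single_hits_def W_def degree_event_def)
        moreover have "S \<in> hit_pattern n K A W"
          using c by (auto simp: hit_pattern_def W_def nbh_def objects_of_def)
        ultimately show ?thesis by auto
      qed
    qed
  qed
  also have "\<dots> \<le> measure_pmf.prob ?M (\<Union>W\<in>?F. hit_pattern n K A W) + measure_pmf.prob ?M ?B1 + measure_pmf.prob ?M ?B2"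
    by (intro order_trans[OF measure_Un_le] add_mono order_refl) auto
  also have "measure_pmf.prob ?M (\<Union>W\<in>?F. hit_pattern n K A W) \<le> (\<Sum>W\<in>?F. measure_pmf.prob ?M (hit_pattern n K A W))"
    by (rule measure_pmf.finite_measure_subadditive_finite) (use fF in auto)
  also have "\<dots> \<le> (\<Sum>W\<in>?F. ?b)"
  proof (rule sum_mono)
    fix W assume W: "W \<in> ?F"
    have "measure_pmf.prob ?M (hit_pattern n K A W) \<le> expect (objects_pmf A P K) (\<lambda>_. ?b)"
      unfolding prob_hit_pattern[OF KP(2) A]
    proof (rule expect_mono[OF fM])
      fix f assume f: "f \<in> set_pmf (objects_pmf A P K)"
      show "of_bool (card (objects_of f A) = card A * K) *
        (\<Prod>w\<in>{..<n} - A. measure_pmf.prob (object_pmf P K) {T. \<forall>v\<in>A. (T \<inter> f v \<noteq> {}) = (w \<in> W v)}) \<le> ?b"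
        using hit_pattern_product_bounds(1)[OF KP A f _ W th] th0 by (cases "card (objects_of f A) = card A * K") auto
    qed
    then show "measure_pmf.prob ?M (hit_pattern n K A W) \<le> ?b" by simp
  qed
  also have "\<dots> = real (card ?F) * ?b" by simp
  also have "\<dots> \<le> real ((n choose d) ^ card A) * ?b"
  proof (rule mult_right_mono)
    have "card ?F \<le> (card ({..<n} - A) choose d) ^ card A" using fin by (intro card_single_hits_le) auto
    also have "\<dots> \<le> (n choose d) ^ card A" unfolding cB by (intro power_mono binomial_right_mono) auto
    finally show "real (card ?F) \<le> real ((n choose d) ^ card A)" by (rule of_nat_mono)
  qed (use th0 in simp)
  finally show ?thesis by simp
qed

text \<open>The patterns are mutually exclusive ways of realising the degree event, so their
  probabilities add up.\<close>

lemma prob_degree_event_lower: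
  fixes \<theta> :: real
  assumes KP: "1 \<le> K" "K \<le> P" and A: "A \<subseteq> {..<n}" and th: "\<theta> = (real K)\<^sup>2 / real P"
    and s1: "real (card A + 1) * \<theta> \<le> 1" and s2: "K + card A * K \<le> P"
  shows "real (((n - card A - card A * d) choose d) ^ card A) *
      ((2 - exp (\<theta> * (real (card A))\<^sup>2)) * ((\<theta> * (1 - real (card A + 1) * \<theta>)) ^ (card A * d)
        * ((1 - real K / real (P - card A * K)) ^ (card A * K)) ^ (n - card A - card A * d)))
    \<le> measure_pmf.prob (objects_pmf {..<n} P K) (degree_event n A d)"
proof -
  have fin: "finite A" using A finite_subset by auto
  have fM: "finite (set_pmf (objects_pmf A P K))" using finite_set_objects_pmf KP fin by blast
  have th0: "\<theta> \<ge> 0" by (simp add: th)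
  let ?M = "objects_pmf {..<n} P K"
  let ?F = "single_hits A ({..<n} - A) d"
  let ?b = "(\<theta> * (1 - real (card A + 1) * \<theta>)) ^ (card A * d)
        * ((1 - real K / real (P - card A * K)) ^ (card A * K)) ^ (n - card A - card A * d)"
  have "real K \<le> real (P - card A * K)" using s2 by (intro of_nat_mono) simp
    then have "real K / real (P - card A * K) \<le> real (P - card A * K) / real (P - card A * K)"
      by (rule divide_right_mono) simp
    also have "\<dots> \<le> 1" by simp
    finally have mu0: "0 \<le> 1 - real K / real (P - card A * K)" by simp
  have b0: "?b \<ge> 0" using th0 s1 mu0 by simp
  have fF: "finite ?F" using fin by (intro finite_single_hits) auto
  have cB: "card ({..<n} - A) = n - card A" using A fin by (simp add: card_Diff_subset)
  let ?p0 = "expect (objects_pmf A P K) (\<lambda>f. of_bool (card (objects_of f A) = card A * K))"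
  have p0: "0 \<le> ?p0" by (rule Bochner_Integration.integral_nonneg) simp
  have "real (((n - card A - card A * d) choose d) ^ card A) * ((2 - exp (\<theta> * (real (card A))\<^sup>2)) * ?b)
      \<le> real (((n - card A - card A * d) choose d) ^ card A) * (?p0 * ?b)"
    using prob_no_overlap_ge[OF KP fin th] b0 by (intro mult_left_mono mult_right_mono) auto
  also have "\<dots> \<le> real (card ?F) * (?p0 * ?b)"
    using card_single_hits_ge[OF fin, of "{..<n} - A" "card A" d] unfolding cB
    by (intro mult_right_mono of_nat_mono mult_nonneg_nonneg[OF p0 b0]) auto
  also have "\<dots> = (\<Sum>W\<in>?F. ?p0 * ?b)" by simp
  \<comment> \<open>Mutual exclusion rests on the sizes of the object sets and so holds on the
    support, hence the intersection.\<close>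
  also have "\<dots> \<le> (\<Sum>W\<in>?F. measure_pmf.prob ?M (hit_pattern n K A W \<inter> set_pmf ?M))"
  proof (rule sum_mono)
    fix W assume W: "W \<in> ?F"
    have "?p0 * ?b = expect (objects_pmf A P K) (\<lambda>f. of_bool (card (objects_of f A) = card A * K) * ?b)" by simp
    also have "\<dots> \<le> measure_pmf.prob ?M (hit_pattern n K A W)"
      unfolding prob_hit_pattern[OF KP(2) A]
    proof (rule expect_mono[OF fM])
      fix f assume f: "f \<in> set_pmf (objects_pmf A P K)"
      show "of_bool (card (objects_of f A) = card A * K) * ?b \<le> of_bool (card (objects_of f A) = card A * K) *
        (\<Prod>w\<in>{..<n} - A. measure_pmf.prob (object_pmf P K) {T. \<forall>v\<in>A. (T \<inter> f v \<noteq> {}) = (w \<in> W v)})"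
        using hit_pattern_product_bounds(2)[OF KP A f _ W th s1 s2] by (cases "card (objects_of f A) = card A * K") auto
    qed
    also have "\<dots> = measure_pmf.prob ?M (hit_pattern n K A W \<inter> set_pmf ?M)" by (simp add: measure_Int_set_pmf)
    finally show "?p0 * ?b \<le> measure_pmf.prob ?M (hit_pattern n K A W \<inter> set_pmf ?M)" .
  qed
  also have "\<dots> = measure_pmf.prob ?M (\<Union>W\<in>?F. hit_pattern n K A W \<inter> set_pmf ?M)"
  proof (rule measure_pmf.finite_measure_finite_Union[symmetric, OF fF])
    show "disjoint_family_on (\<lambda>W. hit_pattern n K A W \<inter> set_pmf ?M) ?F"
      unfolding disjoint_family_on_def
    proof (intro ballI impI, rule ccontr)
      fix W W' assume W: "W \<in> ?F" "W' \<in> ?F" "W \<noteq> W'"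
        and ne: "(hit_pattern n K A W \<inter> set_pmf ?M) \<inter> (hit_pattern n K A W' \<inter> set_pmf ?M) \<noteq> {}"
      then obtain S where S: "S \<in> hit_pattern n K A W" "S \<in> hit_pattern n K A W'" "S \<in> set_pmf ?M" by auto
      have sub: "W v \<subseteq> {..<n} - A" "W' v \<subseteq> {..<n} - A" if "v \<in> A" for v
        using W that by (auto simp: single_hits_def PiE_iff)
      have "W v = W' v" if "v \<in> A" for v
        using hit_pattern_nbh[OF KP(2) A S(3,1) that sub(1)[OF that]]
          hit_pattern_nbh[OF KP(2) A S(3,2) that sub(2)[OF that]] by simp
      moreover have "W v = W' v" if "v \<notin> A" for v
        using W that by (auto simp: single_hits_def PiE_iff extensional_def)
      ultimately show False using W(3) by blast
    qed
  qed auto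
  also have "\<dots> \<le> measure_pmf.prob ?M (degree_event n A d)"
  proof (rule prob_mono)
    fix S assume "S \<in> (\<Union>W\<in>?F. hit_pattern n K A W \<inter> set_pmf ?M)"
    then obtain W where W: "W \<in> ?F" "S \<in> hit_pattern n K A W" "S \<in> set_pmf ?M" by auto
    show "S \<in> degree_event n A d"
      unfolding degree_event_def
    proof (rule CollectI, rule ballI)
      fix v assume v: "v \<in> A"
      have "W v \<subseteq> {..<n} - A" "card (W v) = d" using W(1) v by (auto simp: single_hits_def PiE_iff)
      then show "card (nbh n S {v}) = d" using hit_pattern_nbh[OF KP(2) A W(3,2) v] by simp
    qed
  qed
  finally show ?thesis .
qed

lemma choose_ge_power:
  assumes "d \<le> M"
  shows "(real M - real d) ^ d \<le> fact d * real (M choose d)"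
  using assms
proof (induction d)
  case (Suc d)
  have "Suc d * (M choose Suc d) = (M - d) * (M choose d)"
    using binomial_absorb_comp[of M d] Suc_times_binomial[of d "M - 1"] Suc.prems by (cases M) auto
  then have "real (Suc d) * real (M choose Suc d) = (real M - real d) * real (M choose d)"
    using Suc.prems by (metis of_nat_mult of_nat_diff Suc_leD)
  then have eq: "fact (Suc d) * real (M choose Suc d) = (real M - real d) * (fact d * real (M choose d))"
    by (simp only: fact_Suc mult_ac)
  have "(real M - real (Suc d)) ^ Suc d \<le> (real M - real d) ^ Suc d"
    using Suc.prems by (intro power_mono) auto
  also have "\<dots> = (real M - real d) * (real M - real d) ^ d" by simp
  also have "\<dots> \<le> (real M - real d) * (fact d * real (M choose d))"
    using Suc by (intro mult_left_mono) auto
  finally show ?case unfolding eq .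
qed simp

text \<open>The counterpart of the exponential upper bound for misses, from the lower bound
  \<open>- z - 2 * z\<^sup>2\<close> for \<open>ln (1 - z)\<close>. The correction is of order
  \<open>n * \<theta>\<^sup>2\<close>, which vanishes when \<open>n \<theta>\<close> is of order
  \<open>ln n\<close>.\<close>

lemma prob_miss_power_ge:
  fixes \<theta> :: real
  assumes KP: "1 \<le> K" "K \<le> P" and th: "\<theta> = (real K)\<^sup>2 / real P" and small: "real (j + 1) * \<theta> \<le> 1 / 4"
  shows "exp (- (real j * real n * \<theta>) - real j * real n * \<theta> * \<theta> * (2 * real j + 8))
    \<le> ((1 - real K / real (P - j * K)) ^ (j * K)) ^ n" and "K + j * K \<le> P"
proof -
  define \<kappa> where "\<kappa> = real K / real P"
  have k0: "0 < \<kappa>" using KP by (simp add: \<kappa>_def)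
  have thk: "\<theta> = real K * \<kappa>" by (simp add: th \<kappa>_def power2_eq_square)
  have kth: "\<kappa> \<le> \<theta>" unfolding thk using KP k0 mult_right_mono[of 1 "real K" \<kappa>] by simp
  have "real (j + 1) * \<kappa> \<le> real (j + 1) * \<theta>" using kth by (intro mult_left_mono) auto
  then have jk: "real (j + 1) * \<kappa> \<le> 1 / 4" using small by linarith
  have jk': "real j * \<kappa> \<le> 1 / 4" "\<kappa> \<le> 1 / 4"
  proof -
    have "real (j + 1) * \<kappa> = real j * \<kappa> + \<kappa>" "0 \<le> real j * \<kappa>" using k0 by (auto simp: algebra_simps)
    then show "real j * \<kappa> \<le> 1 / 4" "\<kappa> \<le> 1 / 4" using jk k0 by linarith+
  qed
  have "real (K + j * K) = real (j + 1) * \<kappa> * real P" using KP by (simp add: \<kappa>_def field_simps)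
  also have "\<dots> \<le> 1 / 4 * real P" using jk by (intro mult_right_mono) auto
  finally have "real (K + j * K) \<le> real P" using KP by simp
  then show jKP: "K + j * K \<le> P" unfolding of_nat_le_iff .
  define z where "z = real K / real (P - j * K)"
  have z: "z = \<kappa> / (1 - real j * \<kappa>)"
  proof -
    have "real (P - j * K) = real P * (1 - real j * \<kappa>)"
      using jKP KP by (simp add: of_nat_diff \<kappa>_def right_diff_distrib)
    then show ?thesis by (simp add: z_def \<kappa>_def)
  qed
  have z1: "z \<le> \<kappa> * (1 + 2 * (real j * \<kappa>))"
  proof -
    have "1 \<le> (1 + 2 * (real j * \<kappa>)) * (1 - real j * \<kappa>)"
    proof -
      have "(1 + 2 * (real j * \<kappa>)) * (1 - real j * \<kappa>) = 1 + (real j * \<kappa>) * (1 - 2 * (real j * \<kappa>))"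
        by (simp add: algebra_simps)
      moreover have "0 \<le> (real j * \<kappa>) * (1 - 2 * (real j * \<kappa>))"
        using jk' k0 by (intro mult_nonneg_nonneg) auto
      ultimately show ?thesis by linarith
    qed
    then have "\<kappa> * 1 \<le> \<kappa> * ((1 + 2 * (real j * \<kappa>)) * (1 - real j * \<kappa>))" using k0 by (intro mult_left_mono) auto
    then show ?thesis unfolding z using jk' by (simp add: divide_le_eq mult.assoc)
  qed
  have z0: "0 \<le> z" by (simp add: z_def)
  have z2: "z \<le> 2 * \<kappa>"
  proof -
    have "\<kappa> * (1 + 2 * (real j * \<kappa>)) \<le> \<kappa> * 2" using jk' k0 by (intro mult_left_mono) auto
    then show ?thesis using z1 by linarith
  qed
  then have zh: "z \<le> 1 / 2" using jk' by linarith
  \<comment> \<open>In \<open>2 * j + 8\<close>, the term \<open>2 * j\<close> comes from replacing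
    \<open>P - j * K\<close> by \<open>P\<close>, and \<open>8\<close> from
    \<open>2 * z\<^sup>2\<close> with \<open>z \<le> 2 * \<kappa>\<close>.\<close>
  have "z\<^sup>2 \<le> (2 * \<kappa>)\<^sup>2" using z2 z0 by (intro power_mono)
  then have zz: "z + 2 * z\<^sup>2 \<le> \<kappa> + \<kappa> * \<kappa> * (2 * real j + 8)"
    using z1 by (simp add: power2_eq_square algebra_simps)
  have "real (j * K) * real n * (z + 2 * z\<^sup>2) \<le> real (j * K) * real n * (\<kappa> + \<kappa> * \<kappa> * (2 * real j + 8))"
    using zz by (intro mult_left_mono) auto
  also have "\<dots> = real j * real n * \<theta> + real j * real n * \<theta> * \<kappa> * (2 * real j + 8)"
    by (simp add: thk algebra_simps)
  also have "\<dots> \<le> real j * real n * \<theta> + real j * real n * \<theta> * \<theta> * (2 * real j + 8)"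
    using kth k0 by (intro add_left_mono mult_right_mono mult_left_mono) auto
  finally have main: "real (j * K) * real n * (z + 2 * z\<^sup>2) \<le> \<dots>" .
  have "- z - 2 * z\<^sup>2 \<le> ln (1 - z)" using ln_one_minus_pos_lower_bound[OF z0 zh] .
  then have "exp (- z - 2 * z\<^sup>2) \<le> 1 - z" using zh by (simp add: ln_ge_iff)
  then have "(exp (- z - 2 * z\<^sup>2) ^ (j * K)) ^ n \<le> ((1 - z) ^ (j * K)) ^ n" by (intro power_mono) auto
  moreover have "(exp (- z - 2 * z\<^sup>2) ^ (j * K)) ^ n = exp (- (real (j * K) * real n * (z + 2 * z\<^sup>2)))"
    by (simp only: exp_of_nat_mult[symmetric]) (simp add: algebra_simps)
  ultimately show "exp (- (real j * real n * \<theta>) - real j * real n * \<theta> * \<theta> * (2 * real j + 8))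
    \<le> ((1 - real K / real (P - j * K)) ^ (j * K)) ^ n"
    using main unfolding z_def[symmetric]
    by (smt (verit) exp_le_cancel_iff)
qed

text \<open>The Poisson probability of \<open>d\<close> for mean \<Lambda>; in the applications
  \<Lambda> is \<open>n \<theta>\<close>, roughly the mean degree.\<close>

definition degree_weight :: "nat \<Rightarrow> real \<Rightarrow> real" where
  "degree_weight d \<Lambda> = \<Lambda> ^ d * exp (- \<Lambda>) / fact d"

text \<open>The error is relative because the weights are small and get summed over all
  \<open>j\<close>-sets of nodes. The condition \<open>d = 0\<close> or
  \<open>1 \<le> n \<theta>\<close> guarantees that the power of \<Lambda> in the weight is at least
  \<open>1\<close>; error terms containing \<open>exp (- j * \<Lambda>)\<close> are then bounded by
  the weight.\<close>

theorem prob_degree_event_asymptotic: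
  fixes c \<epsilon> :: real
  assumes c: "c > 0" and eps: "\<epsilon> > 0"
  shows "\<forall>\<^sub>F n in sequentially. \<forall>P K. admissible c n P K \<and> (d = 0 \<or> 1 \<le> real n * ((real K)\<^sup>2 / real P)) \<longrightarrow>
    (\<forall>A\<subseteq>{..<n}. card A = j \<longrightarrow>
      \<bar>measure_pmf.prob (objects_pmf {..<n} P K) (degree_event n A d)
        - degree_weight d (real n * ((real K)\<^sup>2 / real P)) ^ j\<bar>
      \<le> \<epsilon> * degree_weight d (real n * ((real K)\<^sup>2 / real P)) ^ j)"
proof -
  define a where "a = 3 / c"
  have a: "a > 0" using c by (simp add: a_def)
  \<comment> \<open>Only \<open>n - j - i - j * d\<close> nodes with \<open>i \<le> 1\<close> are
    required to miss \<open>A\<close>; \<open>J\<close> bounds what replacing this number by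
    \<open>n\<close> costs, in units of the bound on \<theta>.\<close>
  define J where "J = real j * (real j + 1 + real j * real d)"
  have J: "J \<ge> 0" by (simp add: J_def)
  \<comment> \<open>The sequences \<open>up1\<close>, \<open>up2\<close> and \<open>up3\<close>
    bound, relative to the weight, the patterns, an overlap inside \<open>A\<close>, and an outer
    node joined to two nodes of \<open>A\<close>.\<close>
  define up1 where "up1 = (\<lambda>n::nat. exp (J * (3 * ln (real n) / real n)))"
  define b where "b = 4 * (1 + real j)"
  have b: "b > 0" by (simp add: b_def)
  define up2 where "up2 = (\<lambda>n::nat. ((b * ln (real n)) ^ (j * d) * real n powr (-1/20)) * (up1 n * (exp 1 * fact d ^ j)))"
  define up3 where "up3 = (\<lambda>n::nat. ((b * ln (real n)) ^ (j * d) * (9 * (ln (real n))\<^sup>2 / real n)) * (up1 n * ((real j)\<^sup>2 * fact d ^ j)))"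
  \<comment> \<open>The factors account, in this order, for the choice of the neighbourhoods, the
    absence of an overlap, the hits and the misses.\<close>
  define lo where "lo = (\<lambda>n::nat. (1 - real (j + j * d + d) / real n) ^ (d * j) *
     (2 - exp (3 * ln (real n) / real n * (real j)\<^sup>2)) * (1 - real (j + 1) * (3 * ln (real n) / real n)) ^ (j * d)
     * exp (- (real j * (3 * ln (real n)) * (3 * ln (real n) / real n) * (2 * real j + 8))))"
  have "(\<lambda>n. up1 n + up2 n + up3 n) \<longlonglongrightarrow> 1 + 0 + 0"
  proof (intro tendsto_add)
    show up1: "up1 \<longlonglongrightarrow> 1" unfolding up1_def by real_asymp
    have "(\<lambda>n::nat. (b * ln (real n)) ^ (j * d) * real n powr (-1/20)) \<longlonglongrightarrow> 0"
      using b by real_asymp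
    from tendsto_mult[OF this tendsto_mult[OF up1 tendsto_const]] show "up2 \<longlonglongrightarrow> 0"
      unfolding up2_def by simp
    have "(\<lambda>n::nat. (b * ln (real n)) ^ (j * d) * (9 * (ln (real n))\<^sup>2 / real n)) \<longlonglongrightarrow> 0"
      using b by real_asymp
    from tendsto_mult[OF this tendsto_mult[OF up1 tendsto_const]] show "up3 \<longlonglongrightarrow> 0"
      unfolding up3_def by simp
  qed
  then have e1: "\<forall>\<^sub>F n in sequentially. up1 n + up2 n + up3 n < 1 + \<epsilon>"
    using eps by (intro order_tendstoD(2)) auto
  have "lo \<longlonglongrightarrow> 1 ^ (d * j) * (2 - 1) * 1 ^ (j * d) * 1"
  proof -
    have 1: "(\<lambda>n::nat. 1 - real (j + j * d + d) / real n) \<longlonglongrightarrow> 1" by real_asymp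
    have 2: "(\<lambda>n::nat. exp (3 * ln (real n) / real n * (real j)\<^sup>2)) \<longlonglongrightarrow> 1" by real_asymp
    have 3: "(\<lambda>n::nat. 1 - real (j + 1) * (3 * ln (real n) / real n)) \<longlonglongrightarrow> 1" by real_asymp
    have 4: "(\<lambda>n::nat. exp (- (real j * (3 * ln (real n)) * (3 * ln (real n) / real n) * (2 * real j + 8)))) \<longlonglongrightarrow> 1"
      by real_asymp
    show ?thesis unfolding lo_def by (intro tendsto_intros 1 2 3 4)
  qed
  then have e2: "\<forall>\<^sub>F n in sequentially. lo n > 1 - \<epsilon>"
    using eps by (intro order_tendstoD(1)) auto
  have e3: "\<forall>\<^sub>F n in sequentially. ln (real n) \<ge> 1" by real_asymp
  have e4: "\<forall>\<^sub>F n in sequentially. real (j + 1 + j * d + d) \<le> real n" by real_asymp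
  have e5: "\<forall>\<^sub>F n in sequentially. real (j + 1) * (3 * ln (real n) / real n) \<le> 1 / 4" by real_asymp
  have e6: "\<forall>\<^sub>F n in sequentially. real n powr (1/20) * exp (a * sqrt (ln (real n))) * (3 * ln (real n) / real n) * (real j)\<^sup>2 \<le> 1"
    using a by real_asymp
  have e7: "\<forall>\<^sub>F n in sequentially. 2 - exp (3 * ln (real n) / real n * (real j)\<^sup>2) \<ge> 0" by real_asymp
  show ?thesis
    using e1 e2 e3 e4 e5 e6 e7
  proof eventually_elim
    case (elim n)
    show ?case
    proof (intro allI impI)
      fix P K A
      assume as: "admissible c n P K \<and> (d = 0 \<or> 1 \<le> real n * ((real K)\<^sup>2 / real P))"
        and A: "A \<subseteq> {..<n}" "card A = j"
      define L where "L = ln (real n)"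
      define \<theta> where "\<theta> = (real K)\<^sup>2 / real P"
      define \<Lambda> where "\<Lambda> = real n * \<theta>"
      define s where "s = real n powr (1/20)"
      have KP: "1 \<le> K" "K \<le> P" and Kc: "c * sqrt L \<le> real K" and lam: "\<Lambda> \<le> 3 * L" and dl: "d = 0 \<or> 1 \<le> \<Lambda>"
        using as by (auto simp: admissible_def L_def \<theta>_def \<Lambda>_def)
      have L1: "L \<ge> 1" using elim by (simp add: L_def)
      have n0: "real n > 0" using L1 by (cases "n = 0") (auto simp: L_def)
      have n1: "n \<ge> 1" using n0 by simp
      have bL: "0 \<le> b * L" using b L1 by simp
      have th0: "\<theta> \<ge> 0" by (simp add: \<theta>_def)
      have lam0: "\<Lambda> \<ge> 0" by (simp add: \<Lambda>_def th0)
      have thl: "\<theta> = \<Lambda> / real n" using n0 by (simp add: \<Lambda>_def)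
      have thle: "\<theta> \<le> 3 * L / real n" unfolding thl using lam n0 by (intro divide_right_mono) auto
      have s1: "s \<ge> 1" using n1 by (simp add: s_def ge_one_powr_ge_zero)
      have nn: "j + 1 + j * d + d \<le> n" using elim(4) by linarith
      define \<mu> where "\<mu> = degree_weight d \<Lambda>"
      have mu: "\<mu> ^ j = \<Lambda> ^ (d * j) * exp (- (real j * \<Lambda>)) / fact d ^ j"
        by (simp add: \<mu>_def degree_weight_def power_mult_distrib power_divide power_mult[symmetric] exp_of_nat_mult[symmetric])
      have lamp: "\<Lambda> ^ (d * j) = (real n ^ d) ^ j * \<theta> ^ (j * d)"
      proof -
        have "\<Lambda> ^ (d * j) = real n ^ (d * j) * \<theta> ^ (d * j)" by (simp only: \<Lambda>_def power_mult_distrib)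
        also have "real n ^ (d * j) = (real n ^ d) ^ j" by (rule power_mult)
        also have "\<theta> ^ (d * j) = \<theta> ^ (j * d)" by (simp only: mult.commute)
        finally show ?thesis .
      qed
      have mu0: "\<mu> ^ j \<ge> 0" using lam0 by (simp add: mu)
      have lam1: "1 \<le> \<Lambda> ^ (d * j)" using dl by (cases "d = 0") auto
      have emu: "exp (- (real j * \<Lambda>)) \<le> \<mu> ^ j * fact d ^ j"
      proof -
        have "\<mu> ^ j * fact d ^ j = \<Lambda> ^ (d * j) * exp (- (real j * \<Lambda>))" by (simp add: mu)
        moreover have "1 * exp (- (real j * \<Lambda>)) \<le> \<Lambda> ^ (d * j) * exp (- (real j * \<Lambda>))"
          using lam1 by (intro mult_right_mono) auto
        ultimately show ?thesis by simp
      qed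
      have expo: "exp (- (real j * \<theta>)) ^ (n - j - i - j * d) \<le> exp (- (real j * \<Lambda>)) * up1 n" if "i \<le> 1" for i
      proof -
        have r: "real (n - j - i - j * d) = real n - real j - real i - real j * real d"
          using nn that by (simp add: of_nat_diff)
        have "real j * \<theta> * (real j + real i + real j * real d) \<le> real j * (3 * L / real n) * (real j + 1 + real j * real d)"
          using thle th0 that L1 by (intro mult_mono) auto
        also have "\<dots> = J * (3 * L / real n)" by (simp add: J_def)
        finally have "- (real j * \<theta>) * real (n - j - i - j * d) \<le> - (real j * \<Lambda>) + J * (3 * L / real n)"
          unfolding r \<Lambda>_def by (simp add: algebra_simps)
        moreover have "exp (- (real j * \<theta>)) ^ (n - j - i - j * d) = exp (- (real j * \<theta>) * real (n - j - i - j * d))"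
          by (simp only: exp_of_nat_mult[symmetric] mult.commute)
        ultimately show ?thesis unfolding up1_def L_def[symmetric] exp_add[symmetric] by simp
      qed
      have up10: "up1 n \<ge> 0" by (simp add: up1_def)
      let ?M = "objects_pmf {..<n} P K"
      let ?B1 = "{S. card (objects_of S A) < card A * K \<and> card (nbh n S A) \<le> card A * d}"
      let ?B2 = "{S. card (objects_of S A) = card A * K \<and> card (nbh n S A) \<le> card A * d \<and>
             (\<exists>w\<in>{..<n} - A. \<exists>a\<in>A. \<exists>b\<in>A. a \<noteq> b \<and> S w \<inter> S a \<noteq> {} \<and> S w \<inter> S b \<noteq> {})}"
      have base: "1 + real n * real j * \<theta> \<le> b * L"
      proof -
        have "real n * real j * \<theta> \<le> 3 * (real j * L)"
          using mult_left_mono[OF lam, of "real j"] by (simp add: \<Lambda>_def mult_ac)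
        moreover have "0 \<le> real j * L" using L1 by simp
        moreover have "b * L = 4 * L + 4 * (real j * L)" by (simp add: b_def algebra_simps)
        ultimately show ?thesis using L1 by linarith
      qed
      have M0: "real ((n choose d) ^ j) * (\<theta> ^ (j * d) * exp (- (real j * \<theta>)) ^ (n - j - j * d)) \<le> up1 n * \<mu> ^ j"
      proof -
        have "real ((n choose d) ^ j) * (\<theta> ^ (j * d) * exp (- (real j * \<theta>)) ^ (n - j - j * d))
            \<le> (real n ^ d / fact d) ^ j * (\<theta> ^ (j * d) * (exp (- (real j * \<Lambda>)) * up1 n))"
          using expo[of 0] th0 choose_le_power_fact[of n d] up10
          by (intro mult_mono) (auto intro!: power_mono mult_left_mono)
        also have "\<dots> = up1 n * \<mu> ^ j"
          unfolding mu lamp power_divide by simp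
        finally show ?thesis .
      qed
      have M1: "measure_pmf.prob ?M ?B1 \<le> up2 n * \<mu> ^ j"
      proof -
        define m where "m = n - card A - card A * d"
        define t where "t = exp (real K * real m / real P)"
        have "measure_pmf.prob ?M ?B1 \<le> (1 + real n * real (card A) * \<theta>) ^ (card A * d)
            * exp (- (real (card A) * \<theta> * real m)) * (exp (s * t * \<theta> * (real (card A))\<^sup>2) / s)"
          unfolding m_def by (rule prob_overlap_small_nbh_le[OF KP A(1) s1 _ \<theta>_def]) (simp add: t_def m_def)
        also have "\<dots> \<le> (b * L) ^ (j * d) * (exp (- (real j * \<Lambda>)) * up1 n) * (exp 1 / s)"
        proof (intro mult_mono divide_right_mono)
          show "(1 + real n * real (card A) * \<theta>) ^ (card A * d) \<le> (b * L) ^ (j * d)"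
            using base th0 A(2) by (auto intro!: power_mono)
          have "exp (- (real (card A) * \<theta> * real m)) = exp (- (real j * \<theta>)) ^ (n - j - 0 - j * d)"
            unfolding A(2) m_def by (simp add: exp_of_nat_mult[symmetric] mult_ac)
          then show "exp (- (real (card A) * \<theta> * real m)) \<le> exp (- (real j * \<Lambda>)) * up1 n" using expo[of 0] by simp
          have "real K * real m / real P \<le> real K * real n / real P"
            by (intro divide_right_mono mult_left_mono) (auto simp: m_def)
          also have "\<dots> = \<Lambda> / real K" using KP by (simp add: \<theta>_def \<Lambda>_def power2_eq_square field_simps)
          also have "\<dots> \<le> 3 * L / real K" using lam by (intro divide_right_mono) auto
          also have "\<dots> \<le> 3 * L / (c * sqrt L)" using Kc c L1 KP by (intro divide_left_mono) auto
          also have "\<dots> = a * sqrt L" using c L1 real_div_sqrt[of L] by (simp add: a_def field_simps)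
          finally have t: "t \<le> exp (a * sqrt L)" by (simp add: t_def)
          have "s * t * \<theta> * (real (card A))\<^sup>2 \<le> s * exp (a * sqrt L) * (3 * L / real n) * (real j)\<^sup>2"
            using s1 t thle th0 L1 A(2) by (intro mult_mono) (auto simp: t_def)
          also have "\<dots> \<le> 1" using elim(6) by (simp add: s_def L_def)
          finally show "exp (s * t * \<theta> * (real (card A))\<^sup>2) \<le> exp 1" by simp
        qed (use s1 bL up10 in auto)
        also have "\<dots> = (b * L) ^ (j * d) * up1 n * (exp 1 / s) * exp (- (real j * \<Lambda>))" by simp
        also have "\<dots> \<le> (b * L) ^ (j * d) * up1 n * (exp 1 / s) * (\<mu> ^ j * fact d ^ j)"
          using emu bL up10 s1 by (intro mult_left_mono) auto
        also have "exp 1 / s = exp 1 * real n powr (-1/20)" by (simp add: s_def powr_minus_divide)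
        finally show ?thesis unfolding up2_def L_def[symmetric] by (simp add: mult_ac)
      qed
      have M2: "measure_pmf.prob ?M ?B2 \<le> up3 n * \<mu> ^ j"
      proof -
        have "measure_pmf.prob ?M ?B2 \<le> real n * ((real (card A) * \<theta>)\<^sup>2 * ((1 + real n * real (card A) * \<theta>) ^ (card A * d)
            * exp (- (real (card A) * \<theta>)) ^ (n - card A - 1 - card A * d)))"
          by (rule prob_double_hit_le[OF KP A(1) \<theta>_def])
        also have "\<dots> \<le> real n * ((real j * (3 * L / real n))\<^sup>2 * ((b * L) ^ (j * d)
            * (exp (- (real j * \<Lambda>)) * up1 n)))"
          unfolding A(2)
        proof (intro mult_left_mono mult_mono)
          show "(real j * \<theta>)\<^sup>2 \<le> (real j * (3 * L / real n))\<^sup>2"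
            using thle th0 by (intro power_mono mult_left_mono) auto
          show "(1 + real n * real j * \<theta>) ^ (j * d) \<le> (b * L) ^ (j * d)"
            using base th0 by (intro power_mono) auto
          show "exp (- (real j * \<theta>)) ^ (n - j - 1 - j * d) \<le> exp (- (real j * \<Lambda>)) * up1 n" using expo[of 1] by simp
        qed (use th0 bL up10 in auto)
        also have "\<dots> = (real j)\<^sup>2 * (9 * L\<^sup>2 / real n) * (b * L) ^ (j * d) * up1 n * exp (- (real j * \<Lambda>))"
          using n0 by (simp add: power2_eq_square field_simps)
        also have "\<dots> \<le> (real j)\<^sup>2 * (9 * L\<^sup>2 / real n) * (b * L) ^ (j * d) * up1 n * (\<mu> ^ j * fact d ^ j)"
          using emu bL up10 by (intro mult_left_mono) auto
        finally show ?thesis unfolding up3_def L_def[symmetric] by (simp add: mult_ac)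
      qed
      have "measure_pmf.prob ?M (degree_event n A d) \<le> up1 n * \<mu> ^ j + up2 n * \<mu> ^ j + up3 n * \<mu> ^ j"
        using prob_degree_event_upper[OF KP A(1) \<theta>_def, of d] M0 M1 M2 unfolding A(2) by linarith
      also have "\<dots> = (up1 n + up2 n + up3 n) * \<mu> ^ j" by (simp add: algebra_simps)
      also have "\<dots> \<le> (1 + \<epsilon>) * \<mu> ^ j" using elim(1) mu0 by (intro mult_right_mono) auto
      finally have upper: "measure_pmf.prob ?M (degree_event n A d) \<le> (1 + \<epsilon>) * \<mu> ^ j" .

      have "real (j + 1) * \<theta> \<le> real (j + 1) * (3 * L / real n)" using thle by (intro mult_left_mono) auto
      then have sm: "real (j + 1) * \<theta> \<le> 1 / 4" using elim(5) by (simp add: L_def)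
      note miss = prob_miss_power_ge(1)[OF KP \<theta>_def sm, of n] prob_miss_power_ge(2)[OF KP \<theta>_def sm]
      define \<nu> where "\<nu> = (1 - real K / real (P - j * K)) ^ (j * K)"
      have nu: "0 \<le> \<nu>" "\<nu> \<le> 1"
      proof -
        have "K \<le> P - j * K" using miss(2) by simp
        then have "real K \<le> real (P - j * K)" by (rule of_nat_mono)
        then have "real K / real (P - j * K) \<le> real (P - j * K) / real (P - j * K)"
          by (rule divide_right_mono) simp
        also have "\<dots> \<le> 1" by simp
        finally have "0 \<le> 1 - real K / real (P - j * K)" by simp
        moreover have "0 \<le> real K / real (P - j * K)" by (rule divide_nonneg_nonneg) (rule of_nat_0_le_iff)+
        then have "1 - real K / real (P - j * K) \<le> 1" by simp
        ultimately show "0 \<le> \<nu>" "\<nu> \<le> 1" by (auto simp: \<nu>_def intro: power_le_one)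
      qed
      have mis: "exp (- (real j * \<Lambda>)) * exp (- (real j * (3 * L) * (3 * L / real n) * (2 * real j + 8))) \<le> \<nu> ^ (n - j - j * d)"
      proof -
        have "real j * \<Lambda> * \<theta> * (2 * real j + 8) \<le> real j * (3 * L) * (3 * L / real n) * (2 * real j + 8)"
          using lam lam0 thle th0 L1 by (intro mult_mono) auto
        then have "exp (- (real j * \<Lambda>)) * exp (- (real j * (3 * L) * (3 * L / real n) * (2 * real j + 8)))
           \<le> exp (- (real j * real n * \<theta>) - real j * real n * \<theta> * \<theta> * (2 * real j + 8))"
          unfolding exp_add[symmetric] by (simp add: \<Lambda>_def mult_ac)
        also have "\<dots> \<le> \<nu> ^ n" using miss(1) by (simp add: \<nu>_def)
        also have "\<dots> \<le> \<nu> ^ (n - j - j * d)" using nu by (intro power_decreasing) auto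
        finally show ?thesis .
      qed
      have "(1 - \<epsilon>) * \<mu> ^ j \<le> lo n * \<mu> ^ j" using elim(2) mu0 by (intro mult_right_mono) auto
      also have "\<dots> = ((1 - real (j + j * d + d) / real n) ^ d * real n ^ d / fact d) ^ j *
          ((2 - exp (3 * L / real n * (real j)\<^sup>2)) * ((\<theta> * (1 - real (j + 1) * (3 * L / real n))) ^ (j * d)
          * (exp (- (real j * \<Lambda>)) * exp (- (real j * (3 * L) * (3 * L / real n) * (2 * real j + 8))))))"
        unfolding lo_def mu lamp L_def[symmetric] power_mult[of "1 - real (j + j * d + d) / real n" d j]
          power_mult_distrib power_divide by (simp only: times_divide_eq_left times_divide_eq_right mult_ac)
      also have "\<dots> \<le> real (((n - j - j * d) choose d) ^ j) *
          ((2 - exp (\<theta> * (real j)\<^sup>2)) * ((\<theta> * (1 - real (j + 1) * \<theta>)) ^ (j * d) * \<nu> ^ (n - j - j * d)))"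
      proof (intro mult_mono)
        have "(1 - real (j + j * d + d) / real n) ^ d * real n ^ d = ((1 - real (j + j * d + d) / real n) * real n) ^ d"
          by (simp only: power_mult_distrib)
        also have "(1 - real (j + j * d + d) / real n) * real n = real (n - j - j * d) - real d"
          using n0 nn by (simp add: left_diff_distrib of_nat_diff)
        also have "\<dots> ^ d \<le> fact d * real ((n - j - j * d) choose d)" using nn by (intro choose_ge_power) auto
        finally have "(1 - real (j + j * d + d) / real n) ^ d * real n ^ d / fact d \<le> real ((n - j - j * d) choose d)"
          by (simp add: field_simps)
        moreover have "real (j + j * d + d) \<le> real n" using nn by (intro of_nat_mono) simp
        then have "real (j + j * d + d) / real n \<le> 1" using n0 by (simp only: divide_le_eq_1_pos)
        then have "0 \<le> 1 - real (j + j * d + d) / real n" by simp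
        ultimately show "((1 - real (j + j * d + d) / real n) ^ d * real n ^ d / fact d) ^ j \<le> real (((n - j - j * d) choose d) ^ j)"
          unfolding of_nat_power by (intro power_mono) auto
        have "\<theta> * (real j)\<^sup>2 \<le> 3 * L / real n * (real j)\<^sup>2" using thle by (intro mult_right_mono) auto
        then show "2 - exp (3 * L / real n * (real j)\<^sup>2) \<le> 2 - exp (\<theta> * (real j)\<^sup>2)" by simp
        then show "0 \<le> 2 - exp (\<theta> * (real j)\<^sup>2)" using elim(7) unfolding L_def by linarith
        have j1: "0 \<le> 1 - real (j + 1) * (3 * L / real n)" using elim(5) unfolding L_def by linarith
        have "1 - real (j + 1) * (3 * L / real n) \<le> 1 - real (j + 1) * \<theta>"
          using mult_left_mono[OF thle, of "real (j + 1)"] by simp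
        then show "(\<theta> * (1 - real (j + 1) * (3 * L / real n))) ^ (j * d) \<le> (\<theta> * (1 - real (j + 1) * \<theta>)) ^ (j * d)"
          using th0 j1 by (intro power_mono mult_left_mono mult_nonneg_nonneg) auto
        show "0 \<le> (\<theta> * (1 - real (j + 1) * \<theta>)) ^ (j * d)" using th0 sm by simp
        show "0 \<le> (2 - exp (3 * L / real n * (real j)\<^sup>2)) * ((\<theta> * (1 - real (j + 1) * (3 * L / real n))) ^ (j * d)
          * (exp (- (real j * \<Lambda>)) * exp (- (real j * (3 * L) * (3 * L / real n) * (2 * real j + 8)))))"
          using elim(7) th0 j1 unfolding L_def[symmetric] by (intro mult_nonneg_nonneg zero_le_power) auto
        show "0 \<le> (\<theta> * (1 - real (j + 1) * (3 * L / real n))) ^ (j * d)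
          * (exp (- (real j * \<Lambda>)) * exp (- (real j * (3 * L) * (3 * L / real n) * (2 * real j + 8))))"
          using th0 j1 by (intro mult_nonneg_nonneg zero_le_power) auto
      qed (use mis in auto)
      also have "\<dots> \<le> measure_pmf.prob ?M (degree_event n A d)"
        using prob_degree_event_lower[OF KP A(1) \<theta>_def, of d] sm miss(2) unfolding A(2) \<nu>_def by simp
      finally have lower: "(1 - \<epsilon>) * \<mu> ^ j \<le> measure_pmf.prob ?M (degree_event n A d)" .
      show "\<bar>measure_pmf.prob ?M (degree_event n A d) - degree_weight d (real n * ((real K)\<^sup>2 / real P)) ^ j\<bar>
        \<le> \<epsilon> * degree_weight d (real n * ((real K)\<^sup>2 / real P)) ^ j"
        using upper lower unfolding \<mu>_def \<Lambda>_def \<theta>_def abs_le_iff by (simp add: algebra_simps)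
    qed
  qed
qed

section \<open>The number of nodes of a given degree\<close>

definition degree_count :: "nat \<Rightarrow> nat \<Rightarrow> (nat \<Rightarrow> nat set) \<Rightarrow> nat" where
  "degree_count n d S = card {v \<in> {..<n}. card (nbh n S {v}) = d}"

text \<open>Equivalently the expected number of \<open>i\<close>-sets of nodes all of degree
  \<open>d\<close>, the quantity that enters inclusion and exclusion.\<close>

definition binomial_moment :: "nat \<Rightarrow> nat \<Rightarrow> nat \<Rightarrow> nat \<Rightarrow> nat \<Rightarrow> real" where
  "binomial_moment n P K d i = expect (objects_pmf {..<n} P K) (\<lambda>S. real (degree_count n d S choose i))"

lemma degree_count_choose:
  "real (degree_count n d S choose i) = (\<Sum>A\<in>{A. A \<subseteq> {..<n} \<and> card A = i}. of_bool (S \<in> degree_event n A d))"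
proof -
  let ?V = "{v \<in> {..<n}. card (nbh n S {v}) = d}"
  have "degree_count n d S choose i = card {A. A \<subseteq> ?V \<and> card A = i}"
    unfolding degree_count_def by (rule n_subsets[symmetric]) simp
  also have "{A. A \<subseteq> ?V \<and> card A = i} = {A \<in> {A. A \<subseteq> {..<n} \<and> card A = i}. S \<in> degree_event n A d}"
    by (auto simp: degree_event_def)
  also have "real (card \<dots>) = (\<Sum>A\<in>{A. A \<subseteq> {..<n} \<and> card A = i}. of_bool (S \<in> degree_event n A d))"
    by (simp add: sum.If_cases of_bool_def Int_def)
  finally show ?thesis .
qed

lemma binomial_moment_eq:
  assumes "K \<le> P"
  shows "binomial_moment n P K d i =
    (\<Sum>A\<in>{A. A \<subseteq> {..<n} \<and> card A = i}. measure_pmf.prob (objects_pmf {..<n} P K) (degree_event n A d))"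
  unfolding binomial_moment_def degree_count_choose prob_eq_expect
  by (rule Bochner_Integration.integral_sum)
     (auto intro!: integrable_measure_pmf_finite finite_set_objects_pmf assms)

lemma binomial_moment_bounds:
  assumes "K \<le> P"
    and b: "\<forall>A\<subseteq>{..<n}. card A = i \<longrightarrow>
      \<bar>measure_pmf.prob (objects_pmf {..<n} P K) (degree_event n A d) - w\<bar> \<le> \<epsilon> * w"
  shows "\<bar>binomial_moment n P K d i - real (n choose i) * w\<bar> \<le> \<epsilon> * (real (n choose i) * w)"
proof -
  let ?I = "{A. A \<subseteq> {..<n} \<and> card A = i}"
  have cI: "card ?I = n choose i" using n_subsets[of "{..<n}" i] by simp
  have "binomial_moment n P K d i - real (n choose i) * w
      = (\<Sum>A\<in>?I. measure_pmf.prob (objects_pmf {..<n} P K) (degree_event n A d) - w)"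
    unfolding binomial_moment_eq[OF assms(1)] sum_subtractf using cI by simp
  also have "\<bar>\<dots>\<bar> \<le> (\<Sum>A\<in>?I. \<bar>measure_pmf.prob (objects_pmf {..<n} P K) (degree_event n A d) - w\<bar>)"
    by (rule sum_abs)
  also have "\<dots> \<le> (\<Sum>A\<in>?I. \<epsilon> * w)" by (rule sum_mono) (use b in auto)
  finally show ?thesis using cI by (simp add: mult_ac)
qed

text \<open>Pascal's rule makes the sum telescope. The sign of the remaining term is the parity of
  the truncation, which gives both of Bonferroni's inequalities.\<close>

lemma alternating_choose_sum:
  "(\<Sum>i\<le>m. (-1) ^ i * real (Suc x choose i)) = (-1) ^ m * real (x choose m)"
  by (induction m) (auto simp: algebra_simps)

lemma bonferroni_even: "of_bool (x = 0) \<le> (\<Sum>i\<le>2 * m. (-1) ^ i * real (x choose i))"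
proof (cases x)
  case 0
  have "(\<Sum>i\<le>2 * m. (-1) ^ i * real (0 choose i)) = (\<Sum>i\<in>{0}. (-1) ^ i * real (0 choose i))"
    by (rule sum.mono_neutral_right) (auto simp: binomial_eq_0)
  then show ?thesis using 0 by simp
qed (simp only: alternating_choose_sum, simp)

lemma bonferroni_odd: "(\<Sum>i\<le>Suc (2 * m). (-1) ^ i * real (x choose i)) \<le> of_bool (x = 0)"
proof (cases x)
  case 0
  have "(\<Sum>i\<le>Suc (2 * m). (-1) ^ i * real (0 choose i)) = (\<Sum>i\<in>{0}. (-1) ^ i * real (0 choose i))"
    by (rule sum.mono_neutral_right) (auto simp: binomial_eq_0)
  then show ?thesis using 0 by simp
qed (simp only: alternating_choose_sum, simp)

lemma prob_degree_count_zero_bonferroni: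
  assumes "K \<le> P"
  shows "measure_pmf.prob (objects_pmf {..<n} P K) {S. degree_count n d S = 0}
      \<le> (\<Sum>i\<le>2 * m. (-1) ^ i * binomial_moment n P K d i)"
    and "(\<Sum>i\<le>Suc (2 * m). (-1) ^ i * binomial_moment n P K d i)
      \<le> measure_pmf.prob (objects_pmf {..<n} P K) {S. degree_count n d S = 0}"
proof -
  let ?M = "objects_pmf {..<n} P K"
  have fM: "finite (set_pmf ?M)" by (rule finite_set_objects_pmf[OF assms]) simp
  have eq: "(\<Sum>i\<le>l. (-1) ^ i * binomial_moment n P K d i)
     = expect ?M (\<lambda>S. \<Sum>i\<le>l. (-1) ^ i * real (degree_count n d S choose i))" for l
    unfolding binomial_moment_def
    by (subst Bochner_Integration.integral_sum) (auto intro!: integrable_measure_pmf_finite fM)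
  show "measure_pmf.prob ?M {S. degree_count n d S = 0} \<le> (\<Sum>i\<le>2 * m. (-1) ^ i * binomial_moment n P K d i)"
    unfolding eq prob_eq_expect by (rule expect_mono[OF fM]) (use bonferroni_even in simp)
  show "(\<Sum>i\<le>Suc (2 * m). (-1) ^ i * binomial_moment n P K d i) \<le> measure_pmf.prob ?M {S. degree_count n d S = 0}"
    unfolding eq prob_eq_expect by (rule expect_mono[OF fM]) (use bonferroni_odd in simp)
qed

section \<open>Poisson limit for the number of nodes of degree \<open>d\<close>\<close>

lemma choose_over_power_tendsto: "(\<lambda>n. real (n choose i) / real n ^ i) \<longlonglongrightarrow> 1 / fact i"
proof (rule tendsto_sandwich)
  show "(\<lambda>n. (1 - real i / real n) ^ i / fact i) \<longlonglongrightarrow> 1 / fact i"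
  proof -
    have "(\<lambda>n. 1 - real i / real n) \<longlonglongrightarrow> 1" by real_asymp
    then have "(\<lambda>n. (1 - real i / real n) ^ i / fact i) \<longlonglongrightarrow> 1 ^ i / fact i" by (intro tendsto_intros) auto
    then show ?thesis by simp
  qed
  show "\<forall>\<^sub>F n in sequentially. real (n choose i) / real n ^ i \<le> 1 / fact i"
    using eventually_gt_at_top[of 0]
  proof eventually_elim
    case (elim n)
    then show ?case using choose_le_power_fact[of n i] by (simp add: field_simps)
  qed
  show "\<forall>\<^sub>F n in sequentially. (1 - real i / real n) ^ i / fact i \<le> real (n choose i) / real n ^ i"
    using eventually_gt_at_top[of i]
  proof eventually_elim
    case (elim n)
    have n0: "real n > 0" using elim by simp
    have "(1 - real i / real n) ^ i * real n ^ i = ((1 - real i / real n) * real n) ^ i" by (simp only: power_mult_distrib)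
    also have "(1 - real i / real n) * real n = real n - real i" using n0 by (simp add: left_diff_distrib)
    also have "\<dots> ^ i \<le> fact i * real (n choose i)" using elim by (intro choose_ge_power) auto
    finally show ?case using n0 by (simp add: field_simps)
  qed
qed auto

lemma tendsto_of_relative_error:
  fixes f t :: "nat \<Rightarrow> real"
  assumes t: "t \<longlonglongrightarrow> T" and f: "\<And>\<epsilon>. \<epsilon> > 0 \<Longrightarrow> \<forall>\<^sub>F n in sequentially. \<bar>f n - t n\<bar> \<le> \<epsilon> * t n"
  shows "f \<longlonglongrightarrow> T"
proof -
  have "(\<lambda>n. f n - t n) \<longlonglongrightarrow> 0"
  proof (rule tendstoI)
    fix e :: real assume e: "e > 0"
    define \<epsilon> where "\<epsilon> = e / (2 * (\<bar>T\<bar> + 1))"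
    have eps: "\<epsilon> > 0" using e by (simp add: \<epsilon>_def)
    have "\<forall>\<^sub>F n in sequentially. t n < \<bar>T\<bar> + 1" using t by (rule order_tendstoD) linarith
    with f[OF eps] show "\<forall>\<^sub>F n in sequentially. dist (f n - t n) 0 < e"
    proof eventually_elim
      case (elim n)
      have "\<bar>f n - t n\<bar> \<le> \<epsilon> * (\<bar>T\<bar> + 1)" using elim eps mult_left_mono[of "t n" "\<bar>T\<bar> + 1" \<epsilon>] by linarith
      also have "\<dots> = e / 2" by (simp add: \<epsilon>_def field_simps)
      finally show ?case using e by (simp add: dist_real_def)
    qed
  qed
  from tendsto_add[OF this t] show ?thesis by simp
qed

text \<open>For a fixed truncation all binomial moments converge, so the Bonferroni bounds tend to
  partial sums of the series of \<open>exp (- \<mu>)\<close>. A truncation of the right parity is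
  chosen before \<open>n\<close> grows, which squeezes the probability.\<close>

theorem degree_count_poisson_limit:
  fixes P K :: "nat \<Rightarrow> nat"
  assumes c: "c > 0"
    and adm: "\<forall>\<^sub>F n in sequentially. admissible c n (P n) (K n) \<and> 1 \<le> real n * ((real (K n))\<^sup>2 / real (P n))"
    and w: "(\<lambda>n. real n * degree_weight d (real n * ((real (K n))\<^sup>2 / real (P n)))) \<longlonglongrightarrow> \<mu>"
  shows "(\<lambda>n. measure_pmf.prob (objects_pmf {..<n} (P n) (K n)) {S. degree_count n d S = 0}) \<longlonglongrightarrow> exp (- \<mu>)"
proof -
  define v where "v = (\<lambda>n. degree_weight d (real n * ((real (K n))\<^sup>2 / real (P n))))"
  have mom: "(\<lambda>n. binomial_moment n (P n) (K n) d i) \<longlonglongrightarrow> \<mu> ^ i / fact i" for i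
  proof (rule tendsto_of_relative_error)
    have "(\<lambda>n. real (n choose i) / real n ^ i * (real n * v n) ^ i) \<longlonglongrightarrow> 1 / fact i * \<mu> ^ i"
      using w unfolding v_def by (intro tendsto_mult choose_over_power_tendsto tendsto_power)
    moreover have "\<forall>\<^sub>F n in sequentially. real (n choose i) / real n ^ i * (real n * v n) ^ i = real (n choose i) * v n ^ i"
      using eventually_gt_at_top[of 0] by eventually_elim (simp add: power_mult_distrib)
    ultimately show "(\<lambda>n. real (n choose i) * v n ^ i) \<longlonglongrightarrow> \<mu> ^ i / fact i"
      by (simp add: tendsto_cong)
    fix \<epsilon> :: real assume eps: "\<epsilon> > 0"
    show "\<forall>\<^sub>F n in sequentially. \<bar>binomial_moment n (P n) (K n) d i - real (n choose i) * v n ^ i\<bar> \<le> \<epsilon> * (real (n choose i) * v n ^ i)"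
      using adm prob_degree_event_asymptotic[OF c eps, of d i]
    proof eventually_elim
      case (elim n)
      have "K n \<le> P n" using elim(1) by (simp add: admissible_def)
      then show ?case unfolding v_def by (rule binomial_moment_bounds) (use elim in blast)
    qed
  qed
  define U where "U = (\<lambda>l. \<Sum>i\<le>l. (-1) ^ i * (\<mu> ^ i / fact i))"
  have Ul: "U \<longlonglongrightarrow> exp (- \<mu>)"
  proof -
    have "(\<lambda>i. (- \<mu>) ^ i / fact i) sums exp (- \<mu>)"
      using exp_converges[of "- \<mu>"] by (simp add: field_simps)
    then have "(\<lambda>l. \<Sum>i\<le>l. (- \<mu>) ^ i / fact i) \<longlonglongrightarrow> exp (- \<mu>)" by (simp add: sums_def_le)
    moreover have "(- \<mu>) ^ i / fact i = (-1) ^ i * (\<mu> ^ i / fact i)" for i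
      using power_minus[of \<mu> i] by simp
    ultimately show ?thesis unfolding U_def by simp
  qed
  have sums: "(\<lambda>n. \<Sum>i\<le>l. (-1) ^ i * binomial_moment n (P n) (K n) d i) \<longlonglongrightarrow> U l" for l
    unfolding U_def by (intro tendsto_sum tendsto_mult tendsto_const mom)
  have KP: "\<forall>\<^sub>F n in sequentially. K n \<le> P n" using adm by eventually_elim (simp add: admissible_def)
  show ?thesis
  proof (rule order_tendstoI)
    fix a assume a: "a < exp (- \<mu>)"
    have "\<forall>\<^sub>F l in sequentially. a < U l" using Ul a by (rule order_tendstoD)
    then obtain m where m: "a < U (Suc (2 * m))"
      unfolding eventually_sequentially by (metis le_SucI mult_2 trans_le_add1 order_refl)
    have "\<forall>\<^sub>F n in sequentially. a < (\<Sum>i\<le>Suc (2 * m). (-1) ^ i * binomial_moment n (P n) (K n) d i)"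
      using sums m by (rule order_tendstoD)
    with KP show "\<forall>\<^sub>F n in sequentially. a < measure_pmf.prob (objects_pmf {..<n} (P n) (K n)) {S. degree_count n d S = 0}"
    proof eventually_elim
      case (elim n)
      then show ?case using prob_degree_count_zero_bonferroni(2)[OF elim(1), where m = m and n = n and d = d] by linarith
    qed
  next
    fix a assume a: "exp (- \<mu>) < a"
    have "\<forall>\<^sub>F l in sequentially. U l < a" using Ul a by (rule order_tendstoD)
    then obtain m where m: "U (2 * m) < a"
      unfolding eventually_sequentially by (metis mult_2 trans_le_add1 order_refl)
    have "\<forall>\<^sub>F n in sequentially. (\<Sum>i\<le>2 * m. (-1) ^ i * binomial_moment n (P n) (K n) d i) < a"
      using sums m by (rule order_tendstoD)
    with KP show "\<forall>\<^sub>F n in sequentially. measure_pmf.prob (objects_pmf {..<n} (P n) (K n)) {S. degree_count n d S = 0} < a"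
    proof eventually_elim
      case (elim n)
      then show ?case using prob_degree_count_zero_bonferroni(1)[OF elim(1), where m = m and n = n and d = d] by linarith
    qed
  qed
qed

text \<open>Chebyshev's inequality for the count: \<open>2 * S2 + S1\<close> is its second moment,
  the right-hand side its variance, and at the value \<open>0\<close> the squared deviation from the
  mean is \<open>S1\<^sup>2\<close>.\<close>

lemma prob_degree_count_zero_second_moment:
  fixes n P K d :: nat
  assumes "K \<le> P"
  defines "S1 \<equiv> binomial_moment n P K d 1" and "S2 \<equiv> binomial_moment n P K d 2"
  shows "measure_pmf.prob (objects_pmf {..<n} P K) {S. degree_count n d S = 0} * S1\<^sup>2 \<le> 2 * S2 + S1 - S1\<^sup>2"
proof -
  let ?M = "objects_pmf {..<n} P K"
  let ?X = "\<lambda>S. real (degree_count n d S)"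
  have fM: "finite (set_pmf ?M)" by (rule finite_set_objects_pmf[OF assms(1)]) simp
  have "measure_pmf.prob ?M {S. degree_count n d S = 0} * S1\<^sup>2
      = expect ?M (\<lambda>S. of_bool (S \<in> {S. degree_count n d S = 0}) * S1\<^sup>2)"
    unfolding prob_eq_expect by simp
  also have "\<dots> \<le> expect ?M (\<lambda>S. (2 * real (degree_count n d S choose 2) + real (degree_count n d S choose 1))
      + (S1\<^sup>2 - 2 * S1 * real (degree_count n d S choose 1)))"
  proof (rule expect_mono[OF fM])
    fix S
    have "2 * real (x choose 2) = real x * (real x - 1)" for x :: nat
    proof (cases x)
      case (Suc y)
      have "even (x * (x - 1))" using Suc by simp
      then have "2 * (x choose 2) = x * (x - 1)" by (simp only: choose_two dvd_mult_div_cancel)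
      then have "real (2 * (x choose 2)) = real (x * (x - 1))" by presburger
      then show ?thesis using Suc by (simp add: algebra_simps)
    qed simp
    then have "(2 * real (degree_count n d S choose 2) + real (degree_count n d S choose 1))
      + (S1\<^sup>2 - 2 * S1 * real (degree_count n d S choose 1)) = (?X S - S1)\<^sup>2"
      by (simp add: power2_eq_square algebra_simps)
    then show "of_bool (S \<in> {S. degree_count n d S = 0}) * S1\<^sup>2 \<le>
      (2 * real (degree_count n d S choose 2) + real (degree_count n d S choose 1))
      + (S1\<^sup>2 - 2 * S1 * real (degree_count n d S choose 1))"
      by (cases "degree_count n d S = 0") auto
  qed
  also have "\<dots> = (2 * S2 + S1) + (S1\<^sup>2 - 2 * S1 * S1)"
    unfolding S1_def S2_def binomial_moment_def
    by (subst Bochner_Integration.integral_add Bochner_Integration.integral_diff;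
        (intro integrable_measure_pmf_finite fM)?)+ simp
  finally show ?thesis by (simp add: power2_eq_square)
qed

text \<open>The threshold \<open>T\<close> depends on \<epsilon> but not on \<open>P\<close> and
  \<open>K\<close>, so the statement applies to every \<open>n\<close> at which the expected count
  happens to be large, however fast it grows.\<close>

theorem degree_count_zero_unlikely:
  fixes c \<epsilon> :: real
  assumes c: "c > 0" and eps: "\<epsilon> > 0"
  shows "\<exists>T. \<forall>\<^sub>F n in sequentially. \<forall>P K. admissible c n P K \<and> (d = 0 \<or> 1 \<le> real n * ((real K)\<^sup>2 / real P)) \<and>
     T \<le> real n * degree_weight d (real n * ((real K)\<^sup>2 / real P)) \<longrightarrow>
     measure_pmf.prob (objects_pmf {..<n} P K) {S. degree_count n d S = 0} \<le> \<epsilon>"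
proof -
  \<comment> \<open>The variance is at most \<open>3 * \<delta> * T\<^sup>2 + 2 * T\<close> and the
    squared mean at least \<open>T\<^sup>2 / 4\<close>;
    \<open>\<delta> \<le> \<epsilon> / 24\<close> and \<open>T \<ge> 16 / \<epsilon>\<close> make
    each of the two terms at most half of the allowed
    \<open>\<epsilon> * T\<^sup>2 / 4\<close>.\<close>
  define \<delta> where "\<delta> = min (1/2) (\<epsilon> / 24)"
  have del: "0 < \<delta>" "\<delta> \<le> 1/2" "24 * \<delta> \<le> \<epsilon>" using eps by (auto simp: \<delta>_def)
  define T0 where "T0 = max 1 (16 / \<epsilon>)"
  have "\<forall>\<^sub>F n in sequentially. \<forall>P K. admissible c n P K \<and> (d = 0 \<or> 1 \<le> real n * ((real K)\<^sup>2 / real P)) \<and>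
     T0 \<le> real n * degree_weight d (real n * ((real K)\<^sup>2 / real P)) \<longrightarrow>
     measure_pmf.prob (objects_pmf {..<n} P K) {S. degree_count n d S = 0} \<le> \<epsilon>"
    using prob_degree_event_asymptotic[OF c del(1), of d 1] prob_degree_event_asymptotic[OF c del(1), of d 2]
  proof eventually_elim
    case (elim n)
    show ?case
    proof (intro allI impI)
      fix P K assume as: "admissible c n P K \<and> (d = 0 \<or> 1 \<le> real n * ((real K)\<^sup>2 / real P)) \<and>
        T0 \<le> real n * degree_weight d (real n * ((real K)\<^sup>2 / real P))"
      define v where "v = degree_weight d (real n * ((real K)\<^sup>2 / real P))"
      define T where "T = real n * v"
      have T: "T \<ge> 1" "T \<ge> 16 / \<epsilon>" using as by (auto simp: T_def v_def T0_def)
      have KP: "K \<le> P" using as by (simp add: admissible_def)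
      let ?p = "measure_pmf.prob (objects_pmf {..<n} P K) {S. degree_count n d S = 0}"
      define S1 where "S1 = binomial_moment n P K d 1"
      define S2 where "S2 = binomial_moment n P K d 2"
      have "\<bar>S1 - real (n choose 1) * v ^ 1\<bar> \<le> \<delta> * (real (n choose 1) * v ^ 1)"
        unfolding S1_def v_def by (rule binomial_moment_bounds[OF KP]) (use elim(1) as in blast)
      then have s1: "(1 - \<delta>) * T \<le> S1" "S1 \<le> (1 + \<delta>) * T" by (auto simp: T_def abs_le_iff algebra_simps)
      have "\<bar>S2 - real (n choose 2) * v ^ 2\<bar> \<le> \<delta> * (real (n choose 2) * v ^ 2)"
        unfolding S2_def v_def by (rule binomial_moment_bounds[OF KP]) (use elim(2) as in blast)
      then have "S2 \<le> (1 + \<delta>) * (real (n choose 2) * v\<^sup>2)" by (auto simp: abs_le_iff algebra_simps)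
      also have "\<dots> \<le> (1 + \<delta>) * (real n ^ 2 / 2 * v\<^sup>2)"
        using choose_le_power_fact[of n 2] del by (intro mult_left_mono mult_right_mono) auto
      also have "\<dots> = (1 + \<delta>) * T\<^sup>2 / 2" by (simp add: T_def power_mult_distrib)
      finally have s2: "2 * S2 \<le> (1 + \<delta>) * T\<^sup>2" by simp
      have sq: "(1 - 2 * \<delta>) * T\<^sup>2 \<le> S1\<^sup>2"
      proof -
        have "(1 - 2 * \<delta>) * T\<^sup>2 \<le> (1 - \<delta>)\<^sup>2 * T\<^sup>2" by (intro mult_right_mono) (auto simp: power2_eq_square algebra_simps)
        also have "\<dots> = ((1 - \<delta>) * T)\<^sup>2" by (simp add: power_mult_distrib)
        also have "\<dots> \<le> S1\<^sup>2" using s1 del T by (intro power_mono) auto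
        finally show ?thesis .
      qed
      have sq4: "T\<^sup>2 / 4 \<le> S1\<^sup>2"
      proof -
        have "(T / 2)\<^sup>2 \<le> S1\<^sup>2"
        proof (rule power_mono)
          have "(1/2) * T \<le> (1 - \<delta>) * T" using del T by (intro mult_right_mono) auto
          then show "T / 2 \<le> S1" using s1 by simp
        qed (use T in simp)
        then show ?thesis by (simp add: power_divide)
      qed
      have "?p * (T\<^sup>2 / 4) \<le> ?p * S1\<^sup>2" using sq4 by (intro mult_left_mono) auto
      also have "\<dots> \<le> 2 * S2 + S1 - S1\<^sup>2"
        unfolding S1_def S2_def by (rule prob_degree_count_zero_second_moment[OF KP])
      also have "\<dots> \<le> (1 + \<delta>) * T\<^sup>2 + (1 + \<delta>) * T - (1 - 2 * \<delta>) * T\<^sup>2" using s1 s2 sq by linarith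
      also have "\<dots> = 3 * \<delta> * T\<^sup>2 + (1 + \<delta>) * T" by (simp add: algebra_simps)
      also have "\<dots> \<le> 3 * \<delta> * T\<^sup>2 + 2 * T" using del T by (intro add_left_mono mult_right_mono) auto
      also have "2 * T \<le> (\<epsilon> / 8) * T\<^sup>2"
      proof -
        have "2 \<le> \<epsilon> / 8 * T" using T(2) eps by (simp add: field_simps)
        then have "2 * T \<le> \<epsilon> / 8 * T * T" using T by (intro mult_right_mono) auto
        then show ?thesis by (simp add: power2_eq_square)
      qed
      also have "3 * \<delta> * T\<^sup>2 + \<epsilon> / 8 * T\<^sup>2 \<le> \<epsilon> / 8 * T\<^sup>2 + \<epsilon> / 8 * T\<^sup>2"
        using del by (intro add_right_mono mult_right_mono) auto
      also have "\<dots> = \<epsilon> * (T\<^sup>2 / 4)" by simp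
      finally have "?p * (T\<^sup>2 / 4) \<le> \<epsilon> * (T\<^sup>2 / 4)" by simp
      then show "?p \<le> \<epsilon>" using T by (simp add: mult_le_cancel_right)
    qed
  qed
  then show ?thesis by blast
qed

lemma prob_small_degree_le:
  "\<forall>\<^sub>F n in sequentially. \<forall>P K. admissible c n P K \<longrightarrow>
     measure_pmf.prob (objects_pmf {..<n} P K) {S. \<exists>v<n. card (nbh n S {v}) \<le> q}
     \<le> 3 * (real n * (4 * ln (real n)) ^ q * exp (- (real n * ((real K)\<^sup>2 / real P))))"
proof -
  have e1: "\<forall>\<^sub>F n in sequentially. 3 * ln (real n) / real n * real (q + 1) \<le> 1" by real_asymp
  have e2: "\<forall>\<^sub>F n in sequentially. ln (real n) \<ge> 1" by real_asymp
  have e3: "\<forall>\<^sub>F n in sequentially. real n \<ge> real (q + 1)" by real_asymp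
  show ?thesis
    using e1 e2 e3
  proof eventually_elim
    case (elim n)
    show ?case
    proof (intro allI impI)
      fix P K assume as: "admissible c n P K"
      define L where "L = ln (real n)"
      define \<theta> where "\<theta> = (real K)\<^sup>2 / real P"
      have KP: "1 \<le> K" "K \<le> P" and lam: "real n * \<theta> \<le> 3 * L" using as by (auto simp: admissible_def L_def \<theta>_def)
      have L1: "L \<ge> 1" using elim by (simp add: L_def)
      have n0: "real n > 0" using L1 by (cases "n = 0") (auto simp: L_def)
      have th0: "\<theta> \<ge> 0" by (simp add: \<theta>_def)
      have thle: "\<theta> \<le> 3 * L / real n" using lam n0 by (simp add: field_simps)
      let ?M = "objects_pmf {..<n} P K"
      have "measure_pmf.prob ?M {S. \<exists>v<n. card (nbh n S {v}) \<le> q}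
          \<le> (\<Sum>v\<in>{..<n}. measure_pmf.prob ?M {S. card (nbh n S {v}) \<le> q})"
        by (rule prob_le_sum) auto
      also have "\<dots> \<le> (\<Sum>v\<in>{..<n}. (4 * L) ^ q * (3 * exp (- (real n * \<theta>))))"
      proof (rule sum_mono)
        fix v assume "v \<in> {..<n}"
        then have "measure_pmf.prob ?M {S. card (nbh n S {v}) \<le> q}
            \<le> (1 + real n * \<theta>) ^ q * exp (- (\<theta> * real (n - 1 - q)))"
          by (intro prob_single_small_nbh_le[OF KP _ \<theta>_def]) auto
        also have "\<dots> \<le> (4 * L) ^ q * (3 * exp (- (real n * \<theta>)))"
        proof (intro mult_mono power_mono)
          show "1 + real n * \<theta> \<le> 4 * L" using lam L1 by linarith
          have "\<theta> * real (q + 1) \<le> 3 * L / real n * real (q + 1)" using thle by (intro mult_right_mono) auto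
          then have "\<theta> * real (q + 1) \<le> 1" using elim(1)[folded L_def] by linarith
          moreover have "q + 1 \<le> n" using elim(3) unfolding of_nat_le_iff .
          then have "real (n - 1 - q) = real n - real (q + 1)" by (simp add: of_nat_diff)
          ultimately have "- (\<theta> * real (n - 1 - q)) \<le> 1 + - (real n * \<theta>)" by (simp add: algebra_simps)
          then have "exp (- (\<theta> * real (n - 1 - q))) \<le> exp 1 * exp (- (real n * \<theta>))" unfolding exp_add[symmetric] by simp
          also have "\<dots> \<le> 3 * exp (- (real n * \<theta>))" using exp_le by (intro mult_right_mono) auto
          finally show "exp (- (\<theta> * real (n - 1 - q))) \<le> 3 * exp (- (real n * \<theta>))" .
        qed (use th0 L1 in auto)
        finally show "measure_pmf.prob ?M {S. card (nbh n S {v}) \<le> q} \<le> (4 * L) ^ q * (3 * exp (- (real n * \<theta>)))" .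
      qed
      finally show "measure_pmf.prob ?M {S. \<exists>v<n. card (nbh n S {v}) \<le> q}
        \<le> 3 * (real n * (4 * ln (real n)) ^ q * exp (- (real n * ((real K)\<^sup>2 / real P))))"
        by (simp add: L_def \<theta>_def mult_ac)
    qed
  qed
qed

section \<open>Merging objects\<close>

lemma card_permutes_image: "p permutes S \<Longrightarrow> card (p ` A) = card A"
  by (metis card_image inj_on_subset permutes_inj subset_UNIV)

lemma permutes_object_sets:
  assumes "\<pi> permutes {..<P}"
  shows "\<pi> ` A \<in> object_sets P K \<longleftrightarrow> A \<in> object_sets P K"
proof -
  have "\<pi> ` A \<subseteq> {..<P} \<longleftrightarrow> A \<subseteq> {..<P}"
    using permutes_in_image[OF assms] by auto
  then show ?thesis by (simp add: object_sets_def card_permutes_image[OF assms])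
qed

lemma permutation_between:
  assumes "A \<in> object_sets P K" "A' \<in> object_sets P K"
  shows "\<exists>\<pi>. \<pi> permutes {..<P} \<and> \<pi> ` A = A'"
proof -
  have A: "A \<subseteq> {..<P}" "A' \<subseteq> {..<P}" "card A = card A'" using assms by (auto simp: object_sets_def)
  have fin: "finite A" "finite A'" using A finite_subset by auto
  obtain f where f: "bij_betw f A A'" using fin A by (meson finite_same_card_bij)
  have "card ({..<P} - A) = card ({..<P} - A')" using A fin by (simp add: card_Diff_subset)
  then obtain g where g: "bij_betw g ({..<P} - A) ({..<P} - A')" by (meson finite_Diff finite_lessThan finite_same_card_bij)
  define \<pi> where "\<pi> = (\<lambda>x. if x \<in> A then f x else if x < P then g x else x)"
  have 1: "bij_betw \<pi> A A'" using f by (simp add: bij_betw_def \<pi>_def inj_on_def)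
  have 2: "bij_betw \<pi> ({..<P} - A) ({..<P} - A')"
    using g by (rule bij_betw_cong[THEN iffD1, rotated]) (auto simp: \<pi>_def)
  have "bij_betw \<pi> (A \<union> ({..<P} - A)) (A' \<union> ({..<P} - A'))" by (rule bij_betw_combine[OF 1 2]) auto
  moreover have "A \<union> ({..<P} - A) = {..<P}" "A' \<union> ({..<P} - A') = {..<P}" using A by auto
  ultimately have "bij_betw \<pi> {..<P} {..<P}" by simp
  then have "\<pi> permutes {..<P}" by (rule bij_imp_permutes) (use A in \<open>auto simp: \<pi>_def\<close>)
  then show ?thesis using 1 by (auto simp: bij_betw_def)
qed

text \<open>
  Reducing the objects of a pool of size \<open>M * P\<close> modulo \<open>P\<close> turns a \<open>K\<close>-set into a set of at most
  \<open>K\<close> objects, which is completed to a \<open>K\<close>-set uniformly at random.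
\<close>

definition complete_pmf :: "nat \<Rightarrow> nat \<Rightarrow> nat set \<Rightarrow> nat set pmf" where
  "complete_pmf P K T = pmf_of_set {A \<in> object_sets P K. (\<lambda>w. w mod P) ` T \<subseteq> A}"

lemma completions_nonempty:
  assumes "1 \<le> K" "K \<le> P" "finite T" "card T = K"
  shows "{A \<in> object_sets P K. (\<lambda>w. w mod P) ` T \<subseteq> A} \<noteq> {}"
proof -
  have sub: "(\<lambda>w. w mod P) ` T \<subseteq> {..<P}" using assms by auto
  have "card ((\<lambda>w. w mod P) ` T) \<le> K" using card_image_le[OF assms(3)] assms(4) by metis
  then obtain C where "(\<lambda>w. w mod P) ` T \<subseteq> C" "C \<subseteq> {..<P}" "card C = K"
    using exists_subset_between[OF _ _ sub, of K] assms by auto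
  then show ?thesis by (auto simp: object_sets_def)
qed

text \<open>Symmetry replaces a computation: the resulting distribution is invariant under all
  permutations of the pool, and these act transitively on \<open>K\<close>-sets, so it is constant
  on them.\<close>

lemma bind_complete_pmf:
  assumes KP: "1 \<le> K" "K \<le> P" and M: "M \<ge> 1"
  shows "bind_pmf (object_pmf (M * P) K) (complete_pmf P K) = object_pmf P K" (is "?D = _")
proof -
  let ?h = "\<lambda>w. w mod P"
  have P0: "P > 0" using KP by simp
  have KMP: "K \<le> M * P" using KP M by (metis le_trans mult_le_mono1 mult_1)
  have T: "finite T" "card T = K" if "T \<in> object_sets (M * P) K" for T
    using that by (auto simp: object_sets_def intro: finite_subset)
  have sD: "set_pmf ?D \<subseteq> object_sets P K"
  proof
    fix A assume "A \<in> set_pmf ?D"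
    then obtain X where X: "X \<in> object_sets (M * P) K" "A \<in> set_pmf (complete_pmf P K X)"
      unfolding set_bind_pmf set_object_pmf[OF KMP] by blast
    then show "A \<in> object_sets P K"
      unfolding complete_pmf_def using set_pmf_of_set[OF completions_nonempty[OF KP T[OF X(1)]]] by auto
  qed
  have inv: "map_pmf (image \<pi>) ?D = ?D" if pi: "\<pi> permutes {..<P}" for \<pi>
  proof -
    \<comment> \<open>The lift of \<pi> to the larger pool permutes the residues and keeps the block
      \<open>w div P\<close>. It preserves the uniform distribution there, and reduction modulo
      \<open>P\<close> intertwines it with \<pi>.\<close>
    define \<rho> where "\<rho> = (\<lambda>w. (w div P) * P + \<pi> (w mod P))"
    have piP: "\<pi> (w mod P) < P" for w using permutes_in_image[OF pi] P0 by auto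
    have rd: "\<rho> w div P = w div P" "\<rho> w mod P = \<pi> (w mod P)" for w
      using piP[of w] P0 by (auto simp: \<rho>_def)
    have inj: "inj \<rho>"
    proof (rule injI)
      fix v w assume e: "\<rho> v = \<rho> w"
      then have "v div P = w div P" "\<pi> (v mod P) = \<pi> (w mod P)" using rd by metis+
      then have "v mod P = w mod P" using permutes_inj[OF pi] by (metis injD)
      then show "v = w" using \<open>v div P = w div P\<close> by (metis div_mult_mod_eq)
    qed
    have rM: "\<rho> w < M * P \<longleftrightarrow> w < M * P" for w
      using rd(1)[of w] P0 by (metis div_less_iff_less_mult)
    have imgT: "\<rho> ` X \<in> object_sets (M * P) K" if "X \<in> object_sets (M * P) K" for X
      using that rM card_image[OF inj_on_subset[OF inj subset_UNIV], of X]
      by (auto simp: object_sets_def)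
    have "inj_on (image \<rho>) (object_sets (M * P) K)"
      by (intro inj_onI) (simp add: inj_image_eq_iff[OF inj])
    then have "bij_betw (image \<rho>) (object_sets (M * P) K) (object_sets (M * P) K)"
      unfolding bij_betw_def using imgT by (intro conjI endo_inj_surj) auto
    then have r1: "map_pmf (image \<rho>) (object_pmf (M * P) K) = object_pmf (M * P) K"
      by (rule map_pmf_of_set_bij_betw) (simp_all add: object_sets_nonempty[OF KMP])
    have r2: "map_pmf (image \<pi>) (complete_pmf P K X) = complete_pmf P K (\<rho> ` X)"
      if X: "X \<in> object_sets (M * P) K" for X
      unfolding complete_pmf_def
    proof (rule map_pmf_of_set_bij_betw)
      have hr: "?h ` \<rho> ` X = \<pi> ` (?h ` X)" using rd(2) by (auto simp: image_image)
      show "bij_betw (image \<pi>) {A \<in> object_sets P K. ?h ` X \<subseteq> A} {A \<in> object_sets P K. ?h ` \<rho> ` X \<subseteq> A}"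
      proof (rule bij_betw_imageI)
        show "inj_on (image \<pi>) {A \<in> object_sets P K. ?h ` X \<subseteq> A}"
          by (intro inj_onI) (simp add: inj_image_eq_iff[OF permutes_inj[OF pi]])
        show "image \<pi> ` {A \<in> object_sets P K. ?h ` X \<subseteq> A} = {A \<in> object_sets P K. ?h ` \<rho> ` X \<subseteq> A}"
        proof (intro equalityI subsetI)
          fix B assume "B \<in> image \<pi> ` {A \<in> object_sets P K. ?h ` X \<subseteq> A}"
          then show "B \<in> {A \<in> object_sets P K. ?h ` \<rho> ` X \<subseteq> A}"
            unfolding hr using permutes_object_sets[OF pi] by auto
        next
          fix B assume B: "B \<in> {A \<in> object_sets P K. ?h ` \<rho> ` X \<subseteq> A}"
          define A where "A = inv \<pi> ` B"
          have AB: "\<pi> ` A = B" using permutes_surj[OF pi] by (simp add: A_def image_f_inv_f)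
          have "A \<in> object_sets P K" using permutes_object_sets[OF pi, of A K] AB B by simp
          moreover have "\<pi> ` (?h ` X) \<subseteq> \<pi> ` A" using B unfolding hr AB by simp
          then have "?h ` X \<subseteq> A" using inj_image_subset_iff[OF permutes_inj[OF pi]] by blast
          ultimately show "B \<in> image \<pi> ` {A \<in> object_sets P K. ?h ` X \<subseteq> A}" using AB by blast
        qed
      qed
    qed (use completions_nonempty[OF KP T[OF X]] in auto)
    have "map_pmf (image \<pi>) ?D = bind_pmf (object_pmf (M * P) K) (\<lambda>X. map_pmf (image \<pi>) (complete_pmf P K X))"
      by (simp add: map_bind_pmf)
    also have "\<dots> = bind_pmf (object_pmf (M * P) K) (\<lambda>X. complete_pmf P K (\<rho> ` X))"
      using r2 set_object_pmf[OF KMP] by (intro bind_pmf_cong) auto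
    also have "\<dots> = bind_pmf (map_pmf (image \<rho>) (object_pmf (M * P) K)) (complete_pmf P K)"
      by (simp add: bind_map_pmf)
    finally show ?thesis unfolding r1 .
  qed
  have const: "pmf ?D A = pmf ?D B" if AB: "A \<in> object_sets P K" "B \<in> object_sets P K" for A B
  proof -
    obtain \<pi> where pi: "\<pi> permutes {..<P}" "\<pi> ` A = B" using permutation_between[OF AB] by blast
    have "inj (image \<pi>)" by (intro injI) (simp add: inj_image_eq_iff[OF permutes_inj[OF pi(1)]])
    then have "pmf (map_pmf (image \<pi>) ?D) (\<pi> ` A) = pmf ?D A" by (rule pmf_map_inj')
    then show ?thesis unfolding inv[OF pi(1)] pi(2) by simp
  qed
  have sum1: "(\<Sum>B\<in>object_sets P K. pmf ?D B) = 1" by (rule sum_pmf_eq_1) (use sD in auto)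
  show ?thesis
  proof (rule pmf_eqI)
    fix A
    show "pmf ?D A = pmf (object_pmf P K) A"
    proof (cases "A \<in> object_sets P K")
      case True
      have "(\<Sum>B\<in>object_sets P K. pmf ?D B) = (\<Sum>B\<in>object_sets P K. pmf ?D A)"
        by (rule sum.cong[OF refl]) (use const True in blast)
      then have "real (card (object_sets P K)) * pmf ?D A = 1" using sum1 by simp
      then have "pmf ?D A = 1 / real (card (object_sets P K))"
        by (cases "real (card (object_sets P K)) = 0") (simp_all add: field_simps)
      then show ?thesis using True by (simp only: pmf_of_set[OF object_sets_nonempty[OF KP(2)] finite_object_sets]) simp
    next
      case False
      then have "pmf ?D A = 0" using sD by (auto simp: set_pmf_eq)
      then show ?thesis using False object_sets_nonempty[OF KP(2)] by simp
    qed
  qed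
qed

lemma intersection_edges_mono:
  assumes "\<And>i. i < n \<Longrightarrow> h ` S i \<subseteq> S' i"
  shows "intersection_edges n S \<subseteq> intersection_edges n S'"
proof
  fix e assume "e \<in> intersection_edges n S"
  then obtain i j x where e: "e = {i, j}" "i < n" "j < n" "i \<noteq> j" "x \<in> S i" "x \<in> S j"
    by (auto simp: intersection_edges_def)
  then have "h x \<in> S' i \<inter> S' j" using assms by blast
  then show "e \<in> intersection_edges n S'" using e by (auto simp: intersection_edges_def)
qed

text \<open>A coupling: object sets from the larger pool are reduced modulo \<open>P\<close> and
  completed. Common objects stay common, so the graph can only gain edges, and increasing properties
  become more likely.\<close>

theorem prob_mono_merge_objects:
  assumes KP: "1 \<le> K" "K \<le> P" and M: "M \<ge> 1"
    and mono: "\<And>E E'. \<phi> E \<Longrightarrow> E \<subseteq> E' \<Longrightarrow> \<phi> E'"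
  shows "measure_pmf.prob (objects_pmf {..<n} (M * P) K) {S. \<phi> (intersection_edges n S)}
    \<le> measure_pmf.prob (objects_pmf {..<n} P K) {S. \<phi> (intersection_edges n S)}"
proof -
  have KMP: "K \<le> M * P" using KP M by (metis le_trans mult_le_mono1 mult_1)
  let ?M1 = "objects_pmf {..<n} (M * P) K"
  let ?N = "\<lambda>f. Pi_pmf {..<n} {} (\<lambda>i. complete_pmf P K (f i))"
  have "objects_pmf {..<n} P K = bind_pmf ?M1 ?N"
    using Pi_pmf_bind[of "{..<n}" "{}" "\<lambda>_. object_pmf (M * P) K" "\<lambda>_. complete_pmf P K" "{}"]
    by (simp add: bind_complete_pmf[OF KP M])
  then have "ennreal (measure_pmf.prob (objects_pmf {..<n} P K) {S. \<phi> (intersection_edges n S)})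
      = (\<integral>\<^sup>+f. emeasure (?N f) {S. \<phi> (intersection_edges n S)} \<partial>?M1)"
    by (simp add: measure_pmf.emeasure_eq_measure[symmetric])
  also have "\<dots> \<ge> (\<integral>\<^sup>+f. indicator {S. \<phi> (intersection_edges n S)} f \<partial>?M1)"
  proof (rule nn_integral_mono_AE, unfold AE_measure_pmf_iff, rule ballI)
    fix f assume f: "f \<in> set_pmf ?M1"
    show "indicator {S. \<phi> (intersection_edges n S)} f \<le> emeasure (?N f) {S. \<phi> (intersection_edges n S)}"
    proof (cases "\<phi> (intersection_edges n f)")
      case True
      have "AE S in ?N f. \<phi> (intersection_edges n S)"
        unfolding AE_measure_pmf_iff
      proof
        fix S assume S: "S \<in> set_pmf (?N f)"
        have "(\<lambda>w. w mod P) ` f i \<subseteq> S i" if "i < n" for i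
        proof -
          have "f i \<in> object_sets (M * P) K"
            using set_Pi_pmf_component[OF finite_lessThan f] that set_object_pmf[OF KMP] by auto
          then have fi: "finite (f i)" "card (f i) = K" by (auto simp: object_sets_def intro: finite_subset)
          have "S i \<in> set_pmf (complete_pmf P K (f i))"
            using set_Pi_pmf_component[OF finite_lessThan S] that by auto
          then show ?thesis unfolding complete_pmf_def
            using set_pmf_of_set[OF completions_nonempty[OF KP fi]] by auto
        qed
        then have "intersection_edges n f \<subseteq> intersection_edges n S" by (rule intersection_edges_mono)
        then show "\<phi> (intersection_edges n S)" using mono True by blast
      qed
      then have "emeasure (?N f) {S. \<phi> (intersection_edges n S)} = 1"
        by (intro measure_pmf.emeasure_eq_1_AE) auto
      then show ?thesis using True by simp
    qed simp
  qed
  finally have "emeasure ?M1 {S. \<phi> (intersection_edges n S)}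
      \<le> ennreal (measure_pmf.prob (objects_pmf {..<n} P K) {S. \<phi> (intersection_edges n S)})" by simp
  then show ?thesis by (simp add: measure_pmf.emeasure_eq_measure)
qed

section \<open>The limits\<close>

lemma prob_uniform_rig:
  "measure_pmf.prob (uniform_rig n P K) {E. \<phi> E} = measure_pmf.prob (objects_pmf {..<n} P K) {S. \<phi> (intersection_edges n S)}"
  by (simp add: uniform_rig_def object_sets_def vimage_def)

lemma min_degree_intersection_edges:
  assumes "n \<ge> 1"
  shows "min_degree {..<n} (intersection_edges n S) \<ge> k \<longleftrightarrow> (\<forall>v<n. k \<le> card (nbh n S {v}))"
  using min_degree_ge_iff[OF assms] by (auto simp: node_degree_intersection_edges)

lemma k_connected_imp_nbh:
  assumes "n \<ge> 2" "k_connected k {..<n} (intersection_edges n S)" "v < n"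
  shows "k \<le> card (nbh n S {v})"
  using k_connected_imp_node_degree[OF _ _ assms(2), of v] assms node_degree_intersection_edges[of v n S] by simp

lemma tendsto_zero_of_eventually_le:
  fixes f :: "nat \<Rightarrow> real"
  assumes "\<And>n. 0 \<le> f n" "\<And>\<epsilon>. \<epsilon> > 0 \<Longrightarrow> \<forall>\<^sub>F n in sequentially. f n \<le> \<epsilon>"
  shows "f \<longlonglongrightarrow> 0"
proof (rule tendstoI)
  fix e :: real assume "e > 0"
  then have "e / 2 > 0" by simp
  from assms(2)[OF this] show "\<forall>\<^sub>F n in sequentially. dist (f n) 0 < e"
  proof eventually_elim
    case (elim n)
    then show ?case using assms(1)[of n] \<open>e > 0\<close> by (simp add: dist_real_def)
  qed
qed

text \<open>Failure means that some node has degree below \<open>k\<close>, or that the minimum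
  degree is sufficient and connectivity still fails; each case takes one half of \<epsilon>.\<close>

lemma prob_k_connected_ge:
  fixes c \<epsilon> :: real
  assumes c: "c > 0" and eps: "\<epsilon> > 0" and k: "k \<ge> 1"
  shows "\<forall>\<^sub>F n in sequentially. \<forall>P K. admissible c n P K \<and> ln (real n) \<le> real n * ((real K)\<^sup>2 / real P) \<and>
     3 * (real n * (4 * ln (real n)) ^ (k - 1) * exp (- (real n * ((real K)\<^sup>2 / real P)))) \<le> \<epsilon> / 2 \<longrightarrow>
     1 - \<epsilon> \<le> measure_pmf.prob (objects_pmf {..<n} P K) {S. k_connected k {..<n} (intersection_edges n S)}"
proof -
  have eps2: "\<epsilon> / 2 > 0" using eps by simp
  show ?thesis
    using min_degree_imp_k_connected_asymptotically[OF c eps2 k, of 0] prob_small_degree_le[of c "k - 1"]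
  proof eventually_elim
    case (elim n)
    show ?case
    proof (intro allI impI)
      fix P K assume as: "admissible c n P K \<and> ln (real n) \<le> real n * ((real K)\<^sup>2 / real P) \<and>
        3 * (real n * (4 * ln (real n)) ^ (k - 1) * exp (- (real n * ((real K)\<^sup>2 / real P)))) \<le> \<epsilon> / 2"
      let ?M = "objects_pmf {..<n} P K"
      let ?C = "{S. k_connected k {..<n} (intersection_edges n S)}"
      let ?B = "{S. (\<forall>v<n. k \<le> card (nbh n S {v})) \<and> \<not> k_connected k {..<n} (intersection_edges n S)}"
      let ?D = "{S. \<exists>v<n. card (nbh n S {v}) \<le> k - 1}"
      have "1 = measure_pmf.prob ?M UNIV" by simp
      also have "\<dots> \<le> measure_pmf.prob ?M (?C \<union> (?B \<union> ?D))"
        by (rule prob_mono) (use k in \<open>auto simp: not_le\<close>)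
      also have "\<dots> \<le> measure_pmf.prob ?M ?C + (measure_pmf.prob ?M ?B + measure_pmf.prob ?M ?D)"
        by (intro order_trans[OF measure_Un_le] add_mono order_refl) auto
      also have "measure_pmf.prob ?M ?B \<le> \<epsilon> / 2" using elim(1) as by simp
      also have "measure_pmf.prob ?M ?D \<le> \<epsilon> / 2" using elim(2) as by (meson order_trans)
      finally show "1 - \<epsilon> \<le> measure_pmf.prob ?M ?C" by simp
    qed
  qed
qed

text \<open>
  If \<open>n K\<^sup>2 / P\<close> exceeds \<open>3 ln n\<close>, merging objects allows to replace \<open>P\<close> by the multiple \<open>M * P\<close>
  for which it lies between \<open>1.5 ln n\<close> and \<open>3 ln n\<close>.
\<close>

lemma prob_k_connected_dense_ge:
  fixes c \<epsilon> :: real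
  assumes c: "c > 0" and eps: "\<epsilon> > 0" and k: "k \<ge> 1"
  shows "\<forall>\<^sub>F n in sequentially. \<forall>P K. 1 \<le> K \<and> K \<le> P \<and> c * sqrt (ln (real n)) \<le> real K \<and>
      3 * ln (real n) < real n * ((real K)\<^sup>2 / real P) \<longrightarrow>
     1 - \<epsilon> \<le> measure_pmf.prob (objects_pmf {..<n} P K) {S. k_connected k {..<n} (intersection_edges n S)}"
proof -
  have e1: "\<forall>\<^sub>F n in sequentially. ln (real n) \<ge> 1" by real_asymp
  \<comment> \<open>The lower end \<open>3/2 * ln n\<close> of the window makes
    \<open>n * exp (- (3/2 * ln n))\<close> a negative power of \<open>n\<close>, which defeats the
    power of \<open>ln n\<close>.\<close>
  have e2: "\<forall>\<^sub>F n in sequentially. 3 * (real n * (4 * ln (real n)) ^ (k - 1) * exp (- (3/2 * ln (real n)))) \<le> \<epsilon> / 2"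
    using eps by real_asymp
  show ?thesis
    using e1 e2 prob_k_connected_ge[OF assms]
  proof eventually_elim
    case (elim n)
    show ?case
    proof (intro allI impI)
      fix P K assume as: "1 \<le> K \<and> K \<le> P \<and> c * sqrt (ln (real n)) \<le> real K \<and>
        3 * ln (real n) < real n * ((real K)\<^sup>2 / real P)"
      define L where "L = ln (real n)"
      define x where "x = real n * ((real K)\<^sup>2 / real P)"
      have L1: "L \<ge> 1" using elim by (simp add: L_def)
      have x3: "3 * L < x" using as by (simp add: L_def x_def)
      \<comment> \<open>The quotient exceeds \<open>2\<close>, so rounding it down costs at most a
        factor \<open>2\<close>, exactly the ratio of the two ends of the window.\<close>
      define M where "M = nat \<lfloor>x / (3/2 * L)\<rfloor>"
      have "2 < x / (3/2 * L)" using x3 L1 by (simp add: field_simps)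
      then have M1: "real M \<le> x / (3/2 * L)" "x / (3/2 * L) - 1 \<le> real M" "1 \<le> M"
        unfolding M_def by linarith+
      have M0: "real M > 0" using M1 by simp
      have up: "x / real M \<le> 3 * L"
      proof -
        define z where "z = x / (3 * L)"
        have eq: "x / (3/2 * L) = 2 * z" by (simp add: z_def)
        have "1 \<le> z" using x3 L1 by (simp add: z_def field_simps)
        then have "z \<le> real M" using M1(2) unfolding eq by linarith
        then show ?thesis using M0 L1 by (simp add: z_def field_simps)
      qed
      have lo: "3/2 * L \<le> x / real M" using M1(1) M0 L1 by (simp add: field_simps)
      have x': "real n * ((real K)\<^sup>2 / real (M * P)) = x / real M" by (simp add: x_def)
      have P': "P \<le> M * P" using M1(3) by simp
      have "admissible c n (M * P) K"
        unfolding admissible_def x' using as up P' by (auto simp: L_def intro: order_trans)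
      moreover have "ln (real n) \<le> real n * ((real K)\<^sup>2 / real (M * P))" unfolding x' L_def[symmetric] using lo L1 by linarith
      moreover have "3 * (real n * (4 * ln (real n)) ^ (k - 1) * exp (- (real n * ((real K)\<^sup>2 / real (M * P))))) \<le> \<epsilon> / 2"
      proof -
        have "3 * (real n * (4 * ln (real n)) ^ (k - 1) * exp (- (real n * ((real K)\<^sup>2 / real (M * P)))))
            \<le> 3 * (real n * (4 * ln (real n)) ^ (k - 1) * exp (- (3/2 * ln (real n))))"
          unfolding x' using lo L1 by (intro mult_left_mono) (auto simp: L_def)
        then show ?thesis using elim(2) by linarith
      qed
      ultimately have "1 - \<epsilon> \<le> measure_pmf.prob (objects_pmf {..<n} (M * P) K) {S. k_connected k {..<n} (intersection_edges n S)}"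
        using elim(3) by blast
      also have "\<dots> \<le> measure_pmf.prob (objects_pmf {..<n} P K) {S. k_connected k {..<n} (intersection_edges n S)}"
        using as M1(3) k_connected_mono by (intro prob_mono_merge_objects) blast+
      finally show "1 - \<epsilon> \<le> measure_pmf.prob (objects_pmf {..<n} P K) {S. k_connected k {..<n} (intersection_edges n S)}" .
    qed
  qed
qed

theorem theorem2:
  fixes k :: nat and P K :: "nat \<Rightarrow> nat" and \<alpha> :: "nat \<Rightarrow> real"
  assumes "k \<ge> 1"
    and "\<And>n. n \<ge> 1 \<Longrightarrow> 1 \<le> K n \<and> K n \<le> P n"
    and "\<And>n. n \<ge> 2 \<Longrightarrow>
           (real (K n))\<^sup>2 / real (P n) =
             (ln (real n) + (real k - 1) * ln (ln (real n)) + \<alpha> n) / real n"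
    and "(\<lambda>n. real (K n)) \<in> \<Omega>(\<lambda>n. sqrt (ln (real n)))"
  shows
    "((filterlim \<alpha> at_bot sequentially \<longrightarrow>
        (\<lambda>n. measure_pmf.prob (uniform_rig n (P n) (K n)) {E. k_connected k {..<n} E})
          \<longlonglongrightarrow> 0) \<and>
      (filterlim \<alpha> at_top sequentially \<longrightarrow>
        (\<lambda>n. measure_pmf.prob (uniform_rig n (P n) (K n)) {E. k_connected k {..<n} E})
          \<longlonglongrightarrow> 1) \<and>
      (\<forall>a::real. \<alpha> \<longlonglongrightarrow> a \<longrightarrow>
        (\<lambda>n. measure_pmf.prob (uniform_rig n (P n) (K n)) {E. k_connected k {..<n} E})
          \<longlonglongrightarrow> exp (- (exp (- a) / fact (k - 1))))) \<and>
     ((filterlim \<alpha> at_bot sequentially \<longrightarrow>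
        (\<lambda>n. measure_pmf.prob (uniform_rig n (P n) (K n)) {E. min_degree {..<n} E \<ge> k})
          \<longlonglongrightarrow> 0) \<and>
      (filterlim \<alpha> at_top sequentially \<longrightarrow>
        (\<lambda>n. measure_pmf.prob (uniform_rig n (P n) (K n)) {E. min_degree {..<n} E \<ge> k})
          \<longlonglongrightarrow> 1) \<and>
      (\<forall>a::real. \<alpha> \<longlonglongrightarrow> a \<longrightarrow>
        (\<lambda>n. measure_pmf.prob (uniform_rig n (P n) (K n)) {E. min_degree {..<n} E \<ge> k})
          \<longlonglongrightarrow> exp (- (exp (- a) / fact (k - 1)))))"
proof -
  define q where "q = k - 1"
  have kq: "k = Suc q" using assms(1) by (simp add: q_def)
  define M where "M = (\<lambda>n. objects_pmf {..<n} (P n) (K n))"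
  define C where "C = (\<lambda>n. measure_pmf.prob (M n) {S. k_connected k {..<n} (intersection_edges n S)})"
  define D where "D = (\<lambda>n. measure_pmf.prob (M n) {S. \<forall>v<n. k \<le> card (nbh n S {v})})"
  define x where "x = (\<lambda>n. real n * ((real (K n))\<^sup>2 / real (P n)))"
  obtain c where c: "c > 0" and Kc0: "\<forall>\<^sub>F n in sequentially. c * norm (sqrt (ln (real n))) \<le> norm (real (K n))"
    using assms(4) by (elim landau_omega.bigE)
  have Kc: "\<forall>\<^sub>F n in sequentially. c * sqrt (ln (real n)) \<le> real (K n)"
    using Kc0 eventually_ge_at_top[of 1] by eventually_elim simp
  have KP: "\<forall>\<^sub>F n in sequentially. 1 \<le> K n \<and> K n \<le> P n"
    using eventually_ge_at_top[of 1] by eventually_elim (rule assms(2))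
  have x_eq: "\<forall>\<^sub>F n in sequentially. x n = ln (real n) + real q * ln (ln (real n)) + \<alpha> n"
    using eventually_ge_at_top[of 2]
  proof eventually_elim
    case (elim n)
    have "real k - 1 = real q" by (simp add: kq)
    then show ?case unfolding x_def assms(3)[OF elim] using elim by simp
  qed
  have L1: "\<forall>\<^sub>F n in sequentially. ln (real n) \<ge> 1" by real_asymp
  \<comment> \<open>This identity is the origin of the parametrisation by \<alpha>: once
    \<open>x n\<close> is asymptotic to \<open>ln n\<close>, it says that the expected number of
    nodes of degree \<open>q = k - 1\<close> is close to
    \<open>exp (- \<alpha> n) / fact q\<close>.\<close>
  have exp_x: "\<forall>\<^sub>F n in sequentially. real n * ln (real n) ^ q * exp (- x n) = exp (- \<alpha> n)"
    using x_eq L1 eventually_ge_at_top[of 2]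
  proof eventually_elim
    case (elim n)
    have "exp (- x n) = exp (- \<alpha> n) / (exp (ln (real n)) * exp (real q * ln (ln (real n))))"
      unfolding elim(1) by (simp add: exp_add[symmetric] exp_diff[symmetric])
    also have "exp (real q * ln (ln (real n))) = ln (real n) ^ q" using elim(2) by (simp add: exp_of_nat_mult)
    finally show ?case using elim by simp
  qed
  have admI: "\<forall>\<^sub>F n in sequentially. admissible c n (P n) (K n)"
    if "\<forall>\<^sub>F n in sequentially. x n \<le> 3 * ln (real n)"
    using that KP Kc by eventually_elim (simp add: admissible_def x_def)
  have C01: "0 \<le> C n" "C n \<le> 1" "0 \<le> D n" "D n \<le> 1" for n by (auto simp: C_def D_def)
  have CD: "\<forall>\<^sub>F n in sequentially. C n \<le> D n"
    using eventually_ge_at_top[of 2]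
  proof eventually_elim
    case (elim n)
    then show ?case unfolding C_def D_def by (intro prob_mono) (auto intro: k_connected_imp_nbh)
  qed
  have eqC: "(\<lambda>n. measure_pmf.prob (uniform_rig n (P n) (K n)) {E. k_connected k {..<n} E}) = C"
    by (simp add: C_def M_def prob_uniform_rig)
  have eqD: "\<forall>\<^sub>F n in sequentially. measure_pmf.prob (uniform_rig n (P n) (K n)) {E. min_degree {..<n} E \<ge> k} = D n"
    using eventually_ge_at_top[of 1]
  proof eventually_elim
    case (elim n)
    show ?case unfolding prob_uniform_rig D_def M_def min_degree_intersection_edges[OF elim] ..
  qed
  note limD = tendsto_cong[OF eqD]

  \<comment> \<open>There is no lower bound for \<open>x n\<close> here. If \<open>x n < 1\<close>,
    isolated nodes abound. Otherwise nodes of degree \<open>q\<close> do: for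
    \<open>x n \<le> ln n / 2\<close> because \<open>n * exp (- x n)\<close> is at least of order
    \<open>\<surd>n\<close>, and beyond that because \<open>x n ^ q\<close> is comparable with
    \<open>ln n ^ q\<close>.\<close>
  have bot: "D \<longlonglongrightarrow> 0" if al: "filterlim \<alpha> at_bot sequentially"
  proof (rule tendsto_zero_of_eventually_le)
    fix \<epsilon> :: real assume eps: "\<epsilon> > 0"
    have e1: "\<forall>\<^sub>F n in sequentially. \<alpha> n \<le> 0" using al by (simp add: filterlim_at_bot)
    have e2: "\<forall>\<^sub>F n in sequentially. ln (real n) + real q * ln (ln (real n)) \<le> 3 * ln (real n)" by real_asymp
    have "\<forall>\<^sub>F n in sequentially. x n \<le> 3 * ln (real n)"
      using e1 e2 x_eq by eventually_elim linarith
    note adm = admI[OF this]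
    obtain T0 where T0: "\<forall>\<^sub>F n in sequentially. \<forall>P K. admissible c n P K \<and> ((0::nat) = 0 \<or> 1 \<le> real n * ((real K)\<^sup>2 / real P)) \<and>
       T0 \<le> real n * degree_weight 0 (real n * ((real K)\<^sup>2 / real P)) \<longrightarrow>
       measure_pmf.prob (objects_pmf {..<n} P K) {S. degree_count n 0 S = 0} \<le> \<epsilon>"
      using degree_count_zero_unlikely[OF c eps] by blast
    obtain T1 where T1: "\<forall>\<^sub>F n in sequentially. \<forall>P K. admissible c n P K \<and> (q = 0 \<or> 1 \<le> real n * ((real K)\<^sup>2 / real P)) \<and>
       T1 \<le> real n * degree_weight q (real n * ((real K)\<^sup>2 / real P)) \<longrightarrow>
       measure_pmf.prob (objects_pmf {..<n} P K) {S. degree_count n q S = 0} \<le> \<epsilon>"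
      using degree_count_zero_unlikely[OF c eps] by blast
    have e3: "\<forall>\<^sub>F n in sequentially. T0 \<le> real n * exp (-1)" by real_asymp
    have e4: "\<forall>\<^sub>F n in sequentially. T1 * fact q \<le> real n * exp (- (ln (real n) / 2))" by real_asymp
    have "filterlim (\<lambda>n. exp (- \<alpha> n)) at_top sequentially"
      by (rule filterlim_compose[OF exp_at_top]) (use al in \<open>simp add: filterlim_uminus_at_top\<close>)
    then have e5: "\<forall>\<^sub>F n in sequentially. T1 * fact q * 2 ^ q \<le> exp (- \<alpha> n)" by (simp add: filterlim_at_top)
    have cover: "D n \<le> measure_pmf.prob (M n) {S. degree_count n d S = 0}" if "d < k" for d n
      unfolding D_def by (intro prob_mono) (use that in \<open>fastforce simp: degree_count_def\<close>)
    show "\<forall>\<^sub>F n in sequentially. D n \<le> \<epsilon>"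
      using adm T0 T1 e3 e4 e5 exp_x L1
    proof eventually_elim
      case (elim n)
      define L where "L = ln (real n)"
      have x0: "x n \<ge> 0" by (simp add: x_def)
      show ?case
      proof (cases "x n < 1")
        case True
        have "T0 \<le> real n * exp (-1)" by (fact elim)
        also have "\<dots> \<le> real n * exp (- x n)" using True by (intro mult_left_mono) auto
        finally have "T0 \<le> real n * degree_weight 0 (x n)" by (simp add: degree_weight_def)
        then have "measure_pmf.prob (M n) {S. degree_count n 0 S = 0} \<le> \<epsilon>"
          using elim(1,2) unfolding M_def x_def by blast
        then show ?thesis using cover[of 0 n] kq by simp
      next
        case False
        have "T1 * fact q \<le> real n * (x n ^ q * exp (- x n))"
        proof (cases "x n \<le> L / 2")
          case True
          have "T1 * fact q \<le> real n * exp (- (L / 2))" using elim(5) by (simp add: L_def)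
          also have "\<dots> \<le> real n * exp (- x n)" using True by (intro mult_left_mono) auto
          also have "\<dots> \<le> real n * (x n ^ q * exp (- x n))"
            using False one_le_power[of "x n" q] by (intro mult_left_mono) auto
          finally show ?thesis .
        next
          case False
          have "T1 * fact q * 2 ^ q \<le> real n * L ^ q * exp (- x n)" using elim(6,7) by (simp add: L_def)
          then have "T1 * fact q \<le> real n * (L ^ q * exp (- x n)) / 2 ^ q" by (simp add: field_simps)
          also have "\<dots> = real n * ((L / 2) ^ q * exp (- x n))" by (simp add: power_divide)
          also have "\<dots> \<le> real n * (x n ^ q * exp (- x n))"
            using False elim(8) by (intro mult_left_mono mult_right_mono power_mono) (auto simp: L_def)
          finally show ?thesis .
        qed
        then have "T1 \<le> real n * degree_weight q (x n)" by (simp add: degree_weight_def field_simps)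
        then have "measure_pmf.prob (M n) {S. degree_count n q S = 0} \<le> \<epsilon>"
          using elim(1,3) False unfolding M_def x_def by (meson not_less)
        then show ?thesis using cover[of q n] kq by simp
      qed
    qed
  qed (rule C01)
  have botC: "C \<longlonglongrightarrow> 0" if al: "filterlim \<alpha> at_bot sequentially"
    by (rule tendsto_sandwich[OF _ CD tendsto_const bot[OF al]]) (simp add: C01)

  \<comment> \<open>Below \<open>3 ln n\<close> the expected number of nodes of degree less than
    \<open>k\<close> is at most a constant times \<open>exp (- \<alpha> n)\<close>; above it the
    comparison with a larger pool applies.\<close>
  have top: "C \<longlonglongrightarrow> 1" if al: "filterlim \<alpha> at_top sequentially"
  proof -
    have "(\<lambda>n. 1 - C n) \<longlonglongrightarrow> 0"
    proof (rule tendsto_zero_of_eventually_le)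
      fix \<epsilon> :: real assume eps: "\<epsilon> > 0"
      have "((\<lambda>n. exp (- \<alpha> n)) \<longlongrightarrow> 0) sequentially"
        by (rule filterlim_compose[OF exp_at_bot]) (use al in \<open>simp add: filterlim_uminus_at_bot\<close>)
      then have "(\<lambda>n. 3 * (4 ^ q * exp (- \<alpha> n))) \<longlonglongrightarrow> 3 * (4 ^ q * 0)" by (intro tendsto_intros)
      then have e1: "\<forall>\<^sub>F n in sequentially. 3 * (4 ^ q * exp (- \<alpha> n)) < \<epsilon> / 2"
        by (rule order_tendstoD) (use eps in simp)
      have e2: "\<forall>\<^sub>F n in sequentially. 0 \<le> \<alpha> n" using al by (simp add: filterlim_at_top)
      show "\<forall>\<^sub>F n in sequentially. 1 - C n \<le> \<epsilon>"
        using e1 e2 x_eq exp_x L1 KP Kc prob_k_connected_ge[OF c eps assms(1)] prob_k_connected_dense_ge[OF c eps assms(1)]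
      proof eventually_elim
        case (elim n)
        have "1 - \<epsilon> \<le> C n"
        proof (cases "x n \<le> 3 * ln (real n)")
          case True
          have "admissible c n (P n) (K n)" using elim(6,7) True by (simp add: admissible_def x_def)
          moreover have "0 \<le> real q * ln (ln (real n))" using elim(5) by simp
          then have "ln (real n) \<le> x n" using elim(2,3) by linarith
          moreover have "3 * (real n * (4 * ln (real n)) ^ (k - 1) * exp (- x n)) \<le> \<epsilon> / 2"
          proof -
            have "3 * (real n * (4 * ln (real n)) ^ (k - 1) * exp (- x n)) = 3 * (4 ^ q * (real n * ln (real n) ^ q * exp (- x n)))"
              by (simp add: power_mult_distrib q_def)
            then show ?thesis using elim(1) unfolding elim(4) by linarith
          qed
          ultimately show ?thesis using elim(8) unfolding C_def M_def x_def by blast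
        next
          case False
          then show ?thesis using elim(6,7,9) unfolding C_def M_def x_def by (meson not_le)
        qed
        then show ?case by simp
      qed
    qed (use C01 in simp)
    from tendsto_diff[OF tendsto_const[of 1] this] show ?thesis by simp
  qed
  have topD: "D \<longlonglongrightarrow> 1" if al: "filterlim \<alpha> at_top sequentially"
    by (rule tendsto_sandwich[OF CD _ top[OF al] tendsto_const]) (simp add: C01)

  have mid: "C \<longlonglongrightarrow> exp (- (exp (- a) / fact q)) \<and> D \<longlonglongrightarrow> exp (- (exp (- a) / fact q))" if al: "\<alpha> \<longlonglongrightarrow> a" for a
  proof -
    have a1: "\<forall>\<^sub>F n in sequentially. \<alpha> n < a + 1" "\<forall>\<^sub>F n in sequentially. a - 1 < \<alpha> n"
      using al by (auto intro: order_tendstoD)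
    have e2: "\<forall>\<^sub>F n in sequentially. ln (real n) + real q * ln (ln (real n)) + (a + 1) \<le> 3 * ln (real n)" by real_asymp
    have "\<forall>\<^sub>F n in sequentially. x n \<le> 3 * ln (real n)"
      using a1(1) e2 x_eq by eventually_elim linarith
    note adm = admI[OF this]
    define C0 where "C0 = \<bar>a\<bar> + 1"
    have low: "\<forall>\<^sub>F n in sequentially. ln (real n) - C0 \<le> x n"
      using a1(2) x_eq L1
    proof eventually_elim
      case (elim n)
      have "0 \<le> real q * ln (ln (real n))" using elim(3) by simp
      then show ?case using elim(1,2) unfolding C0_def by linarith
    qed
    have "\<forall>\<^sub>F n in sequentially. ln (real n) - C0 \<ge> 1" by real_asymp
    with low have x1: "\<forall>\<^sub>F n in sequentially. 1 \<le> x n" by eventually_elim linarith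
    have il: "(\<lambda>n::nat. 1 / ln (real n)) \<longlonglongrightarrow> 0" by real_asymp
    have "(\<lambda>n. (ln (real n) + real q * ln (ln (real n))) / ln (real n) + \<alpha> n * (1 / ln (real n))) \<longlonglongrightarrow> 1 + a * 0"
      by (intro tendsto_add tendsto_mult al il) real_asymp
    moreover have "\<forall>\<^sub>F n in sequentially. (ln (real n) + real q * ln (ln (real n))) / ln (real n) + \<alpha> n * (1 / ln (real n)) = x n / ln (real n)"
      using x_eq by eventually_elim (simp add: add_divide_distrib)
    ultimately have ratio: "(\<lambda>n. x n / ln (real n)) \<longlonglongrightarrow> 1" by (simp add: tendsto_cong)
    have "(\<lambda>n. (x n / ln (real n)) ^ q * exp (- \<alpha> n) / fact q) \<longlonglongrightarrow> 1 ^ q * exp (- a) / fact q"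
      by (intro tendsto_intros ratio al) simp
    moreover have "\<forall>\<^sub>F n in sequentially. (x n / ln (real n)) ^ q * exp (- \<alpha> n) / fact q = real n * degree_weight q (x n)"
      using exp_x L1
    proof eventually_elim
      case (elim n)
      show ?case unfolding elim(1)[symmetric] degree_weight_def using elim(2) by (simp add: power_divide)
    qed
    ultimately have w: "(\<lambda>n. real n * degree_weight q (x n)) \<longlonglongrightarrow> exp (- a) / fact q" by (simp add: tendsto_cong)
    \<comment> \<open>Minimum degree at least \<open>k\<close> means no node of degree exactly
      \<open>q\<close> and none of smaller degree. The former has the Poisson limit, and the latter
      changes the probability by at most \<open>Y n\<close>.\<close>
    define Z where "Z = (\<lambda>n. measure_pmf.prob (M n) {S. degree_count n q S = 0})"
    have Z: "Z \<longlonglongrightarrow> exp (- (exp (- a) / fact q))"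
      unfolding Z_def M_def
    proof (rule degree_count_poisson_limit[OF c])
      show "\<forall>\<^sub>F n in sequentially. admissible c n (P n) (K n) \<and> 1 \<le> real n * ((real (K n))\<^sup>2 / real (P n))"
        using adm x1 by eventually_elim (simp add: x_def)
      show "(\<lambda>n. real n * degree_weight q (real n * ((real (K n))\<^sup>2 / real (P n)))) \<longlonglongrightarrow> exp (- a) / fact q"
        using w unfolding x_def .
    qed
    define Y where "Y = (\<lambda>n. measure_pmf.prob (M n) {S. \<exists>v<n. card (nbh n S {v}) < q})"
    have Y: "Y \<longlonglongrightarrow> 0"
    proof (cases q)
      case 0
      then show ?thesis by (simp add: Y_def)
    next
      case (Suc l)
      \<comment> \<open>Each unit of degree below \<open>q\<close> costs a factor of order
        \<open>ln n\<close>, so already degrees up to \<open>l = q - 1\<close> have vanishing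
        expected count.\<close>
      have "(\<lambda>n. 3 * 4 ^ l * (exp (- \<alpha> n) * (1 / ln (real n)))) \<longlonglongrightarrow> 3 * 4 ^ l * (exp (- a) * 0)"
        by (intro tendsto_intros al il)
      then have lim: "(\<lambda>n. 3 * 4 ^ l * (exp (- \<alpha> n) * (1 / ln (real n)))) \<longlonglongrightarrow> 0" by simp
      show ?thesis
      proof (rule tendsto_sandwich[OF _ _ tendsto_const lim])
        show "\<forall>\<^sub>F n in sequentially. Y n \<le> 3 * 4 ^ l * (exp (- \<alpha> n) * (1 / ln (real n)))"
          using prob_small_degree_le[of c l] adm exp_x L1
        proof eventually_elim
          case (elim n)
          have "Y n = measure_pmf.prob (objects_pmf {..<n} (P n) (K n)) {S. \<exists>v<n. card (nbh n S {v}) \<le> l}"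
            by (simp add: Y_def M_def Suc less_Suc_eq_le)
          also have "\<dots> \<le> 3 * (real n * (4 * ln (real n)) ^ l * exp (- x n))" using elim(1,2) unfolding x_def by blast
          also have "\<dots> = 3 * 4 ^ l * ((real n * ln (real n) ^ q * exp (- x n)) * (1 / ln (real n)))"
            using elim(4) by (simp add: Suc power_mult_distrib)
          finally show ?case unfolding elim(3) .
        qed
      qed (simp add: Y_def)
    qed
    have ZD: "Z n - Y n \<le> D n" "D n \<le> Z n" for n
    proof -
      have "Z n \<le> measure_pmf.prob (M n) ({S. \<forall>v<n. k \<le> card (nbh n S {v})} \<union> {S. \<exists>v<n. card (nbh n S {v}) < q})"
        unfolding Z_def
      proof (rule prob_mono)
        fix S assume "S \<in> {S. degree_count n q S = 0}"
        then have "\<forall>v<n. card (nbh n S {v}) \<noteq> q" by (auto simp: degree_count_def)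
        then have "\<forall>v<n. card (nbh n S {v}) < q \<or> k \<le> card (nbh n S {v})" using kq by (metis Suc_leI nat_neq_iff)
        then show "S \<in> {S. \<forall>v<n. k \<le> card (nbh n S {v})} \<union> {S. \<exists>v<n. card (nbh n S {v}) < q}" by blast
      qed
      also have "\<dots> \<le> D n + Y n" unfolding D_def Y_def by (rule measure_Un_le) auto
      finally show "Z n - Y n \<le> D n" by simp
      show "D n \<le> Z n" unfolding D_def Z_def
        by (intro prob_mono) (use kq in \<open>fastforce simp: degree_count_def\<close>)
    qed
    have "(\<lambda>n. Z n - Y n) \<longlonglongrightarrow> exp (- (exp (- a) / fact q)) - 0" by (intro tendsto_diff Z Y)
    then have ZY: "(\<lambda>n. Z n - Y n) \<longlonglongrightarrow> exp (- (exp (- a) / fact q))" by simp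
    have Dl: "D \<longlonglongrightarrow> exp (- (exp (- a) / fact q))"
      by (rule tendsto_sandwich[OF _ _ ZY Z]) (simp_all add: ZD)
    define B where "B = (\<lambda>n. measure_pmf.prob (M n)
      {S. (\<forall>v<n. k \<le> card (nbh n S {v})) \<and> \<not> k_connected k {..<n} (intersection_edges n S)})"
    have B: "B \<longlonglongrightarrow> 0"
    proof (rule tendsto_zero_of_eventually_le)
      fix \<epsilon> :: real assume eps: "\<epsilon> > 0"
      show "\<forall>\<^sub>F n in sequentially. B n \<le> \<epsilon>"
        using min_degree_imp_k_connected_asymptotically[OF c eps assms(1), of C0] adm low
        by eventually_elim (simp add: B_def M_def x_def)
    qed (simp add: B_def)
    \<comment> \<open>Given the minimum degree, \<open>k\<close>-connectivity fails with probability
      at most \<open>B n\<close>, so both properties have the same limit.\<close>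
    have DC: "D n - B n \<le> C n" for n
    proof -
      have "D n \<le> measure_pmf.prob (M n) ({S. k_connected k {..<n} (intersection_edges n S)} \<union>
        {S. (\<forall>v<n. k \<le> card (nbh n S {v})) \<and> \<not> k_connected k {..<n} (intersection_edges n S)})"
        unfolding D_def by (intro prob_mono) auto
      also have "\<dots> \<le> C n + B n" unfolding C_def B_def by (rule measure_Un_le) auto
      finally show ?thesis by simp
    qed
    have "(\<lambda>n. D n - B n) \<longlonglongrightarrow> exp (- (exp (- a) / fact q)) - 0" by (intro tendsto_diff Dl B)
    then have DB: "(\<lambda>n. D n - B n) \<longlonglongrightarrow> exp (- (exp (- a) / fact q))" by simp
    have "C \<longlonglongrightarrow> exp (- (exp (- a) / fact q))"
      by (rule tendsto_sandwich[OF _ CD DB Dl]) (simp add: DC)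
    with Dl show ?thesis by simp
  qed
  show ?thesis
    unfolding eqC limD q_def[symmetric] using bot botC top topD mid by blast
qed

end
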